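(* Assume $R1=1$ and that $m(x_0)$ satisfies the $E(l)$ condition. Let $E_1$ be the eigenspace of $m(x_0)$ for the eigenvalue $1$. (1) The limit $\mathcal P(\tilde x):=\lim_{k\to\infty}m^{(k)}(\tilde r^{-k}(\tilde x))$ exists for all $\tilde x\in\tilde X$, and is uniform on compact sets. The refinement equation $\mathcal P(\tilde r^{-1}\tilde x)\,m(\tilde r^{-1}\tilde x)=\mathcal P(\tilde x)$ holds for all $\tilde x\in\tilde X$. $\mathcal P(\tilde x_0)$ is the orthogonal projection onto $E_1$. The range of $\mathcal P(\tilde x)$ is contained in $E_1$, i.e. $m(x_0)\mathcal P(\tilde x)=\mathcal P(\tilde x)$ for all $\tilde x\in\tilde X$. For all $g\in G$ with $g\ne1$ and all $v\in E_1$, $\mathcal P(g\tilde x_0)v=0$. (2) Fix a function $f\in\Xi_1$ with $\langle f,f\rangle'=1$ and $f(g\tilde x_0)=0$ for all $g\in G$, $g\ne1$. Let $s_0\in S_1$ and put $v:=s_0(x_0)$. Define $W_{s_0}\in\mathrm{Hom}_{C(X)}(S,\Xi)$ by $W_{s_0}s=\langle s_0,s\rangle f$. Then for all $s\in S$, $M^kW_{s_0}s$ converges, as $k\to\infty$, uniformly on compact sets to a continuous function $\mathcal W_vs\in\Xi$, $\mathcal W_vs(\tilde x)=\langle v,\mathcal P(\tilde x)s(p\tilde x)\rangle$, and this defines a $\mathcal W_v\in\mathrm{Hom}_{C(X)}(S,\Xi)$. Moreover $\mathcal W_v$ depends only on the value $v$ of $s_0$ at $x_0$, not on the entire section $s_0$.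 In addition $\mathcal W_v$ satisfies the refinement equation $M\mathcal W_v=\mathcal W_v$. Also, $\mathcal W_vs(\tilde x_0)=\langle\mathcal P(\tilde x_0)v,s(x_0)\rangle f(\tilde x_0)$ for all $s\in S$.
   Context: $E(l)$ condition: for $1\le l\le d$, a $d\times d$ matrix $a$ satisfies $E(l)$ if $\|a\|=1$, $1$ is the only eigenvalue of $a$ on the unit circle, and both the geometric and algebraic multiplicities of $1$ are equal to $l$. Geometric setting. $\tilde X$ is a locally compact metric space with metric $\mathrm{dist}$; a discrete group $G$ acts on $\tilde X$ isometrically and properly discontinuously (so that the quotient map is a covering map); $X:=\tilde X/G$ is compact, $p:\tilde X\to X$ is the quotient covering map. $\tilde r:\tilde X\to\tilde X$ is a homeomorphism such that for some $0<\theta<1$, $\mathrm{dist}(x,y)\le\theta\,\mathrm{dist}(\tilde rx,\tilde ry)$ for all $x,y$; $\tilde x_0$ is the fixed point of $\tilde r$ and $x_0=p(\tilde x_0)$. There is $A\in\mathrm{End}(G)$ with $AG$ a normal subgroup of $G$ and $\tilde r(gx)=(Ag)\tilde r(x)$ for all $g\in G$, $x\in\tilde X$. $r:X\to X$ is defined by $r(p(x))=p(\tilde r(x))$. $g_1=1,g_2,\dots,g_q$ is a (finite) complete system of representatives of the right cosets of $AG$ in $G$, and $\psi_i=\tilde r^{-1}\circ g_i$; thus $\{p\psi_1x,\dots,p\psi_qx\}=r^{-1}(px)$. There are regular measures $\tilde\mu$ on $\tilde X$ and $\mu$ on $X$ with $\int_X f\,d\mu=\int_X q^{-1}\sum_{r(s)=t}f(s)\,d\mu(t)$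 and $\int_{\tilde X}f\,d\tilde\mu=\int_X\sum_{g\in G}f\circ g\,d\mu$ for $f\in C_c(\tilde X)$. Bundle. $\xi\to X$ is a Lipschitz continuous $d$-dimensional complex vector bundle with a hermitian metric $\langle\cdot,\cdot\rangle$ (conjugate linear in the first variable); $S$ is the $C(X)$-Hilbert module of continuous sections; $\mathrm{End}(\xi)$ is the $C^*$-algebra of continuous bundle maps $\xi\to\xi$ over the identity with norm $\|F\|_\infty=\sup_{x\in X}\|F(x)\|$. The pullback $p^*\xi$ is assumed trivial and is identified, by a fiberwise isometric Lipschitz isomorphism, with $\tilde X\times\mathbb C^d$ (standard inner product); so for a section $s$ of $\xi$, $p^*s$ is a function $\tilde X\to\mathbb C^d$. $S_1$ is the set of $s\in S$ with $p^*s$ Lipschitz. Transfer operator. $m:r^*\xi\to\xi$ is a bundle map, i.e. linear maps $m(y):\xi_{r(y)}\to\xi_y$, with adjoint $m^*(y)$. The transfer operator is $(Rh)(px)=\sum_{i=1}^q m^*(p\psi_ix)h(p\psi_ix)m(p\psi_ix)$ for $h\in\mathrm{End}(\xi)$, $x\in\tilde X$. Via the trivialization of $p^*\xi$, $m\circ p=p^*m$ is identified with a function $\tilde X\to M_d(\mathbb C)$, also denoted $m$; $m(x_0)$ means its value at $\tilde x_0$, and likewise $s(x_0)$, $s(p\tilde x)$ mean $p^*s(\tilde x_0)$, $p^*s(\tilde x)\in\mathbb C^d$. Standing assumptions: $m$ is Lipschitz continuous and $\sup_k\|R^k\|_\infty<\infty$. Put $m^{(k)}(x)=m(x)m(\tilde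 rx)\cdots m(\tilde r^{k-1}x)$, $x\in\tilde X$, so $m^{(k)}(\tilde r^{-k}x)=m(\tilde r^{-k}x)\cdots m(\tilde r^{-1}x)$. Refinement operator. $\Xi$ is the set of bounded continuous $f:\tilde X\to\mathbb C$ such that $x\mapsto\sum_{g\in G}|f(gx)|^2$ is bounded and continuous; it is a $C(X)$-Hilbert module with $\langle f_1,f_2\rangle'=\sum_{g\in G}\overline{f_1\circ g}\;f_2\circ g$ (viewed as a function on $X$). $\Xi_1$ is the set of $f\in\Xi$ for which there is $D>0$ with $(\sum_{g\in G}|f(gx)-f(gy)|^2)^{1/2}\le D\,\mathrm{dist}(x,y)$ for all $x,y\in\tilde X$. $\mathrm{Hom}_{C(X)}(S,\Xi)$ is the set of adjointable $C(X)$-linear maps $S\to\Xi$. The refinement operator is $(MW)s=\big(W(m\,s\circ r)\big)\circ\tilde r^{-1}$ for $W\in\mathrm{Hom}_{C(X)}(S,\Xi)$, $s\in S$, where $m\,s\circ r$ is the section $y\mapsto m(y)s(r(y))$.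
   Formalization: The limit is W_v s(x)=⟨v,P(x)s(px)⟩f(x̃_0): the printed formula lacks the factor f(x̃_0), which need only have modulus 1. In P(g x̃_0)v=0, v∈E_1 is first rewritten from fibre coordinates at x̃_0 to those at g x̃_0, as the trivialization may differ there. *)

theory Defs
  imports "HOL-Analysis.Analysis" "HOL-Algebra.Group_Action"
    "HOL-Computational_Algebra.Polynomial"
begin

text \<open>The standard inner product of \<open>complex ^ 'd\<close>, conjugate linear in the first variable.  The norm of
  the type \<open>complex ^ 'd\<close> is the one it induces; the type-class norm of a matrix is the Frobenius
  norm, so the norm of the condition E(l) is written with \<open>onorm\<close>.\<close>

definition cinner_std :: "complex ^ 'd \<Rightarrow> complex ^ 'd \<Rightarrow> complex" where
  "cinner_std u v = (\<Sum>i\<in>UNIV. cnj (u $ i) * v $ i)"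

definition adjoint_matrix :: "complex ^ 'd ^ 'd \<Rightarrow> complex ^ 'd ^ 'd" where
  "adjoint_matrix a = (\<chi> i j. cnj (a $ j $ i))"

definition charpoly :: "complex ^ 'd ^ 'd \<Rightarrow> complex poly" where
  "charpoly a = det (\<chi> i j. (if i = j then [:0, 1:] else 0) - [:a $ i $ j:])"

definition E_condition :: "nat \<Rightarrow> complex ^ 'd ^ 'd \<Rightarrow> bool" where
  "E_condition l a \<longleftrightarrow>
     onorm ((*v) a) = 1 \<and>
     (\<forall>ev v. v \<noteq> 0 \<and> a *v v = ev *s v \<and> cmod ev = 1 \<longrightarrow> ev = 1) \<and>
     vec.dim {v. a *v v = 1 *s v} = l \<and>
     Polynomial.order 1 (charpoly a) = l"

definition is_orth_proj_onto :: "complex ^ 'd ^ 'd \<Rightarrow> (complex ^ 'd) set \<Rightarrow> bool" where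
  "is_orth_proj_onto P E \<longleftrightarrow> P ** P = P \<and> adjoint_matrix P = P \<and> range ((*v) P) = E"

definition locally_lipschitz_on ::
    "'a::metric_space set \<Rightarrow> ('a \<Rightarrow> 'b::metric_space) \<Rightarrow> bool" where
  "locally_lipschitz_on U F \<longleftrightarrow>
     (\<forall>x\<in>U. \<exists>e>0. \<exists>L. L-lipschitz_on (ball x e \<inter> U) F)"

text \<open>The quotient space is a type \<open>'y\<close> with a quotient map \<open>p\<close> whose fibres are the orbits.  Its
  metric is the distance of orbits; this metric induces the quotient topology, so \<open>quotient_map\<close>
  only records the topology explicitly.  Since HOL-Algebra uses the symbol \<open>inv\<close> for inverses in a
  group, inverse functions are written \<open>inv_into UNIV\<close>.\<close>

locale dilation_covering =
  fixes G :: "('g, 'b) monoid_scheme"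
    and act :: "'g \<Rightarrow> 'x::metric_space \<Rightarrow> 'x"
    and p :: "'x \<Rightarrow> 'y::metric_space"
    and rt :: "'x \<Rightarrow> 'x"
    and r :: "'y \<Rightarrow> 'y"
    and \<theta> :: real
    and x0 :: 'x
    and A :: "'g \<Rightarrow> 'g"
    and q :: nat
    and gs :: "nat \<Rightarrow> 'g"
  assumes locally_compact: "locally_compact_space (euclidean :: 'x topology)"
    and group: "group G"
    and action: "group_action G UNIV act"
    and isometric: "\<And>g x y. g \<in> carrier G \<Longrightarrow> dist (act g x) (act g y) = dist x y"
    and properly_discontinuous:
      "\<And>x. \<exists>U. open U \<and> x \<in> U \<and> (\<forall>g\<in>carrier G. g \<noteq> \<one>\<^bsub>G\<^esub> \<longrightarrow> act g ` U \<inter> U = {})"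
    and quotient: "quotient_map euclidean euclidean p"
    and fibres: "\<And>x y. p x = p y \<longleftrightarrow> (\<exists>g\<in>carrier G. y = act g x)"
    and quotient_dist: "\<And>x y. dist (p x) (p y) = (INF g\<in>carrier G. dist x (act g y))"
    and compact_quotient: "compact (UNIV :: 'y set)"
    and homeo: "homeomorphism UNIV UNIV rt (inv_into UNIV rt)"
    and theta: "0 < \<theta>" "\<theta> < 1"
    and expanding: "\<And>x y. dist x y \<le> \<theta> * dist (rt x) (rt y)"
    and fixed_point: "rt x0 = x0"
    and endo: "A \<in> hom G G"
    and normal_image: "(A ` carrier G) \<lhd> G"
    and equivariant: "\<And>g x. g \<in> carrier G \<Longrightarrow> rt (act g x) = act (A g) (rt x)"
    and quotient_dilation: "\<And>x. r (p x) = p (rt x)"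
    and reps_carrier: "\<And>i. i \<in> {1..q} \<Longrightarrow> gs i \<in> carrier G"
    and reps_one: "gs 1 = \<one>\<^bsub>G\<^esub>"
    and reps: "bij_betw (\<lambda>i. (A ` carrier G) #>\<^bsub>G\<^esub> gs i) {1..q} (rcosets\<^bsub>G\<^esub> (A ` carrier G))"

text \<open>The bundle has the total space \<open>'e\<close> and the projection \<open>\<pi>\<close>; \<open>vadd\<close>, \<open>smul\<close> and \<open>ip\<close> are the
  fibrewise operations and the hermitian metric, and they are only meaningful for two vectors of
  the same fibre.  A chart is a pair \<open>(U, t)\<close> where \<open>t y\<close>, for \<open>y \<in> U\<close>, is an isomorphism from
  \<open>complex ^ 'd\<close> to the fibre over \<open>y\<close>.  Since charts are fibrewise bijective and compatible with \<open>vadd\<close>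
  and \<open>smul\<close>, the vector space axioms in the fibres follow.\<close>

definition local_trivialization ::
    "('e::topological_space \<Rightarrow> 'y::topological_space) \<Rightarrow> ('e \<Rightarrow> 'e \<Rightarrow> 'e) \<Rightarrow> (complex \<Rightarrow> 'e \<Rightarrow> 'e) \<Rightarrow>
     'y set \<Rightarrow> ('y \<Rightarrow> complex ^ 'd \<Rightarrow> 'e) \<Rightarrow> bool" where
  "local_trivialization \<pi> vadd smul U t \<longleftrightarrow>
     open U \<and>
     (\<exists>t'. homeomorphism (U \<times> UNIV) (\<pi> -` U) (\<lambda>(y, v). t y v) t') \<and>
     (\<forall>y\<in>U. \<forall>u v c. \<pi> (t y v) = y \<and> t y (u + v) = vadd (t y u) (t y v) \<and>
        t y (c *s v) = smul c (t y v))"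

locale lipschitz_hermitian_bundle =
  fixes \<pi> :: "'e::topological_space \<Rightarrow> 'y::metric_space"
    and vadd :: "'e \<Rightarrow> 'e \<Rightarrow> 'e"
    and smul :: "complex \<Rightarrow> 'e \<Rightarrow> 'e"
    and ip :: "'e \<Rightarrow> 'e \<Rightarrow> complex"
    and charts :: "('y set \<times> ('y \<Rightarrow> complex ^ 'd \<Rightarrow> 'e)) set"
  assumes charts: "\<And>U t. (U, t) \<in> charts \<Longrightarrow> local_trivialization \<pi> vadd smul U t"
    and charts_cover: "(\<Union>(U, t)\<in>charts. U) = UNIV"
    and lipschitz_transition:
      "\<And>U t U' t'. (U, t) \<in> charts \<Longrightarrow> (U', t') \<in> charts \<Longrightarrow>
         locally_lipschitz_on (U \<inter> U') (\<lambda>y. matrix (\<lambda>v. inv_into UNIV (t y) (t' y v)))"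
    and ip_continuous: "continuous_on {(a, b). \<pi> a = \<pi> b} (\<lambda>(a, b). ip a b)"
    and ip_add: "\<And>a b c. \<pi> a = \<pi> b \<Longrightarrow> \<pi> b = \<pi> c \<Longrightarrow> ip a (vadd b c) = ip a b + ip a c"
    and ip_scale: "\<And>a b z. \<pi> a = \<pi> b \<Longrightarrow> ip a (smul z b) = z * ip a b"
    and ip_hermitian: "\<And>a b. \<pi> a = \<pi> b \<Longrightarrow> ip b a = cnj (ip a b)"
    and ip_nonneg: "\<And>a. 0 \<le> Re (ip a a)"
    and ip_definite: "\<And>a. ip a a = 0 \<Longrightarrow> a = smul 0 a"

definition fibre_norm :: "('e \<Rightarrow> 'e \<Rightarrow> complex) \<Rightarrow> 'e \<Rightarrow> real" where
  "fibre_norm ip a = sqrt (Re (ip a a))"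

definition sections :: "('e::topological_space \<Rightarrow> 'y::topological_space) \<Rightarrow> ('y \<Rightarrow> 'e) set" where
  "sections \<pi> = {s. continuous_on UNIV s \<and> (\<forall>y. \<pi> (s y) = y)}"

definition bundle_endos ::
    "('e::topological_space \<Rightarrow> 'y) \<Rightarrow> ('e \<Rightarrow> 'e \<Rightarrow> 'e) \<Rightarrow> (complex \<Rightarrow> 'e \<Rightarrow> 'e) \<Rightarrow> ('e \<Rightarrow> 'e) set" where
  "bundle_endos \<pi> vadd smul =
     {h. continuous_on UNIV h \<and> (\<forall>a. \<pi> (h a) = \<pi> a) \<and>
         (\<forall>a b. \<pi> a = \<pi> b \<longrightarrow> h (vadd a b) = vadd (h a) (h b)) \<and>
         (\<forall>z a. h (smul z a) = smul z (h a))}"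

definition endo_norm :: "('e \<Rightarrow> 'y) \<Rightarrow> ('e \<Rightarrow> 'e \<Rightarrow> complex) \<Rightarrow> ('e \<Rightarrow> 'e) \<Rightarrow> real" where
  "endo_norm \<pi> ip h =
     (SUP y. SUP a\<in>{a. \<pi> a = y \<and> fibre_norm ip a \<le> 1}. fibre_norm ip (h a))"

text \<open>\<open>\<tau> x\<close> is the identification of \<open>complex ^ 'd\<close> with the fibre of the pulled back bundle over \<open>x\<close>,
  that is, with the fibre over \<open>p x\<close>; \<open>coord \<tau> x\<close> is its inverse.
  The points \<open>act g x0\<close> lie over the same point as \<open>x0\<close>, but the identifications there may differ: the
  vector with coordinates \<open>v\<close> at \<open>x0\<close> has coordinates \<open>coord \<tau> (act g x0) (\<tau> x0 v)\<close> at \<open>act g x0\<close>.\<close>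

definition coord :: "('x \<Rightarrow> complex ^ 'd \<Rightarrow> 'e) \<Rightarrow> 'x \<Rightarrow> 'e \<Rightarrow> complex ^ 'd" where
  "coord \<tau> x = inv_into UNIV (\<tau> x)"

definition pull_section ::
    "('x \<Rightarrow> 'y) \<Rightarrow> ('x \<Rightarrow> complex ^ 'd \<Rightarrow> 'e) \<Rightarrow> ('y \<Rightarrow> 'e) \<Rightarrow> 'x \<Rightarrow> complex ^ 'd" where
  "pull_section p \<tau> s x = coord \<tau> x (s (p x))"

text \<open>\<open>m y\<close> maps the fibre over \<open>r y\<close> to the fibre over \<open>y\<close>.  For \<open>y = p x\<close> the former is the fibre
  over \<open>p (rt x)\<close>, which is identified with \<open>complex ^ 'd\<close> at the point \<open>rt x\<close>.\<close>

definition pull_filter ::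
    "('x \<Rightarrow> 'y) \<Rightarrow> ('x \<Rightarrow> 'x) \<Rightarrow> ('x \<Rightarrow> complex ^ 'd \<Rightarrow> 'e) \<Rightarrow> ('y \<Rightarrow> 'e \<Rightarrow> 'e) \<Rightarrow>
     'x \<Rightarrow> complex ^ 'd ^ 'd" where
  "pull_filter p rt \<tau> m x = matrix (\<lambda>v. coord \<tau> x (m (p x) (\<tau> (rt x) v)))"

definition lipschitz_sections ::
    "('e::topological_space \<Rightarrow> 'y::topological_space) \<Rightarrow> ('x::metric_space \<Rightarrow> 'y) \<Rightarrow>
     ('x \<Rightarrow> complex ^ 'd \<Rightarrow> 'e) \<Rightarrow> ('y \<Rightarrow> 'e) set" where
  "lipschitz_sections \<pi> p \<tau> =
     {s \<in> sections \<pi>. \<exists>L. L-lipschitz_on UNIV (pull_section p \<tau> s)}"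

definition filter_adjoint ::
    "('e \<Rightarrow> 'y) \<Rightarrow> ('e \<Rightarrow> 'e \<Rightarrow> complex) \<Rightarrow> ('y \<Rightarrow> 'y) \<Rightarrow> ('y \<Rightarrow> 'e \<Rightarrow> 'e) \<Rightarrow> 'y \<Rightarrow> 'e \<Rightarrow> 'e" where
  "filter_adjoint \<pi> ip r m y a =
     (THE b. \<pi> b = r y \<and> (\<forall>u. \<pi> u = r y \<longrightarrow> ip u b = ip (m y u) a))"

text \<open>The value of \<open>R h\<close> on the vector \<open>a\<close> of the fibre over \<open>p x = \<pi> a\<close>, where \<open>\<psi> i = rt\<inverse> \<circ> gs i\<close>.  The
  sum is the sum of the vector space given by the fibre, with zero vector \<open>smul 0 a\<close>.\<close>

definition transfer_op ::
    "('g \<Rightarrow> 'x \<Rightarrow> 'x) \<Rightarrow> ('x \<Rightarrow> 'y) \<Rightarrow> ('x \<Rightarrow> 'x) \<Rightarrow> ('y \<Rightarrow> 'y) \<Rightarrow> nat \<Rightarrow> (nat \<Rightarrow> 'g) \<Rightarrow>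
     ('e \<Rightarrow> 'y) \<Rightarrow> ('e \<Rightarrow> 'e \<Rightarrow> 'e) \<Rightarrow> (complex \<Rightarrow> 'e \<Rightarrow> 'e) \<Rightarrow> ('e \<Rightarrow> 'e \<Rightarrow> complex) \<Rightarrow>
     ('y \<Rightarrow> 'e \<Rightarrow> 'e) \<Rightarrow> ('e \<Rightarrow> 'e) \<Rightarrow> 'e \<Rightarrow> 'e" where
  "transfer_op act p rt r q gs \<pi> vadd smul ip m h a =
     (let x = inv_into UNIV p (\<pi> a);
          \<psi> = (\<lambda>i. inv_into UNIV rt (act (gs i) x))
      in foldr vadd
           (map (\<lambda>i. filter_adjoint \<pi> ip r m (p (\<psi> i)) (h (m (p (\<psi> i)) a))) [1..<Suc q])
           (smul 0 a))"

locale transfer_setting =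
  dilation_covering G act p rt r \<theta> x0 A q gs +
  lipschitz_hermitian_bundle \<pi> vadd smul ip charts
  for G :: "('g, 'b) monoid_scheme"
    and act :: "'g \<Rightarrow> 'x::metric_space \<Rightarrow> 'x"
    and p :: "'x \<Rightarrow> 'y::metric_space"
    and rt :: "'x \<Rightarrow> 'x"
    and r :: "'y \<Rightarrow> 'y"
    and \<theta> :: real
    and x0 :: 'x
    and A :: "'g \<Rightarrow> 'g"
    and q :: nat
    and gs :: "nat \<Rightarrow> 'g"
    and \<pi> :: "'e::topological_space \<Rightarrow> 'y"
    and vadd :: "'e \<Rightarrow> 'e \<Rightarrow> 'e"
    and smul :: "complex \<Rightarrow> 'e \<Rightarrow> 'e"
    and ip :: "'e \<Rightarrow> 'e \<Rightarrow> complex"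
    and charts :: "('y set \<times> ('y \<Rightarrow> complex ^ 'd \<Rightarrow> 'e)) set" +
  fixes \<tau> :: "'x \<Rightarrow> complex ^ 'd \<Rightarrow> 'e"
    and m :: "'y \<Rightarrow> 'e \<Rightarrow> 'e"
  assumes triv_homeo:
      "\<exists>\<tau>'. homeomorphism UNIV {(x, a). p x = \<pi> a} (\<lambda>(x, v). (x, \<tau> x v)) \<tau>'"
    and triv_add: "\<And>x u v. \<tau> x (u + v) = vadd (\<tau> x u) (\<tau> x v)"
    and triv_scale: "\<And>x c v. \<tau> x (c *s v) = smul c (\<tau> x v)"
    and triv_isometric: "\<And>x u v. ip (\<tau> x u) (\<tau> x v) = cinner_std u v"
    and triv_lipschitz:
      "\<And>U t. (U, t) \<in> charts \<Longrightarrow>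
         locally_lipschitz_on (p -` U) (\<lambda>x. matrix (\<lambda>v. inv_into UNIV (t (p x)) (\<tau> x v)))"
    and filter_fibre: "\<And>y a. \<pi> a = r y \<Longrightarrow> \<pi> (m y a) = y"
    and filter_add:
      "\<And>y a b. \<pi> a = r y \<Longrightarrow> \<pi> b = r y \<Longrightarrow> m y (vadd a b) = vadd (m y a) (m y b)"
    and filter_scale: "\<And>y z a. \<pi> a = r y \<Longrightarrow> m y (smul z a) = smul z (m y a)"
    and filter_continuous: "continuous_on {(y, a). r y = \<pi> a} (\<lambda>(y, a). m y a)"
    and filter_lipschitz: "\<exists>L. L-lipschitz_on UNIV (pull_filter p rt \<tau> m)"
    and transfer_power_bounded:
      "\<exists>C. \<forall>k. \<forall>h\<in>bundle_endos \<pi> vadd smul.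
         endo_norm \<pi> ip ((transfer_op act p rt r q gs \<pi> vadd smul ip m ^^ k) h) \<le> C * endo_norm \<pi> ip h"

fun filter_product ::
    "('x \<Rightarrow> complex ^ 'd ^ 'd) \<Rightarrow> ('x \<Rightarrow> 'x) \<Rightarrow> nat \<Rightarrow> 'x \<Rightarrow> complex ^ 'd ^ 'd" where
  "filter_product mt rt 0 x = mat 1"
| "filter_product mt rt (Suc k) x = filter_product mt rt k x ** mt ((rt ^^ k) x)"

definition backward_product ::
    "('x \<Rightarrow> complex ^ 'd ^ 'd) \<Rightarrow> ('x \<Rightarrow> 'x) \<Rightarrow> nat \<Rightarrow> 'x \<Rightarrow> complex ^ 'd ^ 'd" where
  "backward_product mt rt k x = filter_product mt rt k ((inv_into UNIV rt ^^ k) x)"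

text \<open>\<open>lim\<close> is meaningful only if the limit exists, which is part of the theorem.\<close>

definition limit_product ::
    "('x \<Rightarrow> complex ^ 'd ^ 'd) \<Rightarrow> ('x \<Rightarrow> 'x) \<Rightarrow> 'x \<Rightarrow> complex ^ 'd ^ 'd" where
  "limit_product mt rt x = lim (\<lambda>k. backward_product mt rt k x)"

definition Xi :: "('g, 'b) monoid_scheme \<Rightarrow> ('g \<Rightarrow> 'x::metric_space \<Rightarrow> 'x) \<Rightarrow> ('x \<Rightarrow> complex) set" where
  "Xi G act =
     {f. continuous_on UNIV f \<and> bounded (range f) \<and>
         (\<forall>x. (\<lambda>g. (cmod (f (act g x)))\<^sup>2) summable_on carrier G) \<and>
         continuous_on UNIV (\<lambda>x. \<Sum>\<^sub>\<infinity>g\<in>carrier G. (cmod (f (act g x)))\<^sup>2) \<and>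
         bounded (range (\<lambda>x. \<Sum>\<^sub>\<infinity>g\<in>carrier G. (cmod (f (act g x)))\<^sup>2))}"

definition Xi1 :: "('g, 'b) monoid_scheme \<Rightarrow> ('g \<Rightarrow> 'x::metric_space \<Rightarrow> 'x) \<Rightarrow> ('x \<Rightarrow> complex) set" where
  "Xi1 G act =
     {f \<in> Xi G act. \<exists>D>0. \<forall>x y.
        sqrt (\<Sum>\<^sub>\<infinity>g\<in>carrier G. (cmod (f (act g x) - f (act g y)))\<^sup>2) \<le> D * dist x y}"

text \<open>The inner product is viewed as a function on the quotient; it does not depend on the
  chosen preimage of \<open>y\<close>.\<close>

definition Xi_inner ::
    "('g, 'b) monoid_scheme \<Rightarrow> ('g \<Rightarrow> 'x \<Rightarrow> 'x) \<Rightarrow> ('x \<Rightarrow> 'y) \<Rightarrow>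
     ('x \<Rightarrow> complex) \<Rightarrow> ('x \<Rightarrow> complex) \<Rightarrow> 'y \<Rightarrow> complex" where
  "Xi_inner G act p f1 f2 y =
     (\<Sum>\<^sub>\<infinity>g\<in>carrier G. cnj (f1 (act g (inv_into UNIV p y))) * f2 (act g (inv_into UNIV p y)))"

definition Hom_module ::
    "('g, 'b) monoid_scheme \<Rightarrow> ('g \<Rightarrow> 'x::metric_space \<Rightarrow> 'x) \<Rightarrow> ('x \<Rightarrow> 'y::topological_space) \<Rightarrow>
     ('e::topological_space \<Rightarrow> 'y) \<Rightarrow> ('e \<Rightarrow> 'e \<Rightarrow> 'e) \<Rightarrow> (complex \<Rightarrow> 'e \<Rightarrow> 'e) \<Rightarrow> ('e \<Rightarrow> 'e \<Rightarrow> complex) \<Rightarrow>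
     (('y \<Rightarrow> 'e) \<Rightarrow> 'x \<Rightarrow> complex) set" where
  "Hom_module G act p \<pi> vadd smul ip =
     {W. (\<forall>s\<in>sections \<pi>. W s \<in> Xi G act) \<and>
         (\<forall>s\<in>sections \<pi>. \<forall>t\<in>sections \<pi>. W (\<lambda>y. vadd (s y) (t y)) = (\<lambda>x. W s x + W t x)) \<and>
         (\<forall>c. continuous_on UNIV c \<longrightarrow> (\<forall>s\<in>sections \<pi>.
            W (\<lambda>y. smul (c y) (s y)) = (\<lambda>x. c (p x) * W s x))) \<and>
         (\<exists>V. (\<forall>f\<in>Xi G act. V f \<in> sections \<pi>) \<and>
            (\<forall>s\<in>sections \<pi>. \<forall>f\<in>Xi G act. \<forall>y. Xi_inner G act p (W s) f y = ip (s y) (V f y)))}"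

definition refinement_op ::
    "('x \<Rightarrow> 'x) \<Rightarrow> ('y \<Rightarrow> 'y) \<Rightarrow> ('y \<Rightarrow> 'e \<Rightarrow> 'e) \<Rightarrow>
     (('y \<Rightarrow> 'e) \<Rightarrow> 'x \<Rightarrow> complex) \<Rightarrow> ('y \<Rightarrow> 'e) \<Rightarrow> 'x \<Rightarrow> complex" where
  "refinement_op rt r m W s = W (\<lambda>y. m y (s (r y))) \<circ> inv_into UNIV rt"

definition start_map ::
    "('x \<Rightarrow> 'y) \<Rightarrow> ('e \<Rightarrow> 'e \<Rightarrow> complex) \<Rightarrow> ('x \<Rightarrow> complex) \<Rightarrow> ('y \<Rightarrow> 'e) \<Rightarrow> ('y \<Rightarrow> 'e) \<Rightarrow> 'x \<Rightarrow> complex" where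
  "start_map p ip f s0 s x = ip (s0 (p x)) (s (p x)) * f x"

text \<open>The limit of the iterates of \<open>start_map\<close>, defined from the whole section \<open>s0\<close>; that the limit
  exists and depends only on the value of \<open>s0\<close> at the fixed point is part of the theorem.\<close>

definition limit_map ::
    "('x \<Rightarrow> 'y) \<Rightarrow> ('x \<Rightarrow> 'x) \<Rightarrow> ('y \<Rightarrow> 'y) \<Rightarrow> ('e \<Rightarrow> 'e \<Rightarrow> complex) \<Rightarrow> ('y \<Rightarrow> 'e \<Rightarrow> 'e) \<Rightarrow>
     ('x \<Rightarrow> complex) \<Rightarrow> ('y \<Rightarrow> 'e) \<Rightarrow> ('y \<Rightarrow> 'e) \<Rightarrow> 'x \<Rightarrow> complex" where
  "limit_map p rt r ip m f s0 s x =
     lim (\<lambda>k. (refinement_op rt r m ^^ k) (start_map p ip f s0) s x)"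

end

theory Submission
  imports Defs "HOL-Computational_Algebra.Fundamental_Theorem_Algebra"
begin

text \<open>Write \<open>\<phi> = rt\<^sup>-\<^sup>1\<close>, a contraction with fixed point \<open>x0\<close>.  The condition \<open>R 1 = 1\<close> says that the squared
  norm of a fibre vector is the sum of the squared norms of its images along the \<open>q\<close> branches of \<open>r\<close>.
  In particular all factors \<open>m\<close> are contractions.

  For the first part, the late factors of the product are \<open>m(x0)\<close> up to a geometrically small error, and the powers
  of \<open>m(x0)\<close> converge to the orthogonal projection onto its fixed space.

  For the second part, \<open>(M\<^sup>k W s)(x) = \<langle>\<Phi>\<^sub>k(x), s(x)\<rangle>\<close> with \<open>\<Phi>\<^sub>0 = cnj f * s0\<close> and
  \<open>\<Phi>\<^sub>k\<^sub>+\<^sub>1 = (m\<^sup>* \<Phi>\<^sub>k) \<circ> \<phi>\<close>.  Splitting \<open>G\<close> into the cosets of \<open>A G\<close> turns the family of \<open>\<Phi>\<^sub>k\<^sub>+\<^sub>1\<close> along an orbit into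
  \<open>q\<close> such families of \<open>\<Phi>\<^sub>k\<close>, composed with the branches.  So the \<open>l\<^sup>2\<close> bound of these families is preserved,
  and their \<open>l\<^sup>2\<close> Lipschitz constants satisfy \<open>D\<^sub>k\<^sub>+\<^sub>1 \<le> \<theta> * D\<^sub>k + c\<close>.  Both bounds pass to the limit, where they make
  \<open>\<langle>W s, W s\<rangle>'\<close> and the adjoint of \<open>W\<close> continuous.\<close>

section \<open>Powers of a contraction\<close>

text \<open>The obstacle is that the trivialization of the pulled back bundle need not be
  \<open>G\<close>-invariant: one fibre vector has coordinates at \<open>x\<close> and at
  \<open>act g x\<close> that differ by a unitary \<open>shift g x\<close>, and its Lipschitz
  constant in \<open>x\<close> is not controlled uniformly over \<open>G\<close>. The Lipschitz
  estimate is therefore made over a compact set \<open>K\<close> meeting every orbit. A branch point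
  \<open>psi i x\<close> is moved back into \<open>K\<close> by some \<open>h\<close>, and by proper
  discontinuity only finitely many transition functions occur in doing so. Uniform Lipschitz bounds
  are needed because pointwise limits preserve inequalities on finite subfamilies, but not
  continuity of the infinite sums that define \<open>Xi\<close> and the adjoint. In the recursion
  the factor \<theta> must not be spoiled by the sum over \<open>q\<close> branches: the contracting
  term is weighted with the norms of the branch images, whose squares add up exactly to the squared
  norm of the vector; only the additive error pays a factor \<open>sqrt q\<close>.\<close>

lemma cinner_std_add_right: "cinner_std u (v + w) = cinner_std u v + cinner_std u w"
  by (simp add: cinner_std_def distrib_left sum.distrib)

lemma cinner_std_add_left: "cinner_std (u + v) w = cinner_std u w + cinner_std v w"
  by (simp add: cinner_std_def distrib_right sum.distrib)

lemma cinner_std_diff_right: "cinner_std u (v - w) = cinner_std u v - cinner_std u w"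
  by (simp add: cinner_std_def right_diff_distrib sum_subtractf)

lemma cinner_std_diff_left: "cinner_std (u - v) w = cinner_std u w - cinner_std v w"
  by (simp add: cinner_std_def left_diff_distrib sum_subtractf)

lemma cinner_std_scale_right: "cinner_std u (c *s v) = c * cinner_std u v"
  by (simp add: cinner_std_def sum_distrib_left mult_ac)

lemma cinner_std_scale_left: "cinner_std (c *s u) v = cnj c * cinner_std u v"
  by (simp add: cinner_std_def sum_distrib_left mult_ac)

lemma cinner_std_zero [simp]: "cinner_std u 0 = 0" "cinner_std 0 u = 0"
  by (simp_all add: cinner_std_def)

lemma cnj_cinner_std: "cnj (cinner_std u v) = cinner_std v u"
  by (simp add: cinner_std_def mult.commute)

text \<open>Bridge to the real inner product of the type, through which norm identities and real
  orthogonal decompositions become available.\<close>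

lemma Re_cinner_std: "Re (cinner_std u v) = inner u v"
  by (simp add: cinner_std_def inner_vec_def inner_complex_def)

lemma cinner_std_self: "cinner_std v v = complex_of_real ((norm v)\<^sup>2)"
proof -
  have "cnj (cinner_std v v) = cinner_std v v"
    by (rule cnj_cinner_std)
  then have "cinner_std v v = complex_of_real (Re (cinner_std v v))"
    by (metis Reals_cnj_iff of_real_Re)
  then show ?thesis
    by (simp add: Re_cinner_std power2_norm_eq_inner)
qed

lemma norm_cinner_std_le: "cmod (cinner_std u v) \<le> norm u * norm v"
proof -
  have "cmod (cinner_std u v) \<le> (\<Sum>i\<in>UNIV. \<bar>norm (u $ i)\<bar> * \<bar>norm (v $ i)\<bar>)"
    unfolding cinner_std_def by (rule order_trans[OF norm_sum]) (simp add: norm_mult)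
  also have "\<dots> \<le> norm u * norm v"
    unfolding norm_vec_def by (rule L2_set_mult_ineq)
  finally show ?thesis .
qed

lemma norm_vector_scale: "norm (c *s (v :: complex ^ 'd)) = cmod c * norm v"
  by (simp add: norm_vec_def norm_mult L2_set_right_distrib)

lemma scaleR_eq_scale: "r *\<^sub>R (v :: complex ^ 'd) = complex_of_real r *s v"
  by (simp add: vec_eq_iff scaleR_conv_of_real[where 'a = complex])

lemma bounded_bilinear_cinner_std: "bounded_bilinear cinner_std"
proof (rule bounded_bilinear.intro)
  show "cinner_std (r *\<^sub>R u) v = r *\<^sub>R cinner_std u v" for r and u v :: "complex ^ 'd"
    by (simp only: scaleR_eq_scale cinner_std_scale_left) (simp add: scaleR_conv_of_real)
  show "cinner_std u (r *\<^sub>R v) = r *\<^sub>R cinner_std u v" for r and u v :: "complex ^ 'd"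
    by (simp only: scaleR_eq_scale cinner_std_scale_right) (simp add: scaleR_conv_of_real)
  show "\<exists>K. \<forall>u v :: complex ^ 'd. cmod (cinner_std u v) \<le> norm u * norm v * K"
    by (intro exI[of _ 1]) (simp add: norm_cinner_std_le)
qed (auto simp: cinner_std_add_left cinner_std_add_right)

lemma cinner_std_axis: "cinner_std (axis i 1) v = v $ i"
proof -
  have "cinner_std (axis i 1) v = (\<Sum>j\<in>UNIV. if i = j then v $ j else 0)"
    unfolding cinner_std_def by (rule sum.cong) (auto simp: axis_def)
  then show ?thesis
    by simp
qed

lemma cinner_std_eqI: "(\<And>u. cinner_std u v = cinner_std u w) \<Longrightarrow> v = w"
  by (metis cinner_std_axis vec_eq_iff)

lemma cinner_std_adjoint: "cinner_std (adjoint_matrix M *v u) v = cinner_std u (M *v v)"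
proof -
  have "cinner_std (adjoint_matrix M *v u) v = (\<Sum>i\<in>UNIV. \<Sum>j\<in>UNIV. M $ j $ i * cnj (u $ j) * v $ i)"
    by (simp add: cinner_std_def adjoint_matrix_def matrix_vector_mult_def sum_distrib_right)
  also have "\<dots> = (\<Sum>j\<in>UNIV. \<Sum>i\<in>UNIV. M $ j $ i * cnj (u $ j) * v $ i)"
    by (rule sum.swap)
  also have "\<dots> = cinner_std u (M *v v)"
    by (simp add: cinner_std_def matrix_vector_mult_def sum_distrib_left mult_ac)
  finally show ?thesis .
qed

lemma adjoint_adjoint_matrix [simp]: "adjoint_matrix (adjoint_matrix M) = M"
  by (simp add: adjoint_matrix_def vec_eq_iff)

lemma cinner_std_adjoint': "cinner_std u (adjoint_matrix M *v v) = cinner_std (M *v u) v"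
  using cinner_std_adjoint[of "adjoint_matrix M" u v] by simp

text \<open>Cauchy-Schwarz in each row: the Frobenius norm dominates the operator norm.\<close>

lemma norm_matrix_vector_le: "norm (M *v u) \<le> norm (M :: complex ^ 'd ^ 'e) * norm u"
proof -
  have "norm ((M *v u) $ i) \<le> norm (M $ i) * norm u" for i
  proof -
    have "norm ((M *v u) $ i) \<le> (\<Sum>j\<in>UNIV. \<bar>norm (M $ i $ j)\<bar> * \<bar>norm (u $ j)\<bar>)"
      unfolding matrix_vector_mult_def vec_lambda_beta
      by (rule order_trans[OF norm_sum]) (simp add: norm_mult)
    also have "\<dots> \<le> norm (M $ i) * norm u"
      unfolding norm_vec_def[of "M $ i"] norm_vec_def[of u] by (rule L2_set_mult_ineq)
    finally show ?thesis .
  qed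
  then have "norm (M *v u) \<le> L2_set (\<lambda>i. norm (M $ i) * norm u) UNIV"
    unfolding norm_vec_def[of "M *v u"] by (intro L2_set_mono) auto
  also have "\<dots> = norm M * norm u"
    by (simp add: norm_vec_def[of M] L2_set_left_distrib)
  finally show ?thesis .
qed

text \<open>The converse comparison, entry by entry. The constant is crude; it only has to turn
  bounds on vectors, which contractions provide, into convergence of matrices.\<close>

lemma norm_matrix_le:
  fixes M :: "complex ^ 'd ^ 'd"
  assumes "\<And>u. norm (M *v u) \<le> B * norm u"
  shows "norm M \<le> (real CARD('d))\<^sup>2 * B"
proof -
  have entry: "cmod (M $ i $ j) \<le> B" for i j
  proof -
    have "M $ i $ j = (M *v axis j 1) $ i"
      by (simp add: matrix_vector_mult_def axis_def if_distrib[of "(*) _"] cong: if_cong)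
    then have "cmod (M $ i $ j) \<le> norm (M *v axis j 1)"
      using Finite_Cartesian_Product.norm_nth_le[of "M *v axis j 1" i] by simp
    also have "\<dots> \<le> B"
      using assms[of "axis j 1"] by simp
    finally show ?thesis .
  qed
  have "norm M \<le> (\<Sum>i\<in>UNIV. norm (M $ i))"
    unfolding norm_vec_def[of M] by (rule L2_set_le_sum) auto
  also have "\<dots> \<le> (\<Sum>i\<in>(UNIV::'d set). \<Sum>j\<in>(UNIV::'d set). cmod (M $ i $ j))"
    unfolding norm_vec_def[of "M $ _"] by (intro sum_mono L2_set_le_sum) auto
  also have "\<dots> \<le> (\<Sum>i\<in>(UNIV::'d set). \<Sum>j\<in>(UNIV::'d set). B)"
    by (intro sum_mono entry)
  also have "\<dots> = (real CARD('d))\<^sup>2 * B"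
    by (simp add: power2_eq_square)
  finally show ?thesis .
qed

lemma bounded_bilinear_matrix_vector_mult:
  "bounded_bilinear ((*v) :: complex ^ 'd ^ 'e \<Rightarrow> complex ^ 'd \<Rightarrow> complex ^ 'e)"
proof (rule bounded_bilinear.intro)
  show "(r *\<^sub>R M) *v u = r *\<^sub>R (M *v u)" for r and M :: "complex ^ 'd ^ 'e" and u
    by (simp add: vec_eq_iff matrix_vector_mult_def scaleR_sum_right)
  show "M *v (r *\<^sub>R u) = r *\<^sub>R (M *v u)" for r and M :: "complex ^ 'd ^ 'e" and u
    by (simp add: vec_eq_iff matrix_vector_mult_def scaleR_sum_right)
  show "\<exists>K. \<forall>(M :: complex ^ 'd ^ 'e) u. norm (M *v u) \<le> norm M * norm u * K"
    by (intro exI[of _ 1]) (simp add: norm_matrix_vector_le)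
qed (auto simp: matrix_vector_mult_add_rdistrib matrix_vector_right_distrib)

lemma matrix_vector_scale: "M *v (c *s v) = c *s (M *v (v :: complex ^ 'd))"
  by (simp add: vec_eq_iff matrix_vector_mult_def sum_distrib_left mult_ac)

text \<open>An eigenvector is produced from \<open>w\<close> by the shortest linear relation between the powers of
  \<open>a\<close> applied to \<open>w\<close>: splitting off one linear factor leaves a nonzero vector.\<close>

definition poly_act :: "complex ^ 'd ^ 'd \<Rightarrow> complex poly \<Rightarrow> complex ^ 'd \<Rightarrow> complex ^ 'd" where
  "poly_act a P w = (\<Sum>i\<le>degree P. coeff P i *s ((*v) a ^^ i) w)"

text \<open>\<open>degree\<close> drops under cancellation; a free summation bound lets polynomials
  of different degrees be combined term by term.\<close>

lemma poly_act_altdef: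
  "degree P \<le> n \<Longrightarrow> poly_act a P w = (\<Sum>i\<le>n. coeff P i *s ((*v) a ^^ i) w)"
  unfolding poly_act_def
  by (rule sum.mono_neutral_left) (auto simp: coeff_eq_0)

lemma matrix_vector_sum: "M *v (\<Sum>i\<in>I. f i) = (\<Sum>i\<in>I. M *v (f i :: complex ^ 'd))"
  by (induction I rule: infinite_finite_induct) (auto simp: matrix_vector_right_distrib)

lemma poly_act_mult_linear:
  "poly_act a ([:- ev, 1:] * P) w = a *v poly_act a P w - ev *s poly_act a P w"
proof -
  let ?n = "degree P"
  have eq: "[:- ev, 1:] * P = pCons 0 P - smult ev P"
    by (simp add: )
  have 1: "poly_act a (pCons 0 P) w = a *v poly_act a P w"
  proof -
    have "poly_act a (pCons 0 P) w = (\<Sum>i\<le>Suc ?n. coeff (pCons 0 P) i *s ((*v) a ^^ i) w)"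
      by (rule poly_act_altdef) (rule degree_pCons_le)
    also have "\<dots> = (\<Sum>i\<le>?n. coeff P i *s (a *v ((*v) a ^^ i) w))"
      by (subst sum.atMost_Suc_shift) simp
    also have "\<dots> = a *v poly_act a P w"
      by (simp add: poly_act_def matrix_vector_sum matrix_vector_scale)
    finally show ?thesis .
  qed
  have 2: "poly_act a (smult ev P) w = ev *s poly_act a P w"
    by (subst poly_act_altdef[of _ ?n])
      (auto simp: poly_act_def vec.scale_sum_right degree_smult_le)
  have "poly_act a (pCons 0 P - smult ev P) w = poly_act a (pCons 0 P) w - poly_act a (smult ev P) w"
    (is "poly_act a (?p - ?q) w = _")
    using degree_pCons_le[of 0 P] degree_smult_le[of ev P] degree_diff_le_max[of ?p ?q]
    by (simp add: poly_act_altdef[of _ "Suc ?n"] vec.scale_left_diff_distrib sum_subtractf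
        flip: vec.scale_sum_right)
  then show ?thesis
    using 1 2 eq by simp
qed

lemma poly_act_annihilator:
  fixes a :: "complex ^ 'd ^ 'd"
  shows "\<exists>P. P \<noteq> 0 \<and> poly_act a P w = 0"
proof -
  let ?n = "CARD('d)"
  let ?f = "\<lambda>i. ((*v) a ^^ i) w"
  show ?thesis
  proof (cases "inj_on ?f {..?n}")
    \<comment> \<open>Dependence is a property of a set and does not see repetitions; a repetition
      among the iterates is itself a relation.\<close>
    case False
    then obtain i j where ij: "i \<noteq> j" "?f i = ?f j"
      unfolding inj_on_def by blast
    let ?P = "monom 1 i - monom 1 j :: complex poly"
    have "?P \<noteq> 0"
      using ij(1) by (simp add: monom_eq_iff')
    moreover have "poly_act a ?P w = 0"
    proof -
      have "degree ?P \<le> i + j"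
        by (rule degree_diff_le) (simp_all add: degree_monom_eq)
      then have "poly_act a ?P w =
          (\<Sum>k\<le>i + j. (if k = i then ?f i else 0) - (if k = j then ?f j else 0))"
        by (subst poly_act_altdef) (auto intro!: sum.cong)
      also have "\<dots> = ?f i - ?f j"
        by (simp add: sum_subtractf)
      finally show ?thesis
        using ij by simp
    qed
    ultimately show ?thesis by blast
  next
    case True
    have "vec.dependent (?f ` {..?n})"
    proof (rule vec.dependent_biggerset_general)
      have "vec.dim (?f ` {..?n}) \<le> CARD('d)"
        using vec.dim_subset[OF subset_UNIV, of "?f ` {..?n}"] unfolding vec_dim_card .
      then show "card (?f ` {..?n}) > vec.dim (?f ` {..?n})"
        by (simp add: card_image True)
    qed
    then obtain u where u: "\<exists>v\<in>?f ` {..?n}. u v \<noteq> 0" "(\<Sum>v\<in>?f ` {..?n}. u v *s v) = 0"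
      by (subst (asm) vec.dependent_finite) auto
    define P where "P = (\<Sum>i\<le>?n. monom (u (?f i)) i)"
    have coeff: "coeff P i = (if i \<le> ?n then u (?f i) else 0)" for i
      unfolding P_def by (simp add: coeff_sum)
    obtain i where "i \<le> ?n" "u (?f i) \<noteq> 0"
      using u(1) by auto
    then have "coeff P i \<noteq> 0"
      by (simp add: coeff)
    then have "P \<noteq> 0"
      by (metis coeff_0)
    moreover have "poly_act a P w = 0"
    proof -
      have "degree P \<le> ?n"
        by (rule degree_le) (simp add: coeff)
      then have "poly_act a P w = (\<Sum>i\<le>?n. u (?f i) *s ?f i)"
        by (simp add: poly_act_altdef coeff)
      also have "\<dots> = (\<Sum>v\<in>?f ` {..?n}. u v *s v)"
        using True by (simp add: sum.reindex)
      finally show ?thesis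
        using u(2) by simp
    qed
    ultimately show ?thesis by blast
  qed
qed

text \<open>The eigenvector is a polynomial in \<open>a\<close> applied to \<open>w\<close>, so it
  stays in every invariant subspace that contains \<open>w\<close>; no matrix of the restriction to
  \<open>V\<close> has to be formed.\<close>

lemma exists_eigenvector_in_invariant:
  fixes a :: "complex ^ 'd ^ 'd"
  assumes "w \<noteq> 0" "w \<in> V"
    and add: "\<And>u v. u \<in> V \<Longrightarrow> v \<in> V \<Longrightarrow> u + v \<in> V"
    and scale: "\<And>c v. v \<in> V \<Longrightarrow> c *s v \<in> V"
    and invariant: "\<And>v. v \<in> V \<Longrightarrow> a *v v \<in> V"
  shows "\<exists>ev v. v \<noteq> 0 \<and> v \<in> V \<and> a *v v = ev *s v"
proof -
  obtain P where P: "P \<noteq> 0" "poly_act a P w = 0"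
    and least: "\<And>Q. Q \<noteq> 0 \<and> poly_act a Q w = 0 \<Longrightarrow> degree P \<le> degree Q"
    using poly_act_annihilator[of a w]
      exists_least_iff[of "\<lambda>n. \<exists>Q. Q \<noteq> 0 \<and> poly_act a Q w = 0 \<and> degree Q = n"]
    by (metis not_le)
  have "degree P \<noteq> 0"
  proof
    assume "degree P = 0"
    then obtain c where "P = [:c:]"
      by (rule degree_eq_zeroE)
    then show False
      using P assms(1) by (auto simp: poly_act_def vec.scale_eq_0_iff)
  qed
  then have "\<not> constant (poly P)"
    by (simp add: constant_degree)
  then obtain ev where "poly P ev = 0"
    using fundamental_theorem_of_algebra by blast
  then obtain Q where Q: "P = [:- ev, 1:] * Q"
    by (auto simp: poly_eq_0_iff_dvd)
  have "Q \<noteq> 0"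
    using P Q by auto
  then have "degree Q < degree P"
    unfolding Q by (subst degree_mult_eq) auto
  then have "poly_act a Q w \<noteq> 0"
    using least \<open>Q \<noteq> 0\<close> not_le by blast
  moreover have "a *v poly_act a Q w = ev *s poly_act a Q w"
    using P(2) unfolding Q poly_act_mult_linear by simp
  moreover have "poly_act a Q w \<in> V"
  proof -
    have 0: "0 \<in> V"
      using scale[OF assms(2), of 0] by simp
    have iter: "((*v) a ^^ i) w \<in> V" for i
      by (induction i) (auto intro: assms(2) invariant)
    have "(\<Sum>i\<in>I. coeff Q i *s ((*v) a ^^ i) w) \<in> V" for I
      by (induction I rule: infinite_finite_induct) (auto intro: 0 add scale iter)
    then show ?thesis
      unfolding poly_act_def .
  qed
  ultimately show ?thesis by blast
qed

section \<open>Contractions, their adjoints and their fixed vectors\<close>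

lemma norm_diff_cinner_std:
  "(norm (u - v))\<^sup>2 = (norm u)\<^sup>2 - 2 * Re (cinner_std u v) + (norm (v :: complex ^ 'd))\<^sup>2"
  by (simp add: Re_cinner_std power2_norm_eq_inner inner_diff_left inner_diff_right inner_commute)

lemma norm_adjoint_contraction:
  fixes a :: "complex ^ 'd ^ 'd"
  assumes "\<And>v. norm (a *v v) \<le> norm v"
  shows "norm (adjoint_matrix a *v v) \<le> norm v"
proof -
  let ?w = "adjoint_matrix a *v v"
  have "(norm ?w)\<^sup>2 = Re (cinner_std v (a *v ?w))"
    by (simp add: cinner_std_self flip: cinner_std_adjoint)
  also have "\<dots> \<le> norm v * norm (a *v ?w)"
    by (rule order_trans[OF complex_Re_le_cmod norm_cinner_std_le])
  also have "\<dots> \<le> norm v * norm ?w"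
    by (intro mult_left_mono assms) auto
  finally show ?thesis
    by (cases "norm ?w = 0") (auto simp: power2_eq_square)
qed

text \<open>In the expansion of \<open>|a* v - v|^2\<close> the cross term is
  \<open><a* v, v> = <v, a v> = |v|^2\<close>, so what remains is \<open>|a* v|^2 - |v|^2\<close>,
  which is not positive.\<close>

lemma adjoint_contraction_fixed:
  fixes a :: "complex ^ 'd ^ 'd"
  assumes contraction: "\<And>v. norm (a *v v) \<le> norm v" and "a *v v = v"
  shows "adjoint_matrix a *v v = v"
proof -
  have "(norm (adjoint_matrix a *v v - v))\<^sup>2 = (norm (adjoint_matrix a *v v))\<^sup>2 - (norm v)\<^sup>2"
    unfolding norm_diff_cinner_std cinner_std_adjoint assms(2) by (simp add: cinner_std_self)
  also have "\<dots> \<le> 0"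
    using power_mono[OF norm_adjoint_contraction[OF contraction, of v] norm_ge_zero, of 2] by simp
  finally show ?thesis
    by simp
qed

lemma linear_iterate: "linear ((*v) (a :: complex ^ 'd ^ 'd) ^^ n)"
proof (induction n)
  case 0
  then show ?case
    by (simp add: id_def linear_id[unfolded id_def])
next
  case (Suc n)
  then show ?case
    unfolding funpow.simps by (rule linear_compose[OF _ matrix_vector_mul_linear])
qed

lemma iterate_scale: "((*v) (a :: complex ^ 'd ^ 'd) ^^ n) (c *s v) = c *s ((*v) a ^^ n) v"
  by (induction n) (auto simp: matrix_vector_scale)

lemma norm_iterate_le:
  fixes a :: "complex ^ 'd ^ 'd"
  assumes "\<And>v. norm (a *v v) \<le> norm v"
  shows "norm (((*v) a ^^ n) v) \<le> norm v"
  by (induction n) (auto intro: order_trans[OF assms])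

text \<open>The vectors on which all powers of a contraction are isometric form an invariant subspace, by
  the parallelogram law; a limit point of an orbit lies in it.\<close>

lemma isometric_part_add:
  fixes a :: "complex ^ 'd ^ 'd"
  assumes contraction: "\<And>v. norm (a *v v) \<le> norm v"
    and "norm (((*v) a ^^ n) u) = norm u" "norm (((*v) a ^^ n) v) = norm v"
  shows "norm (((*v) a ^^ n) (u + v)) = norm (u + v)"
proof -
  let ?A = "(*v) a ^^ n"
  have par: "(norm (x + y))\<^sup>2 + (norm (x - y))\<^sup>2 = 2 * (norm x)\<^sup>2 + 2 * (norm y)\<^sup>2" for x y :: "complex ^ 'd"
    by (simp add: power2_norm_eq_inner inner_add_left inner_add_right inner_diff_left inner_diff_right)
  have "(norm (?A (u + v)))\<^sup>2 + (norm (?A (u - v)))\<^sup>2 = (norm (u + v))\<^sup>2 + (norm (u - v))\<^sup>2"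
    using assms(2,3) par[of "?A u" "?A v"] par[of u v]
    by (simp add: linear_add[OF linear_iterate] linear_diff[OF linear_iterate])
  moreover have "(norm (?A (u + v)))\<^sup>2 \<le> (norm (u + v))\<^sup>2" "(norm (?A (u - v)))\<^sup>2 \<le> (norm (u - v))\<^sup>2"
    by (intro power_mono norm_iterate_le contraction norm_ge_zero)+
  ultimately have "(norm (?A (u + v)))\<^sup>2 = (norm (u + v))\<^sup>2"
    by linarith
  then show ?thesis
    by simp
qed

text \<open>On the orthogonal complement of the fixed space an orbit can only accumulate at 0: a
  nonzero limit point would provide, inside the isometric part, an eigenvector with eigenvalue of
  modulus 1, hence 1, and this fixed vector would be orthogonal to itself.\<close>

lemma contraction_iterates_tendsto_zero:
  fixes a :: "complex ^ 'd ^ 'd"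
  assumes contraction: "\<And>v. norm (a *v v) \<le> norm v"
    and unimodular: "\<And>ev v. v \<noteq> 0 \<Longrightarrow> a *v v = ev *s v \<Longrightarrow> cmod ev = 1 \<Longrightarrow> ev = 1"
    and orth: "\<And>e. a *v e = e \<Longrightarrow> cinner_std e w = 0"
  shows "(\<lambda>n. ((*v) a ^^ n) w) \<longlonglongrightarrow> 0"
proof -
  let ?A = "\<lambda>n. (*v) a ^^ n"
  let ?perp = "{w. \<forall>e. a *v e = e \<longrightarrow> cinner_std e w = 0}"
  have perp_inv: "a *v v \<in> ?perp" if "v \<in> ?perp" for v
    using that adjoint_contraction_fixed[OF contraction] by (simp flip: cinner_std_adjoint)
  have perp_iter: "?A n w \<in> ?perp" for n
    by (induction n) (use orth perp_inv in auto)
  have "decseq (\<lambda>n. norm (?A n w))"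
    by (rule decseq_SucI) (simp add: contraction)
  then obtain \<rho> where \<rho>: "(\<lambda>n. norm (?A n w)) \<longlonglongrightarrow> \<rho>"
    by (rule decseq_convergent[of _ 0]) auto
  have "bounded (range (\<lambda>n. ?A n w))"
    by (rule boundedI[of _ "norm w"]) (auto intro: norm_iterate_le contraction)
  then obtain w' \<sigma> where \<sigma>: "strict_mono \<sigma>" "((\<lambda>n. ?A n w) \<circ> \<sigma>) \<longlonglongrightarrow> w'"
    by (metis bounded_imp_convergent_subsequence)
  \<comment> \<open>By continuity \<open>?A j w'\<close> is the limit of the vectors
    \<open>?A (j + \<sigma> n) w\<close>, whose norms have the same limit \<rho> for every
    \<open>j\<close>.\<close>
  have norm_w': "norm (?A j w') = \<rho>" for j
  proof -
    have "(\<lambda>n. norm (?A j (?A (\<sigma> n) w))) \<longlonglongrightarrow> norm (?A j w')"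
      using linear_continuous_at[OF linear_conv_bounded_linear[THEN iffD1, OF linear_iterate]]
      by (intro tendsto_norm isCont_tendsto_compose[where g = "?A j"])
        (use \<sigma>(2) in \<open>auto simp: o_def\<close>)
    moreover have "(\<lambda>n. norm (?A (j + \<sigma> n) w)) \<longlonglongrightarrow> \<rho>"
      using LIMSEQ_subseq_LIMSEQ[OF \<rho>, of "\<lambda>n. j + \<sigma> n"] \<sigma>(1)
      by (simp add: o_def strict_mono_def)
    ultimately show ?thesis
      by (simp add: funpow_add LIMSEQ_unique)
  qed
  have "w' \<in> ?perp"
  proof safe
    fix e assume "a *v e = e"
    then have "(\<lambda>n. 0) \<longlonglongrightarrow> cinner_std e w'"
      using bounded_bilinear.tendsto[OF bounded_bilinear_cinner_std tendsto_const \<sigma>(2), of e] perp_iter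
      by simp
    then show "cinner_std e w' = 0"
      by (metis LIMSEQ_unique tendsto_const)
  qed
  have "w' = 0"
  proof (rule ccontr)
    assume "w' \<noteq> 0"
    let ?V = "{v \<in> ?perp. \<forall>j. norm (?A j v) = norm v}"
    have "\<exists>ev v. v \<noteq> 0 \<and> v \<in> ?V \<and> a *v v = ev *s v"
    proof (rule exists_eigenvector_in_invariant)
      show "w' \<noteq> 0" "w' \<in> ?V"
        using \<open>w' \<noteq> 0\<close> \<open>w' \<in> ?perp\<close> norm_w' norm_w'[of 0] by auto
      show "u + v \<in> ?V" if "u \<in> ?V" "v \<in> ?V" for u v
        using that by (auto simp: cinner_std_add_right intro: isometric_part_add contraction)
      show "c *s v \<in> ?V" if "v \<in> ?V" for c v
        using that by (auto simp: cinner_std_scale_right iterate_scale norm_vector_scale)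
      show "a *v v \<in> ?V" if "v \<in> ?V" for v
      proof -
        have "norm (?A j (a *v v)) = norm (a *v v)" for j
        proof -
          have "norm (?A (Suc j) v) = norm v" "norm (?A 1 v) = norm v"
            using that by blast+
          then show ?thesis
            unfolding funpow_Suc_right by simp
        qed
        then show ?thesis
          using that perp_inv by blast
      qed
    qed
    then obtain ev v where v: "v \<noteq> 0" "v \<in> ?V" "a *v v = ev *s v"
      by blast
    then have "norm (?A 1 v) = norm v"
      by blast
    then have "cmod ev = 1"
      using v by (simp add: norm_vector_scale)
    then have "a *v v = v"
      using unimodular[OF v(1,3)] v(3) by simp
    then have "cinner_std v v = 0"
      using v(2) by blast
    then show False
      using v(1) by (simp add: cinner_std_self)
  qed
  then have "\<rho> = 0"
    using norm_w'[of 0] by simp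
  then show ?thesis
    using \<rho> tendsto_norm_zero_iff by blast
qed

text \<open>The decomposition is that of the underlying real space; complex orthogonality is
  recovered because the fixed space is closed under multiplication by \<open>\<i>\<close>, which
  accounts for the imaginary part.\<close>

lemma fixed_space_decomposition:
  fixes a :: "complex ^ 'd ^ 'd"
  obtains e f where "v = e + f" "a *v e = e" "\<And>e'. a *v e' = e' \<Longrightarrow> cinner_std e' f = 0"
proof -
  let ?E = "{v. a *v v = v}"
  have sub: "subspace ?E"
    by (auto simp: subspace_def matrix_vector_right_distrib matrix_vector_mult_scaleR
        scaleR_eq_scale matrix_vector_scale)
  obtain e f where ef: "e \<in> span ?E" "\<And>w. w \<in> span ?E \<Longrightarrow> orthogonal f w" "v = e + f"
    using orthogonal_subspace_decomp_exists[of ?E v] by blast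
  have "cinner_std e' f = 0" if "a *v e' = e'" for e'
  proof (rule complex_eqI)
    have "e' \<in> span ?E" "\<i> *s e' \<in> span ?E"
      using that by (auto simp: matrix_vector_scale intro: span_base)
    then have "inner e' f = 0" "inner (\<i> *s e') f = 0"
      using ef(2) by (auto simp: orthogonal_def inner_commute[of _ f])
    then show "Re (cinner_std e' f) = Re 0" "Im (cinner_std e' f) = Im 0"
      by (simp_all add: cinner_std_scale_left flip: Re_cinner_std)
  qed
  moreover have "a *v e = e"
    using ef(1) span_eq_iff[THEN iffD2, OF sub] by blast
  ultimately show thesis
    using that ef(3) by blast
qed

text \<open>Fixed vectors of a contraction are fixed by the adjoint, so the orthogonal complement of the
  fixed space is invariant, and the powers tend to zero there.\<close>

lemma contraction_powers_tendsto_projection: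
  fixes a :: "complex ^ 'd ^ 'd"
  assumes contraction: "\<And>v. norm (a *v v) \<le> norm v"
    and unimodular: "\<And>ev v. v \<noteq> 0 \<Longrightarrow> a *v v = ev *s v \<Longrightarrow> cmod ev = 1 \<Longrightarrow> ev = 1"
  obtains P where "is_orth_proj_onto P {v. a *v v = v}"
    and "\<And>v. (\<lambda>n. ((*v) a ^^ n) v) \<longlonglongrightarrow> P *v v"
proof -
  let ?A = "\<lambda>n. (*v) a ^^ n"
  have lim_e: "(\<lambda>n. ?A n (e + f)) \<longlonglongrightarrow> e"
    if "a *v e = e" "\<And>e'. a *v e' = e' \<Longrightarrow> cinner_std e' f = 0" for e f
  proof -
    have "?A n e = e" for n
      by (induction n) (use that(1) in auto)
    then have "(\<lambda>n. ?A n (e + f)) = (\<lambda>n. e + ?A n f)"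
      by (simp add: linear_add[OF linear_iterate])
    then show ?thesis
      using tendsto_add[OF tendsto_const[of e] contraction_iterates_tendsto_zero[OF assms that(2)]] by simp
  qed
  \<comment> \<open>Taking the limit itself as the definition makes linearity a matter of uniqueness
    of limits; the decomposition gives existence, the values on fixed vectors and
    self-adjointness.\<close>
  define T where "T v = lim (\<lambda>n. ?A n v)" for v
  have T_eq: "T (e + f) = e"
    if "a *v e = e" "\<And>e'. a *v e' = e' \<Longrightarrow> cinner_std e' f = 0" for e f
    unfolding T_def by (rule limI) (rule lim_e[OF that])
  have T: "(\<lambda>n. ?A n v) \<longlonglongrightarrow> T v \<and> a *v T v = T v" for v
  proof -
    obtain e f where e: "v = e + f" "a *v e = e" "\<And>e'. a *v e' = e' \<Longrightarrow> cinner_std e' f = 0"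
      by (rule fixed_space_decomposition[where v = v and a = a]) blast
    then show ?thesis
      using lim_e[OF e(2,3)] T_eq[OF e(2,3)] by simp
  qed
  have "Vector_Spaces.linear (*s) (*s) T"
  proof unfold_locales
    show "T (u + v) = T u + T v" for u v
      using tendsto_add[OF T[THEN conjunct1, of u] T[THEN conjunct1, of v]] T[of "u + v"]
      by (auto simp: linear_add[OF linear_iterate] intro: LIMSEQ_unique)
    show "T (c *s v) = c *s T v" for c v
    proof -
      have "(\<lambda>n. c *s ?A n v) \<longlonglongrightarrow> c *s T v"
        by (intro vec_tendstoI) (auto intro!: tendsto_intros tendsto_vec_nth[OF T[THEN conjunct1]])
      then show ?thesis
        using T[of "c *s v"] by (auto simp: iterate_scale intro: LIMSEQ_unique)
    qed
  qed
  then have P: "matrix T *v v = T v" for v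
    by (rule matrix_works)
  have fixed: "T e = e" if "a *v e = e" for e
    using T_eq[of e 0] that by simp
  have self_adjoint: "cinner_std (T u) v = cinner_std u (T v)" for u v
  proof -
    obtain e f where e: "u = e + f" "a *v e = e" "\<And>e'. a *v e' = e' \<Longrightarrow> cinner_std e' f = 0"
      by (rule fixed_space_decomposition[where v = u and a = a]) blast
    obtain e1 f1 where e1: "v = e1 + f1" "a *v e1 = e1" "\<And>e'. a *v e' = e' \<Longrightarrow> cinner_std e' f1 = 0"
      by (rule fixed_space_decomposition[where v = v and a = a]) blast
    \<comment> \<open>With the mixed terms gone, both sides equal
      \<open>cinner_std e e1\<close>.\<close>
    have "cinner_std f e1 = 0"
      using e(3)[OF e1(2)] by (metis cnj_cinner_std complex_cnj_zero)
    then show ?thesis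
      using T_eq[OF e(2,3)] T_eq[OF e1(2,3)] e1(3)[OF e(2)] e(1) e1(1)
      by (simp add: cinner_std_add_left cinner_std_add_right)
  qed
  have "is_orth_proj_onto (matrix T) {v. a *v v = v}"
    unfolding is_orth_proj_onto_def
  proof (intro conjI)
    show "matrix T ** matrix T = matrix T"
      by (simp add: matrix_eq P fixed T flip: matrix_vector_mul_assoc)
    have "adjoint_matrix (matrix T) *v v = matrix T *v v" for v
      by (rule cinner_std_eqI) (simp add: cinner_std_adjoint' P self_adjoint)
    then show "adjoint_matrix (matrix T) = matrix T"
      by (simp add: matrix_eq)
    show "range ((*v) (matrix T)) = {v. a *v v = v}"
    proof safe
      show "a *v (matrix T *v v) = matrix T *v v" for v
        by (simp add: P T)
      show "v \<in> range ((*v) (matrix T))" if "a *v v = v" for v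
        by (rule image_eqI[of _ _ v]) (simp_all add: P fixed that)
    qed
  qed
  then show thesis
    using that[of "matrix T"] T by (simp add: P)
qed

section \<open>Square-summable families\<close>

lemma continuous_on_UNIV_tendsto_nhds: "continuous_on UNIV f \<Longrightarrow> (f \<longlongrightarrow> f z) (nhds z)"
  by (simp add: continuous_on_def flip: tendsto_at_iff_tendsto_nhds)

text \<open>Bounding the finite partial sums avoids side conditions on summability and passes to pointwise limits.\<close>

definition l2_le :: "'g set \<Rightarrow> ('g \<Rightarrow> complex) \<Rightarrow> real \<Rightarrow> bool" where
  "l2_le I \<phi> B \<longleftrightarrow> (\<forall>F. finite F \<and> F \<subseteq> I \<longrightarrow> L2_set (\<lambda>g. cmod (\<phi> g)) F \<le> B)"

lemma l2_leI: "(\<And>F. finite F \<Longrightarrow> F \<subseteq> I \<Longrightarrow> L2_set (\<lambda>g. cmod (\<phi> g)) F \<le> B) \<Longrightarrow> l2_le I \<phi> B"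
  by (simp add: l2_le_def)

lemma l2_leD: "l2_le I \<phi> B \<Longrightarrow> finite F \<Longrightarrow> F \<subseteq> I \<Longrightarrow> L2_set (\<lambda>g. cmod (\<phi> g)) F \<le> B"
  by (simp add: l2_le_def)

lemma l2_le_nonneg: "l2_le I \<phi> B \<Longrightarrow> 0 \<le> B"
  using l2_leD[of I \<phi> B "{}"] by simp

lemma l2_le_mono: "l2_le I \<phi> B \<Longrightarrow> B \<le> C \<Longrightarrow> l2_le I \<phi> C"
  unfolding l2_le_def by (blast intro: order_trans)

lemma l2_le_cong: "(\<And>g. g \<in> I \<Longrightarrow> \<phi> g = \<psi> g) \<Longrightarrow> l2_le I \<phi> B \<longleftrightarrow> l2_le I \<psi> B"
  unfolding l2_le_def by (intro iff_allI imp_cong refl arg_cong2[of _ _ _ _ "(\<le>)"] L2_set_cong) auto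

lemma l2_le_component: "l2_le I \<phi> B \<Longrightarrow> g \<in> I \<Longrightarrow> cmod (\<phi> g) \<le> B"
  using l2_leD[of I \<phi> B "{g}"] by (simp add: L2_set_def)

lemma l2_le_add:
  assumes "l2_le I \<phi> B" "l2_le I \<psi> C"
  shows "l2_le I (\<lambda>g. \<phi> g + \<psi> g) (B + C)"
proof (rule l2_leI)
  fix F assume F: "finite F" "F \<subseteq> I"
  have "L2_set (\<lambda>g. cmod (\<phi> g + \<psi> g)) F \<le> L2_set (\<lambda>g. cmod (\<phi> g) + cmod (\<psi> g)) F"
    by (rule L2_set_mono) (auto intro: norm_triangle_ineq)
  also have "\<dots> \<le> L2_set (\<lambda>g. cmod (\<phi> g)) F + L2_set (\<lambda>g. cmod (\<psi> g)) F"
    by (rule L2_set_triangle_ineq)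
  also have "\<dots> \<le> B + C"
    by (intro add_mono l2_leD[OF _ F] assms)
  finally show "L2_set (\<lambda>g. cmod (\<phi> g + \<psi> g)) F \<le> B + C" .
qed

lemma l2_le_scale: "l2_le I \<phi> B \<Longrightarrow> l2_le I (\<lambda>g. c * \<phi> g) (cmod c * B)"
  by (auto simp: l2_le_def norm_mult mult_left_mono simp flip: L2_set_right_distrib)

lemma l2_le_limit:
  assumes "\<And>k. l2_le I (\<phi> k) B" "\<And>g. g \<in> I \<Longrightarrow> (\<lambda>k. \<phi> k g) \<longlonglongrightarrow> \<psi> g"
  shows "l2_le I \<psi> B"
proof (rule l2_leI)
  fix F assume F: "finite F" "F \<subseteq> I"
  have "(\<lambda>k. L2_set (\<lambda>g. cmod (\<phi> k g)) F) \<longlonglongrightarrow> L2_set (\<lambda>g. cmod (\<psi> g)) F"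
    unfolding L2_set_def using F(2) by (intro tendsto_intros assms(2)) auto
  then show "L2_set (\<lambda>g. cmod (\<psi> g)) F \<le> B"
    by (rule LIMSEQ_le_const2) (use l2_leD[OF assms(1) F] in auto)
qed

lemma l2_le_sum_bound:
  assumes "l2_le I \<phi> B" "finite F" "F \<subseteq> I"
  shows "(\<Sum>g\<in>F. (cmod (\<phi> g))\<^sup>2) \<le> B\<^sup>2"
  using l2_leD[OF assms] l2_le_nonneg[OF assms(1)] by (simp add: L2_set_def real_sqrt_le_iff flip: real_sqrt_le_iff[of _ "B\<^sup>2"])

lemma l2_le_summable: "l2_le I \<phi> B \<Longrightarrow> (\<lambda>g. (cmod (\<phi> g))\<^sup>2) summable_on I"
  by (rule nonneg_bdd_above_summable_on) (auto intro!: bdd_aboveI2 l2_le_sum_bound)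

lemma l2_le_infsum: "l2_le I \<phi> B \<Longrightarrow> (\<Sum>\<^sub>\<infinity>g\<in>I. (cmod (\<phi> g))\<^sup>2) \<le> B\<^sup>2"
  by (rule infsum_le_finite_sums[OF l2_le_summable]) (auto intro: l2_le_sum_bound)

lemma l2_le_sqrt_infsum:
  assumes "(\<lambda>g. (cmod (\<phi> g))\<^sup>2) summable_on I"
  shows "l2_le I \<phi> (sqrt (\<Sum>\<^sub>\<infinity>g\<in>I. (cmod (\<phi> g))\<^sup>2))"
  by (rule l2_leI) (auto simp: L2_set_def intro!: finite_sum_le_infsum assms)

lemma sqrt_infsum_le: "l2_le I \<phi> B \<Longrightarrow> sqrt (\<Sum>\<^sub>\<infinity>g\<in>I. (cmod (\<phi> g))\<^sup>2) \<le> B"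
  by (rule real_le_lsqrt) (auto intro: l2_le_infsum l2_le_nonneg infsum_nonneg)

text \<open>By the reverse triangle inequality in l2, continuity of the family in l2 gives
  continuity of its norm; squaring gives the claim.\<close>

lemma isCont_infsum_square:
  fixes \<phi> :: "'x :: metric_space \<Rightarrow> 'g \<Rightarrow> complex"
  assumes summable: "\<And>x. (\<lambda>g. (cmod (\<phi> x g))\<^sup>2) summable_on I"
    and cont: "\<And>e. 0 < e \<Longrightarrow> \<exists>d>0. \<forall>x. dist x z < d \<longrightarrow> l2_le I (\<lambda>g. \<phi> x g - \<phi> z g) e"
  shows "isCont (\<lambda>x. \<Sum>\<^sub>\<infinity>g\<in>I. (cmod (\<phi> x g))\<^sup>2) z"
proof -
  let ?n = "\<lambda>x. sqrt (\<Sum>\<^sub>\<infinity>g\<in>I. (cmod (\<phi> x g))\<^sup>2)"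
  have le: "?n x \<le> ?n y + e" if "l2_le I (\<lambda>g. \<phi> x g - \<phi> y g) e" for x y e
    using sqrt_infsum_le[OF l2_le_add[OF l2_le_sqrt_infsum[OF summable[of y]] that]] by simp
  have "isCont ?n z"
    unfolding continuous_at_eps_delta
  proof safe
    fix e :: real assume "0 < e"
    then obtain d where d: "d > 0" "\<And>x. dist x z < d \<Longrightarrow> l2_le I (\<lambda>g. \<phi> x g - \<phi> z g) (e / 2)"
      using cont[of "e / 2"] by auto
    have "dist (?n x) (?n z) < e" if "dist x z < d" for x
    proof -
      have "l2_le I (\<lambda>g. \<phi> z g - \<phi> x g) (e / 2)"
        using d(2)[OF that] by (simp add: l2_le_def norm_minus_commute)
      then show ?thesis
        using le[OF d(2)[OF that]] le[of z x "e / 2"] \<open>0 < e\<close> by (auto simp: dist_real_def)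
    qed
    with d(1) show "\<exists>d>0. \<forall>x. dist x z < d \<longrightarrow> dist (?n x) (?n z) < e"
      by blast
  qed
  then have "isCont (\<lambda>x. (?n x)\<^sup>2) z"
    by (rule isCont_power)
  moreover have "(\<lambda>x. (?n x)\<^sup>2) = (\<lambda>x. \<Sum>\<^sub>\<infinity>g\<in>I. (cmod (\<phi> x g))\<^sup>2)"
    by (intro ext real_sqrt_pow2 infsum_nonneg) auto
  ultimately show ?thesis
    by argo
qed

lemma norm_cnj_mult_le: "cmod (cnj a * b) \<le> (cmod a)\<^sup>2 + (cmod b)\<^sup>2"
proof -
  have "2 * (cmod a * cmod b) \<le> (cmod a)\<^sup>2 + (cmod b)\<^sup>2"
    using sum_squares_bound[of "cmod a" "cmod b"] by simp
  moreover have "0 \<le> cmod a * cmod b"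
    by simp
  ultimately show ?thesis
    unfolding norm_mult complex_mod_cnj by linarith
qed

lemma abs_summable_cnj_mult:
  assumes "(\<lambda>g. (cmod (u g))\<^sup>2) summable_on I" "(\<lambda>g. (cmod (w g))\<^sup>2) summable_on I"
  shows "(\<lambda>g. cmod (cnj (u g) * w g)) summable_on I"
  by (rule Infinite_Sum.abs_summable_on_comparison_test'[OF summable_on_add[OF assms]])
    (rule norm_cnj_mult_le)

lemma infsum_split_finite:
  fixes f :: "'g \<Rightarrow> 'b :: banach"
  assumes "f summable_on I" "finite F" "F \<subseteq> I"
  shows "infsum f I = sum f F + infsum f (I - F)"
  using infsum_Un_disjoint[of f F "I - F"] assms
  by (simp add: Un_absorb1 summable_on_subset_banach[of f I "I - F"] Diff_subset)

text \<open>Continuity of the square sums makes their tails uniformly small near each point.\<close>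

lemma eventually_square_tail_small:
  fixes u :: "'x :: topological_space \<Rightarrow> 'g \<Rightarrow> complex"
  assumes cont: "\<And>g. g \<in> I \<Longrightarrow> continuous_on UNIV (\<lambda>x. u x g)"
    and summable: "\<And>x. (\<lambda>g. (cmod (u x g))\<^sup>2) summable_on I"
    and cont_sum: "continuous_on UNIV (\<lambda>x. \<Sum>\<^sub>\<infinity>g\<in>I. (cmod (u x g))\<^sup>2)"
    and "0 < e"
  obtains F where "finite F" "F \<subseteq> I"
    and "\<And>F'. finite F' \<Longrightarrow> F \<subseteq> F' \<Longrightarrow> F' \<subseteq> I \<Longrightarrow>
      eventually (\<lambda>x. (\<Sum>\<^sub>\<infinity>g\<in>I - F'. (cmod (u x g))\<^sup>2) < e) (nhds z)"
proof -
  have "((\<lambda>g. (cmod (u z g))\<^sup>2) has_sum (\<Sum>\<^sub>\<infinity>g\<in>I. (cmod (u z g))\<^sup>2)) I"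
    using summable by (rule has_sum_infsum)
  then obtain F where F: "finite F" "F \<subseteq> I"
    and lt: "\<And>F'. finite F' \<Longrightarrow> F \<subseteq> F' \<Longrightarrow> F' \<subseteq> I \<Longrightarrow>
      dist (\<Sum>g\<in>F'. (cmod (u z g))\<^sup>2) (\<Sum>\<^sub>\<infinity>g\<in>I. (cmod (u z g))\<^sup>2) < e"
    unfolding has_sum_def tendsto_iff eventually_finite_subsets_at_top using \<open>0 < e\<close> by meson
  have "eventually (\<lambda>x. (\<Sum>\<^sub>\<infinity>g\<in>I - F'. (cmod (u x g))\<^sup>2) < e) (nhds z)"
    if F': "finite F'" "F \<subseteq> F'" "F' \<subseteq> I" for F'
  proof -
    have split: "(\<Sum>\<^sub>\<infinity>g\<in>I - F'. (cmod (u x g))\<^sup>2) = (\<Sum>\<^sub>\<infinity>g\<in>I. (cmod (u x g))\<^sup>2) - (\<Sum>g\<in>F'. (cmod (u x g))\<^sup>2)" for x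
      using infsum_split_finite[OF summable[of x] F'(1,3)] by simp
    have "continuous_on UNIV (\<lambda>x. \<Sum>\<^sub>\<infinity>g\<in>I - F'. (cmod (u x g))\<^sup>2)"
      unfolding split using F'(3) by (intro continuous_intros cont_sum cont) auto
    then have "((\<lambda>x. \<Sum>\<^sub>\<infinity>g\<in>I - F'. (cmod (u x g))\<^sup>2) \<longlongrightarrow> (\<Sum>\<^sub>\<infinity>g\<in>I - F'. (cmod (u z g))\<^sup>2)) (nhds z)"
      by (rule continuous_on_UNIV_tendsto_nhds)
    then show ?thesis
      by (rule order_tendstoD) (use lt[OF F'] in \<open>auto simp: split dist_real_def\<close>)
  qed
  then show thesis
    using that F by blast
qed

text \<open>A finite part of the pairing is continuous, and the tail is dominated by the two square
  tails, which are small uniformly near \<open>z\<close>.\<close>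

lemma continuous_on_infsum_cnj_mult:
  fixes u w :: "'x :: topological_space \<Rightarrow> 'g \<Rightarrow> complex"
  assumes u: "\<And>g. g \<in> I \<Longrightarrow> continuous_on UNIV (\<lambda>x. u x g)"
      "\<And>x. (\<lambda>g. (cmod (u x g))\<^sup>2) summable_on I"
      "continuous_on UNIV (\<lambda>x. \<Sum>\<^sub>\<infinity>g\<in>I. (cmod (u x g))\<^sup>2)"
    and w: "\<And>g. g \<in> I \<Longrightarrow> continuous_on UNIV (\<lambda>x. w x g)"
      "\<And>x. (\<lambda>g. (cmod (w x g))\<^sup>2) summable_on I"
      "continuous_on UNIV (\<lambda>x. \<Sum>\<^sub>\<infinity>g\<in>I. (cmod (w x g))\<^sup>2)"
  shows "continuous_on UNIV (\<lambda>x. \<Sum>\<^sub>\<infinity>g\<in>I. cnj (u x g) * w x g)"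
proof -
  let ?s = "\<lambda>x. \<Sum>\<^sub>\<infinity>g\<in>I. cnj (u x g) * w x g"
  have "(?s \<longlongrightarrow> ?s z) (nhds z)" for z
  proof (rule tendstoI)
    fix e :: real assume "0 < e"
    \<comment> \<open>The tail collects two square tails, so \<open>e / 6\<close> for each makes it
      \<open>e / 3\<close>; the finite part, the tail at \<open>x\<close> and the tail at
      \<open>z\<close> then contribute a third each.\<close>
    then have e: "0 < e / 6" by simp
    obtain F1 where F1: "finite F1" "F1 \<subseteq> I" "\<And>F'. finite F' \<Longrightarrow> F1 \<subseteq> F' \<Longrightarrow> F' \<subseteq> I \<Longrightarrow>
      eventually (\<lambda>x. (\<Sum>\<^sub>\<infinity>g\<in>I - F'. (cmod (u x g))\<^sup>2) < e / 6) (nhds z)"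
      by (rule eventually_square_tail_small[OF u e]) blast+
    obtain F2 where F2: "finite F2" "F2 \<subseteq> I" "\<And>F'. finite F' \<Longrightarrow> F2 \<subseteq> F' \<Longrightarrow> F' \<subseteq> I \<Longrightarrow>
      eventually (\<lambda>x. (\<Sum>\<^sub>\<infinity>g\<in>I - F'. (cmod (w x g))\<^sup>2) < e / 6) (nhds z)"
      by (rule eventually_square_tail_small[OF w e]) blast+
    let ?F = "F1 \<union> F2"
    have F: "finite ?F" "?F \<subseteq> I"
      using F1 F2 by auto
    let ?f = "\<lambda>x. \<Sum>g\<in>?F. cnj (u x g) * w x g"
    let ?t = "\<lambda>x. \<Sum>\<^sub>\<infinity>g\<in>I - ?F. cnj (u x g) * w x g"
    have split: "?s x = ?f x + ?t x" for x
      by (rule infsum_split_finite[OF abs_summable_summable[OF abs_summable_cnj_mult[OF u(2) w(2)]] F])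
    have tail: "norm (?t x) \<le> (\<Sum>\<^sub>\<infinity>g\<in>I - ?F. (cmod (u x g))\<^sup>2) + (\<Sum>\<^sub>\<infinity>g\<in>I - ?F. (cmod (w x g))\<^sup>2)" for x
    proof -
      have s: "(\<lambda>g. (cmod (u x g))\<^sup>2) summable_on (I - ?F)" "(\<lambda>g. (cmod (w x g))\<^sup>2) summable_on (I - ?F)"
        by (rule summable_on_subset_banach[OF u(2)] summable_on_subset_banach[OF w(2)], blast)+
      have "norm (?t x) \<le> (\<Sum>\<^sub>\<infinity>g\<in>I - ?F. cmod (cnj (u x g) * w x g))"
        by (rule norm_infsum_bound[OF abs_summable_cnj_mult[OF s]])
      also have "\<dots> \<le> (\<Sum>\<^sub>\<infinity>g\<in>I - ?F. (cmod (u x g))\<^sup>2 + (cmod (w x g))\<^sup>2)"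
        by (rule infsum_mono[OF abs_summable_cnj_mult[OF s] summable_on_add[OF s] norm_cnj_mult_le])
      also have "\<dots> = (\<Sum>\<^sub>\<infinity>g\<in>I - ?F. (cmod (u x g))\<^sup>2) + (\<Sum>\<^sub>\<infinity>g\<in>I - ?F. (cmod (w x g))\<^sup>2)"
        by (rule infsum_add[OF s])
      finally show ?thesis .
    qed
    have ev_tail: "eventually (\<lambda>x. norm (?t x) < e / 3) (nhds z)"
      using F1(3)[OF F(1) Un_upper1 F(2)] F2(3)[OF F(1) Un_upper2 F(2)]
    proof eventually_elim
      case (elim x)
      then show ?case
        using tail[of x] by simp
    qed
    have "continuous_on UNIV ?f"
      using F by (intro continuous_intros u(1) w(1)) auto
    then have "(?f \<longlongrightarrow> ?f z) (nhds z)"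
      by (rule continuous_on_UNIV_tendsto_nhds)
    then have "eventually (\<lambda>x. dist (?f x) (?f z) < e / 3) (nhds z)"
      using \<open>0 < e\<close> by (intro tendstoD) auto
    then show "eventually (\<lambda>x. dist (?s x) (?s z) < e) (nhds z)"
      using ev_tail
    proof eventually_elim
      case (elim x)
      have "?s x - ?s z = (?f x - ?f z) + ?t x - ?t z"
        by (simp add: split)
      then have "norm (?s x - ?s z) \<le> norm (?f x - ?f z) + norm (?t x) + norm (?t z)"
        by (metis (no_types, lifting) add_mono_thms_linordered_semiring(3) norm_triangle_ineq norm_triangle_ineq4 order_trans)
      then show ?case
        using elim eventually_nhds_x_imp_x[OF ev_tail] by (simp add: dist_norm)
    qed
  qed
  then show ?thesis
    by (simp add: continuous_on_def tendsto_nhds_iff)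
qed

section \<open>The group action and the branches\<close>

lemma compact_ball_cover:
  fixes C :: "'a :: metric_space set"
  assumes "compact C" "\<And>x. 0 < e x"
  obtains D where "finite D" "C \<subseteq> (\<Union>x\<in>D. ball x (e x))"
proof -
  have cover: "C \<subseteq> (\<Union>x\<in>C. ball x (e x))"
  proof
    fix x assume "x \<in> C"
    then show "x \<in> (\<Union>x\<in>C. ball x (e x))"
      using assms(2)[of x] by (intro UN_I[of x]) auto
  qed
  show thesis
    by (rule compactE_image[OF assms(1) _ cover]) (use that in auto)
qed

context dilation_covering
begin

interpretation grp: group G
  by (rule group)

interpretation action: group_action G UNIV act
  by (rule action)

abbreviation rti :: "'x \<Rightarrow> 'x" where "rti \<equiv> inv_into UNIV rt"

lemma rti_rt [simp]: "rti (rt x) = x" and rt_rti [simp]: "rt (rti x) = x"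
  using homeo by (auto simp: homeomorphism_def)

lemma continuous_rt: "continuous_on UNIV rt" and continuous_rti: "continuous_on UNIV rti"
  using homeo by (auto simp: homeomorphism_def)

lemma dist_rti: "dist (rti x) (rti y) \<le> \<theta> * dist x y"
  using expanding[of "rti x" "rti y"] by simp

lemma rti_x0 [simp]: "rti x0 = x0"
  using rti_rt[of x0] fixed_point by simp

lemma rti_pow_x0 [simp]: "(rti ^^ k) x0 = x0"
  by (induction k) auto

text \<open>An off-by-one that matters: in the backward product of length \<open>k + 1\<close> the
  last factor, with index \<open>k\<close>, is evaluated at \<open>rti x\<close>, whatever
  \<open>k\<close> is.\<close>

lemma rt_pow_rti_pow_Suc: "(rt ^^ k) ((rti ^^ Suc k) x) = rti x"
proof (induction k)
  case (Suc k)
  have "(rt ^^ Suc k) ((rti ^^ Suc (Suc k)) x) = (rt ^^ k) (rt (rti ((rti ^^ Suc k) x)))"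
    by (simp add: funpow_swap1)
  then show ?case
    using Suc by simp
qed simp

lemma dist_rti_pow: "dist ((rti ^^ k) x) ((rti ^^ k) y) \<le> \<theta> ^ k * dist x y"
proof (induction k)
  case (Suc k)
  have "dist ((rti ^^ Suc k) x) ((rti ^^ Suc k) y) \<le> \<theta> * dist ((rti ^^ k) x) ((rti ^^ k) y)"
    by (simp add: dist_rti)
  also have "\<dots> \<le> \<theta> * (\<theta> ^ k * dist x y)"
    using Suc theta by (intro mult_left_mono) auto
  finally show ?case
    by (simp add: mult_ac)
qed simp

lemma dist_rti_pow_x0: "dist ((rti ^^ k) x) x0 \<le> \<theta> ^ k * dist x x0"
  using dist_rti_pow[of k x x0] by simp

section \<open>The action of G and its quotient\<close>

lemma act_one [simp]: "act \<one>\<^bsub>G\<^esub> x = x"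
  using fun_cong[OF action.id_eq_one, of x] by simp

lemma act_mult: "g \<in> carrier G \<Longrightarrow> h \<in> carrier G \<Longrightarrow> act (g \<otimes>\<^bsub>G\<^esub> h) x = act g (act h x)"
  by (rule action.composition_rule) auto

lemma act_act_inv [simp]: "g \<in> carrier G \<Longrightarrow> act g (act (inv\<^bsub>G\<^esub> g) x) = x"
  by (simp flip: act_mult)

lemma A_closed [simp]: "g \<in> carrier G \<Longrightarrow> A g \<in> carrier G"
  using endo by (auto simp: hom_def)

lemma rti_act: "g \<in> carrier G \<Longrightarrow> rti (act (A g) x) = act g (rti x)"
  using equivariant[of g "rti x"] rti_rt[of "act g (rti x)"] by simp

lemma p_act [simp]: "g \<in> carrier G \<Longrightarrow> p (act g x) = p x"
  using fibres by metis

lemma continuous_act: "g \<in> carrier G \<Longrightarrow> continuous_on UNIV (act g)"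
  unfolding continuous_on_iff using isometric by auto

text \<open>Proper discontinuity compares \<open>x\<close> with its own translates; by isometry the
  distance of two orbit points is that of \<open>x\<close> and its translate by
  \<open>g^-1 h\<close>, so one radius separates the whole orbit.\<close>

lemma orbit_separated:
  obtains e where "0 < e"
    "\<And>g h. g \<in> carrier G \<Longrightarrow> h \<in> carrier G \<Longrightarrow> g \<noteq> h \<Longrightarrow> e \<le> dist (act g x) (act h x)"
proof -
  obtain U where U: "open U" "x \<in> U"
    and disj: "\<And>g. g \<in> carrier G \<Longrightarrow> g \<noteq> \<one>\<^bsub>G\<^esub> \<Longrightarrow> act g ` U \<inter> U = {}"
    using properly_discontinuous by metis
  obtain e where e: "0 < e" "ball x e \<subseteq> U"
    using U openE by blast
  have "e \<le> dist (act g x) (act h x)" if gh: "g \<in> carrier G" "h \<in> carrier G" "g \<noteq> h" for g h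
  proof (rule ccontr)
    assume "\<not> e \<le> dist (act g x) (act h x)"
    let ?k = "inv\<^bsub>G\<^esub> g \<otimes>\<^bsub>G\<^esub> h"
    have "dist x (act ?k x) = dist (act g x) (act g (act ?k x))"
      using gh isometric by simp
    also have "\<dots> = dist (act g x) (act h x)"
      using gh by (simp add: act_mult)
    finally have "act ?k x \<in> U"
      using e(2) \<open>\<not> e \<le> _\<close> by auto
    moreover have "?k \<in> carrier G"
      using gh by simp
    moreover have "?k \<noteq> \<one>\<^bsub>G\<^esub>"
    proof
      assume "?k = \<one>\<^bsub>G\<^esub>"
      then have "inv\<^bsub>G\<^esub> h = inv\<^bsub>G\<^esub> g"
        using gh by (intro grp.inv_equality) auto
      then show False
        using gh grp.inv_inv by metis
    qed
    ultimately show False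
      using disj U(2) by blast
  qed
  with e(1) show thesis
    using that by blast
qed

lemma act_inj: "g \<in> carrier G \<Longrightarrow> h \<in> carrier G \<Longrightarrow> act g x = act h x \<Longrightarrow> g = h"
  by (rule orbit_separated[of x]) (metis dist_self not_le)

lemma surj_p: "range p = UNIV" and continuous_p: "continuous_on UNIV p"
  using quotient_imp_continuous_map[OF quotient] quotient_imp_surjective_map[OF quotient]
  by (auto simp: continuous_map_iff_continuous2)

lemma p_inv_p [simp]: "p (inv_into UNIV p y) = y"
  by (rule f_inv_into_f) (simp add: surj_p)

lemma obtain_lift: obtains x where "p x = y"
  using p_inv_p by blast

lemma continuous_on_quotient:
  assumes "continuous_on UNIV (\<lambda>x. f (p x))"
  shows "continuous_on UNIV f"
  using continuous_compose_quotient_map[OF quotient, of euclidean f] assms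
  by (simp add: continuous_map_iff_continuous2 o_def)

lemma continuous_r: "continuous_on UNIV r"
proof (rule continuous_on_quotient)
  have "continuous_on UNIV (p \<circ> rt)"
    by (rule continuous_on_compose[OF continuous_rt continuous_on_subset[OF continuous_p]]) auto
  then show "continuous_on UNIV (\<lambda>x. r (p x))"
    by (simp add: quotient_dilation o_def)
qed

text \<open>The metric of the quotient is an infimum over the orbit, so a strict bound is met by
  some representative. Thus \<open>p\<close> is open with explicit radii.\<close>

lemma ball_subset_image_ball: "ball (p x) e \<subseteq> p ` ball x e"
proof
  fix y assume "y \<in> ball (p x) e"
  obtain z where z: "p z = y"
    by (rule obtain_lift)
  have "(INF g\<in>carrier G. dist x (act g z)) < e"
    using \<open>y \<in> ball (p x) e\<close> z quotient_dist[of x z] by simp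
  then obtain g where "g \<in> carrier G" "dist x (act g z) < e"
    by (subst (asm) cINF_less_iff) (auto intro!: bdd_belowI2[where m = 0])
  then show "y \<in> p ` ball x e"
    using z by (intro image_eqI[of _ _ "act g z"]) auto
qed

text \<open>Cocompactness in usable form: estimates that need uniformity over the quotient are made
  on such a \<open>K\<close>.\<close>

lemma obtain_compact_lift:
  obtains K where "compact K" "p ` K = UNIV"
proof -
  have "\<exists>C e. compact C \<and> 0 < e \<and> ball x e \<subseteq> C" for x :: 'x
  proof -
    obtain U C where "open U" "compact C" "x \<in> U" "U \<subseteq> C"
      using locally_compact by (simp add: locally_compact_space_def) meson
    then show ?thesis
      by (meson openE order_trans)
  qed
  then obtain C :: "'x \<Rightarrow> 'x set" and e :: "'x \<Rightarrow> real" where C: "\<And>x. compact (C x)" "\<And>x. 0 < e x" "\<And>x. ball x (e x) \<subseteq> C x"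
    by metis
  have cover: "UNIV \<subseteq> (\<Union>x\<in>UNIV. ball (p x) (e x))"
  proof
    fix y :: 'y
    obtain x where "p x = y"
      by (rule obtain_lift)
    then show "y \<in> (\<Union>x\<in>UNIV. ball (p x) (e x))"
      using C(2)[of x] by (intro UN_I[of x]) auto
  qed
  obtain D where D: "finite D" "UNIV \<subseteq> (\<Union>x\<in>D. ball (p x) (e x))"
    by (rule compactE_image[OF compact_quotient _ cover]) auto
  show thesis
  proof (rule that)
    show "compact (\<Union>x\<in>D. C x)"
      using D(1) C(1) by blast
    have "(\<Union>x\<in>D. ball (p x) (e x)) \<subseteq> (\<Union>x\<in>D. p ` C x)"
      by (intro UN_mono order_refl order_trans[OF ball_subset_image_ball image_mono] C(3))
    then show "p ` (\<Union>x\<in>D. C x) = UNIV"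
      using D(2) unfolding image_UN by (metis order_trans top.extremum_uniqueI)
  qed
qed

text \<open>Around \<open>x\<close> and around each point of \<open>C\<close> there are balls so
  small that at most one group element carries a point of the first into the second; compactness
  leaves finitely many pairs of balls.\<close>

lemma finite_return_set:
  assumes "compact K" "compact C"
  shows "finite {g \<in> carrier G. \<exists>x\<in>K. act g x \<in> C}"
proof -
  have "\<exists>e>0. finite {g \<in> carrier G. \<exists>y\<in>ball x e. act g y \<in> C}" for x
  proof -
    obtain e where e: "0 < e"
      "\<And>g h. g \<in> carrier G \<Longrightarrow> h \<in> carrier G \<Longrightarrow> g \<noteq> h \<Longrightarrow> e \<le> dist (act g x) (act h x)"
      by (rule orbit_separated[of x]) blast
    obtain D where D: "finite D" "C \<subseteq> (\<Union>c\<in>D. ball c (e / 4))"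
      by (rule compact_ball_cover[OF assms(2), of "\<lambda>_. e / 4"]) (use e(1) in auto)
    let ?L = "\<lambda>c. {g \<in> carrier G. \<exists>y\<in>ball x (e / 4). act g y \<in> ball c (e / 4)}"
    have "finite (?L c)" for c
    proof -
      have "g = h" if gh: "g \<in> ?L c" "h \<in> ?L c" for g h
      proof -
        obtain y z where yz: "g \<in> carrier G" "h \<in> carrier G" "dist x y < e / 4" "dist x z < e / 4"
          "dist c (act g y) < e / 4" "dist c (act h z) < e / 4"
          using gh by auto
        have "dist (act g x) (act g y) = dist x y" "dist (act h x) (act h z) = dist x z"
          using isometric yz by auto
        \<comment> \<open>Four distances below \<open>e / 4\<close>, two of them transported by
          isometry, contradict the separation of the orbit of \<open>x\<close> unless
          \<open>g = h\<close>.\<close>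
        moreover have "dist (act g x) (act h x) \<le> dist (act g x) (act g y) + dist c (act g y)
            + dist c (act h z) + dist (act h x) (act h z)"
          using dist_triangle[of "act g x" "act h x" "act g y"] dist_triangle[of "act g y" "act h x" c]
            dist_triangle[of c "act h x" "act h z"]
          by (simp add: dist_commute)
        ultimately have "dist (act g x) (act h x) < e"
          using yz by linarith
        then show ?thesis
          using e(2) yz by (meson not_le)
      qed
      then have "?L c = {} \<or> (\<exists>g. ?L c = {g})"
        by blast
      then show ?thesis
        by (metis (no_types, lifting) finite.emptyI finite.insertI)
    qed
    then have "finite (\<Union>c\<in>D. ?L c)"
      using D(1) by blast
    moreover have "{g \<in> carrier G. \<exists>y\<in>ball x (e / 4). act g y \<in> C} \<subseteq> (\<Union>c\<in>D. ?L c)"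
      using D(2) by blast
    ultimately show ?thesis
      using e(1) finite_subset by (intro exI[of _ "e / 4"]) auto
  qed
  then have "\<forall>x. \<exists>e. 0 < e \<and> finite {g \<in> carrier G. \<exists>y\<in>ball x e. act g y \<in> C}"
    by blast
  then obtain e where e: "\<And>x. 0 < e x" "\<And>x. finite {g \<in> carrier G. \<exists>y\<in>ball x (e x). act g y \<in> C}"
    by (drule_tac choice) blast
  obtain D where D: "finite D" "K \<subseteq> (\<Union>x\<in>D. ball x (e x))"
    by (rule compact_ball_cover[OF assms(1) e(1)])
  have "{g \<in> carrier G. \<exists>x\<in>K. act g x \<in> C} \<subseteq> (\<Union>x\<in>D. {g \<in> carrier G. \<exists>y\<in>ball x (e x). act g y \<in> C})"
    using D(2) by blast
  then show ?thesis
    by (rule finite_subset) (use e(2) D(1) in blast)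
qed

section \<open>Cosets of A G and the branches of r\<close>

abbreviation psi :: "nat \<Rightarrow> 'x \<Rightarrow> 'x" where "psi i x \<equiv> rti (act (gs i) x)"

lemma image_subgroup: "subgroup (A ` carrier G) G"
  using normal_image by (rule normal_imp_subgroup)

lemma obtain_coset_rep:
  assumes "g \<in> carrier G"
  obtains i h where "i \<in> {1..q}" "h \<in> carrier G" "g = A h \<otimes>\<^bsub>G\<^esub> gs i"
proof -
  let ?H = "A ` carrier G"
  have "?H #>\<^bsub>G\<^esub> g \<in> rcosets\<^bsub>G\<^esub> ?H"
    using assms by (auto simp: RCOSETS_def)
  then have "?H #>\<^bsub>G\<^esub> g \<in> (\<lambda>i. ?H #>\<^bsub>G\<^esub> gs i) ` {1..q}"
    using reps by (simp only: bij_betw_def)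
  then obtain i where i: "i \<in> {1..q}" "?H #>\<^bsub>G\<^esub> g = ?H #>\<^bsub>G\<^esub> gs i"
    by blast
  moreover have "g \<in> ?H #>\<^bsub>G\<^esub> g"
    using assms image_subgroup by (simp add: grp.rcos_self)
  ultimately show thesis
    using that by (auto simp: r_coset_def)
qed

lemma coset_rep_unique:
  assumes "A h \<otimes>\<^bsub>G\<^esub> gs i = A h' \<otimes>\<^bsub>G\<^esub> gs j" "i \<in> {1..q}" "j \<in> {1..q}" "h \<in> carrier G" "h' \<in> carrier G"
  shows "i = j"
proof -
  let ?H = "A ` carrier G"
  have "A h \<otimes>\<^bsub>G\<^esub> gs i \<in> ?H #>\<^bsub>G\<^esub> gs i" "A h' \<otimes>\<^bsub>G\<^esub> gs j \<in> ?H #>\<^bsub>G\<^esub> gs j"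
    unfolding r_coset_def using assms(4,5) by blast+
  then have "?H #>\<^bsub>G\<^esub> gs i = ?H #>\<^bsub>G\<^esub> gs j"
    using grp.repr_independence[OF _ reps_carrier[OF assms(2)] image_subgroup]
      grp.repr_independence[OF _ reps_carrier[OF assms(3)] image_subgroup] assms(1) by metis
  then show ?thesis
    by (rule inj_onD[OF bij_betw_imp_inj_on[OF reps]]) (use assms(2,3) in auto)
qed

lemma one_le_q: "1 \<le> q"
  using obtain_coset_rep[OF grp.one_closed] by force

lemma rt_psi [simp]: "rt (psi i x) = act (gs i) x"
  by simp

lemma r_p_psi [simp]: "i \<in> {1..q} \<Longrightarrow> r (p (psi i x)) = p x"
  by (simp add: quotient_dilation reps_carrier)

lemma dist_psi: "i \<in> {1..q} \<Longrightarrow> dist (psi i x) (psi i y) \<le> \<theta> * dist x y"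
  using dist_rti[of "act (gs i) x" "act (gs i) y"] by (simp add: isometric reps_carrier)

lemma psi_1: "psi 1 x = rti x"
  by (simp only: reps_one act_one)

text \<open>This is how \<open>rti\<close> acts on an orbit: the points belonging to one coset go to
  the orbit of one branch point \<open>psi i x\<close>, with \<open>h\<close> as the new
  index.\<close>

lemma rti_act_coset:
  "i \<in> {1..q} \<Longrightarrow> h \<in> carrier G \<Longrightarrow> rti (act (A h \<otimes>\<^bsub>G\<^esub> gs i) x) = act h (psi i x)"
  by (simp add: act_mult reps_carrier rti_act)

text \<open>Sums over the branches at \<open>x\<close> are thereby sums over a fibre of
  \<open>r\<close>, hence independent of the lift \<open>x\<close>. Injectivity rests on freeness of
  the action and disjointness of cosets, surjectivity on the coset decomposition.\<close>

lemma bij_betw_branches: "bij_betw (\<lambda>i. p (psi i x)) {1..q} {y. r y = p x}"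
  unfolding bij_betw_def
proof
  show "inj_on (\<lambda>i. p (psi i x)) {1..q}"
  proof (rule inj_onI)
    fix i j assume ij: "i \<in> {1..q}" "j \<in> {1..q}" "p (psi i x) = p (psi j x)"
    then obtain h where h: "h \<in> carrier G" "psi j x = act h (psi i x)"
      using fibres by blast
    then have "act (gs j) x = rt (act h (psi i x))"
      by (metis rt_psi)
    then have "act (gs j) x = act (A h \<otimes>\<^bsub>G\<^esub> gs i) x"
      using ij h by (simp add: equivariant act_mult reps_carrier)
    \<comment> \<open>The unit is mapped to the unit by \<open>A\<close>; writing
      \<open>gs j\<close> with this trivial factor brings both sides into the form to which
      uniqueness of the coset applies.\<close>
    then have "\<one>\<^bsub>G\<^esub> \<in> carrier G" "A \<one>\<^bsub>G\<^esub> \<otimes>\<^bsub>G\<^esub> gs j = A h \<otimes>\<^bsub>G\<^esub> gs i"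
      using act_inj[of "gs j" "A h \<otimes>\<^bsub>G\<^esub> gs i" x] ij h reps_carrier
      by (auto simp: hom_one[OF endo group group])
    then have "j = i"
      using coset_rep_unique ij(1,2) h(1) by blast
    then show "i = j" ..
  qed
  show "(\<lambda>i. p (psi i x)) ` {1..q} = {y. r y = p x}"
  proof (intro equalityI subsetI)
    fix y assume "y \<in> {y. r y = p x}"
    obtain z where z: "p z = y"
      by (rule obtain_lift)
    then have "p (rt z) = p x"
      using \<open>y \<in> _\<close> quotient_dilation[of z] by simp
    then obtain g where g: "g \<in> carrier G" "rt z = act g x"
      using fibres by metis
    obtain i h where ih: "i \<in> {1..q}" "h \<in> carrier G" "g = A h \<otimes>\<^bsub>G\<^esub> gs i"
      using obtain_coset_rep[OF g(1)] .
    have "z = act h (psi i x)"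
      using g(2) rti_rt[of z] rti_act_coset[OF ih(1,2)] ih(3) by simp
    then show "y \<in> (\<lambda>i. p (psi i x)) ` {1..q}"
      using z ih by auto
  qed auto
qed

lemma l2_le_coset_split:
  assumes "\<And>i. i \<in> {1..q} \<Longrightarrow> l2_le (carrier G) (\<lambda>h. \<phi> (A h \<otimes>\<^bsub>G\<^esub> gs i)) (B i)"
  shows "l2_le (carrier G) \<phi> (L2_set B {1..q})"
proof (rule l2_leI)
  fix F assume F: "finite F" "F \<subseteq> carrier G"
  \<comment> \<open>Some \<open>h g\<close> is chosen for each \<open>g\<close>; since
    \<open>g\<close> is recovered from \<open>c g\<close> and \<open>h g\<close>, the choice is
    injective on each coset.\<close>
  obtain c h where ch: "\<And>g. g \<in> carrier G \<Longrightarrow> c g \<in> {1..q} \<and> h g \<in> carrier G \<and> g = A (h g) \<otimes>\<^bsub>G\<^esub> gs (c g)"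
  proof -
    have "\<forall>g\<in>carrier G. \<exists>f. fst f \<in> {1..q} \<and> snd f \<in> carrier G \<and> g = A (snd f) \<otimes>\<^bsub>G\<^esub> gs (fst f)"
    proof
      fix g assume "g \<in> carrier G"
      then obtain i h where "i \<in> {1..q}" "h \<in> carrier G" "g = A h \<otimes>\<^bsub>G\<^esub> gs i"
        by (rule obtain_coset_rep)
      then show "\<exists>f. fst f \<in> {1..q} \<and> snd f \<in> carrier G \<and> g = A (snd f) \<otimes>\<^bsub>G\<^esub> gs (fst f)"
        by (intro exI[of _ "(i, h)"]) simp
    qed
    then obtain f where "\<forall>g\<in>carrier G. fst (f g) \<in> {1..q} \<and> snd (f g) \<in> carrier G \<and>
        g = A (snd (f g)) \<otimes>\<^bsub>G\<^esub> gs (fst (f g))"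
      by (rule exE[OF bchoice])
    then show thesis
      by (intro that[of "fst \<circ> f" "snd \<circ> f"]) auto
  qed
  have "(\<Sum>g\<in>F. (cmod (\<phi> g))\<^sup>2) = (\<Sum>i\<in>{1..q}. \<Sum>g\<in>{g\<in>F. c g = i}. (cmod (\<phi> g))\<^sup>2)"
    using F ch by (intro sum.group[symmetric]) auto
  also have "\<dots> \<le> (\<Sum>i\<in>{1..q}. (B i)\<^sup>2)"
  proof (rule sum_mono)
    fix i assume i: "i \<in> {1..q}"
    let ?F = "{g\<in>F. c g = i}"
    have ch_i: "g = A (h g) \<otimes>\<^bsub>G\<^esub> gs i" if "g \<in> ?F" for g
      using ch[of g] that F(2) by auto
    have inj: "inj_on h ?F"
    proof (rule inj_onI)
      fix a b assume "a \<in> ?F" "b \<in> ?F" "h a = h b"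
      then show "a = b"
        using ch_i[of a] ch_i[of b] by simp
    qed
    have "(\<Sum>g\<in>?F. (cmod (\<phi> g))\<^sup>2) = (\<Sum>g\<in>?F. (cmod (\<phi> (A (h g) \<otimes>\<^bsub>G\<^esub> gs i)))\<^sup>2)"
      by (intro sum.cong refl arg_cong[where f = "\<lambda>g. (cmod (\<phi> g))\<^sup>2"] ch_i)
    also have "\<dots> = (\<Sum>k\<in>h ` ?F. (cmod (\<phi> (A k \<otimes>\<^bsub>G\<^esub> gs i)))\<^sup>2)"
      by (simp add: sum.reindex[OF inj])
    also have "\<dots> \<le> (B i)\<^sup>2"
      by (rule l2_le_sum_bound[OF assms[OF i]]) (use F ch in auto)
    finally show "(\<Sum>g\<in>?F. (cmod (\<phi> g))\<^sup>2) \<le> (B i)\<^sup>2" .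
  qed
  finally show "L2_set (\<lambda>g. cmod (\<phi> g)) F \<le> L2_set B {1..q}"
    by (simp add: L2_set_def)
qed

lemma bij_betw_translate: "h \<in> carrier G \<Longrightarrow> bij_betw (\<lambda>g. g \<otimes>\<^bsub>G\<^esub> h) (carrier G) (carrier G)"
  by (rule bij_betwI[where g = "\<lambda>g. g \<otimes>\<^bsub>G\<^esub> inv\<^bsub>G\<^esub> h"]) (auto simp: grp.m_assoc)

text \<open>It lets the base point of an orbit be replaced by any of its translates, without
  changing the bound.\<close>

lemma l2_le_translate:
  assumes "l2_le (carrier G) (\<lambda>g. \<phi> (g \<otimes>\<^bsub>G\<^esub> h)) B" "h \<in> carrier G"
  shows "l2_le (carrier G) \<phi> B"
proof (rule l2_leI)
  fix F assume F: "finite F" "F \<subseteq> carrier G"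
  let ?k = "\<lambda>g. g \<otimes>\<^bsub>G\<^esub> inv\<^bsub>G\<^esub> h"
  have inj: "inj_on ?k F"
    using bij_betw_imp_inj_on[OF bij_betw_translate[of "inv\<^bsub>G\<^esub> h"]] F(2) assms(2)
    by (auto intro: inj_on_subset)
  have "(\<Sum>g\<in>F. (cmod (\<phi> g))\<^sup>2) = (\<Sum>g\<in>?k ` F. (cmod (\<phi> (g \<otimes>\<^bsub>G\<^esub> h)))\<^sup>2)"
    unfolding sum.reindex[OF inj] using F(2) assms(2)
    by (intro sum.cong refl) (auto simp: grp.m_assoc subset_iff)
  also have "\<dots> \<le> B\<^sup>2"
    by (rule l2_le_sum_bound[OF assms(1)]) (use F assms(2) in auto)
  finally have "L2_set (\<lambda>g. cmod (\<phi> g)) F \<le> sqrt (B\<^sup>2)"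
    unfolding L2_set_def by (rule real_sqrt_le_mono)
  then show "L2_set (\<lambda>g. cmod (\<phi> g)) F \<le> B"
    using l2_le_nonneg[OF assms(1)] by simp
qed

end

section \<open>Coordinates and the transfer operator\<close>

context transfer_setting
begin

abbreviation mt :: "'x \<Rightarrow> complex ^ 'd ^ 'd" where "mt \<equiv> pull_filter p rt \<tau> m"

lemma trivialization:
  obtains \<tau>' where "homeomorphism UNIV {(x, a). p x = \<pi> a} (\<lambda>(x, v). (x, \<tau> x v)) \<tau>'"
  using triv_homeo by blast

lemma pi_tau [simp]: "\<pi> (\<tau> x v) = p x"
proof -
  obtain \<tau>' where "homeomorphism UNIV {(x, a). p x = \<pi> a} (\<lambda>(x, v). (x, \<tau> x v)) \<tau>'"
    by (rule trivialization)
  then have "(\<lambda>(x, v). (x, \<tau> x v)) ` UNIV = {(x, a). p x = \<pi> a}"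
    by (simp add: homeomorphism_def)
  then have "(x, \<tau> x v) \<in> {(x, a). p x = \<pi> a}"
    by (metis (no_types, lifting) UNIV_I case_prod_conv image_eqI)
  then show ?thesis
    by simp
qed

lemma coord_tau [simp]: "coord \<tau> x (\<tau> x v) = v"
proof -
  obtain \<tau>' where h: "homeomorphism UNIV {(x, a). p x = \<pi> a} (\<lambda>(x, v). (x, \<tau> x v)) \<tau>'"
    by (rule trivialization)
  have "inj (\<tau> x)"
  proof (rule injI)
    fix u v assume "\<tau> x u = \<tau> x v"
    then show "u = v"
      using homeomorphism_apply1[OF h, of "(x, u)"] homeomorphism_apply1[OF h, of "(x, v)"] by simp
  qed
  then show ?thesis
    by (simp add: coord_def)
qed

lemma tau_coord [simp]: "\<pi> a = p x \<Longrightarrow> \<tau> x (coord \<tau> x a) = a"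
proof -
  assume a: "\<pi> a = p x"
  obtain \<tau>' where h: "homeomorphism UNIV {(x, a). p x = \<pi> a} (\<lambda>(x, v). (x, \<tau> x v)) \<tau>'"
    by (rule trivialization)
  obtain z v where "\<tau>' (x, a) = (z, v)"
    by fastforce
  then have "a = \<tau> x v"
    using homeomorphism_apply2[OF h, of "(x, a)"] a by auto
  then show ?thesis
    by simp
qed

lemma continuous_on_tau:
  assumes "continuous_on T f" "continuous_on T w"
  shows "continuous_on T (\<lambda>z. \<tau> (f z) (w z))"
proof -
  obtain \<tau>' where "homeomorphism UNIV {(x, a). p x = \<pi> a} (\<lambda>(x, v). (x, \<tau> x v)) \<tau>'"
    by (rule trivialization)
  then have "continuous_on UNIV (\<lambda>(x, v). (x, \<tau> x v))"
    by (rule homeomorphism_cont1)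
  from continuous_on_snd[OF continuous_on_compose2[OF this continuous_on_Pair[OF assms] subset_UNIV]]
  show ?thesis
    by simp
qed

lemma continuous_on_coord:
  assumes "continuous_on T f" "continuous_on T a" "\<And>z. z \<in> T \<Longrightarrow> \<pi> (a z) = p (f z)"
  shows "continuous_on T (\<lambda>z. coord \<tau> (f z) (a z))"
proof -
  obtain \<tau>' where h: "homeomorphism UNIV {(x, a). p x = \<pi> a} (\<lambda>(x, v). (x, \<tau> x v)) \<tau>'"
    by (rule trivialization)
  have "(\<lambda>z. (f z, a z)) ` T \<subseteq> {(x, a). p x = \<pi> a}"
    using assms(3) by auto
  note continuous_on_snd[OF continuous_on_compose2[OF homeomorphism_cont2[OF h]
        continuous_on_Pair[OF assms(1,2)] this]]
  moreover have "snd (\<tau>' (f z, a z)) = coord \<tau> (f z) (a z)" if "z \<in> T" for z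
    using homeomorphism_apply1[OF h, of "(f z, coord \<tau> (f z) (a z))"] assms(3)[OF that] by simp
  ultimately show ?thesis
    by (simp cong: continuous_on_cong)
qed

lemma pi_vadd: "\<pi> a = \<pi> b \<Longrightarrow> \<pi> (vadd a b) = \<pi> a"
proof -
  assume "\<pi> a = \<pi> b"
  obtain x where "p x = \<pi> a"
    by (rule obtain_lift)
  then show ?thesis
    using triv_add[of x "coord \<tau> x a" "coord \<tau> x b"] \<open>\<pi> a = \<pi> b\<close> pi_tau by (metis tau_coord)
qed

lemma pi_smul [simp]: "\<pi> (smul c a) = \<pi> a"
proof -
  obtain x where "p x = \<pi> a"
    by (rule obtain_lift)
  then show ?thesis
    using triv_scale[of x c "coord \<tau> x a"] pi_tau by (metis tau_coord)
qed

lemma coord_add: "\<pi> a = p x \<Longrightarrow> \<pi> b = p x \<Longrightarrow> coord \<tau> x (vadd a b) = coord \<tau> x a + coord \<tau> x b"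
  using coord_tau[of x "coord \<tau> x a + coord \<tau> x b"] by (simp add: triv_add)

lemma coord_scale: "\<pi> a = p x \<Longrightarrow> coord \<tau> x (smul c a) = c *s coord \<tau> x a"
  using coord_tau[of x "c *s coord \<tau> x a"] by (simp add: triv_scale)

lemma ip_eq_cinner_coord:
  "\<pi> a = p x \<Longrightarrow> \<pi> b = p x \<Longrightarrow> ip a b = cinner_std (coord \<tau> x a) (coord \<tau> x b)"
  using triv_isometric[of x "coord \<tau> x a" "coord \<tau> x b"] by simp

lemma ip_self_eq_norm_coord: "\<pi> a = p x \<Longrightarrow> ip a a = complex_of_real ((norm (coord \<tau> x a))\<^sup>2)"
  by (simp add: ip_eq_cinner_coord cinner_std_self)

lemma norm_coord_eq: "\<pi> a = p x \<Longrightarrow> \<pi> a = p z \<Longrightarrow> norm (coord \<tau> x a) = norm (coord \<tau> z a)"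
  using ip_self_eq_norm_coord[of a x] ip_self_eq_norm_coord[of a z]
  by (simp del: of_real_power)

lemma pi_filter [simp]: "\<pi> a = p (rt x) \<Longrightarrow> \<pi> (m (p x) a) = p x"
  by (simp add: filter_fibre quotient_dilation)

lemma mt_mult: "mt x *v u = coord \<tau> x (m (p x) (\<tau> (rt x) u))"
proof -
  have "Vector_Spaces.linear (*s) (*s) (\<lambda>v. coord \<tau> x (m (p x) (\<tau> (rt x) v)))"
    by unfold_locales
      (simp_all add: triv_add triv_scale filter_add filter_scale quotient_dilation coord_add coord_scale)
  then show ?thesis
    unfolding pull_filter_def by (rule matrix_works)
qed

lemma coord_filter: "\<pi> a = p (rt x) \<Longrightarrow> coord \<tau> x (m (p x) a) = mt x *v coord \<tau> (rt x) a"
  by (simp add: mt_mult)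

text \<open>Resolves the definite description: in isometric coordinates the adjoint is the conjugate
  transpose, and a vector is determined by its inner products.\<close>

lemma filter_adjoint_eq:
  assumes "\<pi> a = p x"
  shows "filter_adjoint \<pi> ip r m (p x) a = \<tau> (rt x) (adjoint_matrix (mt x) *v coord \<tau> x a)" (is "_ = ?b")
  unfolding filter_adjoint_def
proof (rule the_equality)
  have ip_b: "ip u ?b = ip (m (p x) u) a" if "\<pi> u = r (p x)" for u
    using that assms
    by (simp add: quotient_dilation ip_eq_cinner_coord[of u "rt x"] ip_eq_cinner_coord[of _ x]
        coord_filter cinner_std_adjoint')
  then show "\<pi> ?b = r (p x) \<and> (\<forall>u. \<pi> u = r (p x) \<longrightarrow> ip u ?b = ip (m (p x) u) a)"
    by (simp add: quotient_dilation)
  fix b assume b: "\<pi> b = r (p x) \<and> (\<forall>u. \<pi> u = r (p x) \<longrightarrow> ip u b = ip (m (p x) u) a)"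
  have "coord \<tau> (rt x) b = coord \<tau> (rt x) ?b"
  proof (rule cinner_std_eqI)
    fix u
    have "ip (\<tau> (rt x) u) b = ip (\<tau> (rt x) u) ?b"
      using b ip_b[of "\<tau> (rt x) u"] by (simp add: quotient_dilation)
    then show "cinner_std u (coord \<tau> (rt x) b) = cinner_std u (coord \<tau> (rt x) ?b)"
      using b by (simp add: quotient_dilation ip_eq_cinner_coord[of _ "rt x"])
  qed
  then have "\<tau> (rt x) (coord \<tau> (rt x) b) = ?b"
    by simp
  then show "b = ?b"
    using b by (simp add: quotient_dilation)
qed

lemma pi_filter_adjoint: "\<pi> a = y \<Longrightarrow> \<pi> (filter_adjoint \<pi> ip r m y a) = r y"
  by (rule obtain_lift[of y]) (metis filter_adjoint_eq pi_tau quotient_dilation)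

lemma ip_filter_adjoint:
  assumes "\<pi> c = r y" "\<pi> a = y"
  shows "ip c (filter_adjoint \<pi> ip r m y a) = ip (m y c) a"
proof -
  obtain x where x: "p x = y"
    by (rule obtain_lift)
  show ?thesis
    using assms unfolding x[symmetric]
    by (simp add: filter_adjoint_eq quotient_dilation ip_eq_cinner_coord[of c "rt x"]
        ip_eq_cinner_coord[of _ x] coord_filter cinner_std_adjoint')
qed

text \<open>\<open>vadd\<close> is meaningful only within a fibre, so the folded sum is not
  evaluated itself; pairing it with \<open>c\<close> turns it into a sum of complex numbers.\<close>

lemma ip_foldr_vadd:
  assumes "\<pi> c = \<pi> z" "\<And>b. b \<in> set bs \<Longrightarrow> \<pi> b = \<pi> z"
  shows "\<pi> (foldr vadd bs z) = \<pi> z \<and> ip c (foldr vadd bs z) = (\<Sum>b\<leftarrow>bs. ip c b) + ip c z"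
  using assms(2)
proof (induction bs)
  case (Cons b bs)
  then show ?case
    using assms(1) by (simp add: pi_vadd ip_add)
qed simp

section \<open>Sections and the filter in coordinates\<close>

lemma continuous_on_pull_section: "s \<in> sections \<pi> \<Longrightarrow> continuous_on UNIV (pull_section p \<tau> s)"
  unfolding pull_section_def[abs_def]
  by (intro continuous_on_coord continuous_on_id continuous_on_compose2[OF _ continuous_p])
    (auto simp: sections_def)

lemma pi_section: "s \<in> sections \<pi> \<Longrightarrow> \<pi> (s y) = y"
  by (simp add: sections_def)

lemma tau_pull_section [simp]: "s \<in> sections \<pi> \<Longrightarrow> \<tau> x (pull_section p \<tau> s x) = s (p x)"
  by (simp add: pull_section_def pi_section[of s])

lemma sectionI:
  assumes "continuous_on UNIV w" "\<And>x. s (p x) = \<tau> x (w x)"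
  shows "s \<in> sections \<pi>"
  unfolding sections_def
proof safe
  show "continuous_on UNIV s"
    by (rule continuous_on_quotient) (simp add: assms(2) continuous_on_tau[OF continuous_on_id assms(1)])
  show "\<pi> (s y) = y" for y
    by (rule obtain_lift[of y]) (metis assms(2) pi_tau)
qed

lemma pull_section_eq: "s (p x) = \<tau> x w \<Longrightarrow> pull_section p \<tau> s x = w"
  by (simp add: pull_section_def)

lemma filtered_section:
  assumes "s \<in> sections \<pi>"
  shows "(\<lambda>y. m y (s (r y))) \<in> sections \<pi>"
proof -
  have "continuous_on UNIV s"
    using assms by (simp add: sections_def)
  note s_r = continuous_on_compose2[OF this continuous_r subset_UNIV]
  have "(\<lambda>y. (y, s (r y))) ` UNIV \<subseteq> {(y, a). r y = \<pi> a}"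
    using pi_section[OF assms] by auto
  from continuous_on_compose2[OF filter_continuous continuous_on_Pair[OF continuous_on_id s_r] this]
  have "continuous_on UNIV (\<lambda>y. m y (s (r y)))"
    by simp
  then show ?thesis
    using assms by (simp add: sections_def filter_fibre)
qed

lemma pull_filtered_section:
  "s \<in> sections \<pi> \<Longrightarrow> pull_section p \<tau> (\<lambda>y. m y (s (r y))) x = mt x *v pull_section p \<tau> s (rt x)"
  by (simp add: pull_section_def coord_filter quotient_dilation pi_section[of s])

lemma mt_lipschitz:
  obtains L where "0 \<le> L" "\<And>x y u. norm (mt x *v u - mt y *v u) \<le> L * dist x y * norm u"
proof -
  obtain L where L: "L-lipschitz_on UNIV mt"
    using filter_lipschitz by blast
  have "norm (mt x *v u - mt y *v u) \<le> L * dist x y * norm u" for x y u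
  proof -
    have "norm (mt x *v u - mt y *v u) \<le> norm (mt x - mt y) * norm u"
      by (metis matrix_vector_mult_diff_rdistrib norm_matrix_vector_le)
    also have "\<dots> \<le> L * dist x y * norm u"
      using lipschitz_onD[OF L, of x y] by (intro mult_right_mono) (auto simp: dist_norm)
    finally show ?thesis .
  qed
  then show thesis
    using that lipschitz_on_nonneg[OF L] by blast
qed

lemma continuous_mt: "continuous_on UNIV mt"
  using filter_lipschitz lipschitz_on_continuous_on by blast

end

section \<open>Consequences of the normalization R 1 = 1\<close>

locale normalized_transfer_setting =
  transfer_setting G act p rt r \<theta> x0 A q gs \<pi> vadd smul ip charts \<tau> m
  for G :: "('g, 'b) monoid_scheme"
    and act :: "'g \<Rightarrow> 'x::metric_space \<Rightarrow> 'x"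
    and p :: "'x \<Rightarrow> 'y::metric_space"
    and rt r \<theta> x0 A q gs
    and \<pi> :: "'e::topological_space \<Rightarrow> 'y"
    and vadd smul ip
    and charts :: "('y set \<times> ('y \<Rightarrow> complex ^ 'd \<Rightarrow> 'e)) set"
    and \<tau> m +
  assumes transfer_one: "transfer_op act p rt r q gs \<pi> vadd smul ip m (\<lambda>a. a) = (\<lambda>a. a)"
begin

text \<open>Apply \<open>R 1 = 1\<close> to \<open>a\<close> and pair the result with
  \<open>a\<close>; the adjoints move to the other side.\<close>

lemma ip_sum_branches:
  assumes "\<pi> a = p x"
  shows "(\<Sum>i\<in>{1..q}. ip (m (p (psi i x)) a) (m (p (psi i x)) a)) = ip a a"
proof -
  let ?z = "inv_into UNIV p (\<pi> a)"
  let ?bs = "map (\<lambda>i. filter_adjoint \<pi> ip r m (p (psi i ?z)) (m (p (psi i ?z)) a)) [1..<Suc q]"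
  have z: "p ?z = \<pi> a"
    by simp
  have r: "r (p (psi i ?z)) = \<pi> a" if "i \<in> {1..q}" for i
    using that by simp
  have fibre: "\<pi> (m (p (psi i ?z)) a) = p (psi i ?z)" if "i \<in> {1..q}" for i
    by (rule filter_fibre) (simp add: r[OF that])
  have set: "set [1..<Suc q] = {1..q}"
    by auto
  have fold: "foldr vadd ?bs (smul 0 a) = a"
    using fun_cong[OF transfer_one, of a] unfolding transfer_op_def Let_def .
  have pi_bs: "\<pi> b = \<pi> (smul 0 a)" if b: "b \<in> set ?bs" for b
  proof -
    obtain i where "i \<in> {1..q}" "b = filter_adjoint \<pi> ip r m (p (psi i ?z)) (m (p (psi i ?z)) a)"
      using b unfolding set_map set by blast
    then show ?thesis
      using pi_filter_adjoint[OF fibre] r by simp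
  qed
  have "ip a a = ip a (foldr vadd ?bs (smul 0 a))"
    by (simp only: fold)
  also have "\<dots> = (\<Sum>b\<leftarrow>?bs. ip a b) + ip a (smul 0 a)"
    using ip_foldr_vadd[OF pi_smul[symmetric] pi_bs] by (rule conjunct2)
  also have "\<dots> = (\<Sum>i\<in>{1..q}. ip a (filter_adjoint \<pi> ip r m (p (psi i ?z)) (m (p (psi i ?z)) a)))"
    by (simp only: map_map o_def interv_sum_list_conv_sum_set_nat set ip_scale[OF refl] mult_zero_left add_0_right)
  also have "\<dots> = (\<Sum>i\<in>{1..q}. ip (m (p (psi i ?z)) a) (m (p (psi i ?z)) a))"
    by (intro sum.cong refl ip_filter_adjoint(1)) (simp_all add: r fibre)
  \<comment> \<open>\<open>transfer_op\<close> works with the chosen lift \<open>?z\<close>; passing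
    through the sum over the fibre of \<open>r\<close> exchanges it for the given
    \<open>x\<close>.\<close>
  also have "\<dots> = (\<Sum>y\<in>{y. r y = p ?z}. ip (m y a) (m y a))"
    by (rule sum.reindex_bij_betw[OF bij_betw_branches])
  also have "\<dots> = (\<Sum>y\<in>{y. r y = p x}. ip (m y a) (m y a))"
    by (simp add: assms)
  also have "\<dots> = (\<Sum>i\<in>{1..q}. ip (m (p (psi i x)) a) (m (p (psi i x)) a))"
    by (rule sum.reindex_bij_betw[OF bij_betw_branches, symmetric])
  finally show ?thesis ..
qed

text \<open>The vector \<open>u\<close> is given in the coordinates at \<open>x\<close>, not at
  \<open>act (gs i) x = rt (psi i x)\<close>, so this differs from \<open>mt (psi i x)\<close> by a
  unitary change of coordinates. In this form the \<open>q\<close> branches together are an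
  isometry.\<close>

definition branch :: "nat \<Rightarrow> 'x \<Rightarrow> complex ^ 'd \<Rightarrow> complex ^ 'd" where
  "branch i x u = coord \<tau> (psi i x) (m (p (psi i x)) (\<tau> x u))"

lemma pi_branch: "i \<in> {1..q} \<Longrightarrow> \<pi> (m (p (psi i x)) (\<tau> x u)) = p (psi i x)"
  by (rule filter_fibre) simp

lemma sum_norm_branch: "(\<Sum>i\<in>{1..q}. (norm (branch i x u))\<^sup>2) = (norm u)\<^sup>2"
proof -
  have "complex_of_real (\<Sum>i\<in>{1..q}. (norm (branch i x u))\<^sup>2) =
      (\<Sum>i\<in>{1..q}. ip (m (p (psi i x)) (\<tau> x u)) (m (p (psi i x)) (\<tau> x u)))"
    unfolding of_real_sum branch_def
    by (intro sum.cong refl ip_self_eq_norm_coord[symmetric] pi_branch)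
  also have "\<dots> = complex_of_real ((norm u)\<^sup>2)"
    unfolding ip_sum_branches[OF pi_tau] triv_isometric cinner_std_self ..
  finally show ?thesis
    by (simp only: of_real_eq_iff)
qed

lemma norm_branch_le: "i \<in> {1..q} \<Longrightarrow> norm (branch i x u) \<le> norm u"
  using member_le_sum[of i "{1..q}" "\<lambda>i. (norm (branch i x u))\<^sup>2", unfolded sum_norm_branch]
  by (simp add: power2_le_iff_abs_le)

text \<open>\<open>p x\<close> is one of the branch points over \<open>p (rt x)\<close>, so
  \<open>mt x\<close> is a branch up to isometric changes of coordinates, and a single branch is
  bounded by the sum of all.\<close>

lemma norm_mt_le: "norm (mt x *v u) \<le> norm u"
proof -
  have "p x \<in> (\<lambda>i. p (psi i (rt x))) ` {1..q}"
    unfolding bij_betw_imp_surj_on[OF bij_betw_branches] by (simp add: quotient_dilation)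
  then obtain i where i: "i \<in> {1..q}" "p x = p (psi i (rt x))"
    by blast
  have "norm (mt x *v u) = norm (branch i (rt x) u)"
    unfolding mt_mult branch_def i(2) using pi_branch[OF i(1)] by (intro norm_coord_eq) (simp_all add: i(2))
  then show ?thesis
    using norm_branch_le[OF i(1)] by simp
qed

end

section \<open>The limit product\<close>

lemma tendsto_matrixI:
  fixes M :: "'a \<Rightarrow> complex ^ 'd ^ 'e"
  assumes "\<And>v. ((\<lambda>n. M n *v v) \<longlongrightarrow> N *v v) F"
  shows "(M \<longlongrightarrow> N) F"
proof (intro vec_tendstoI)
  fix i j
  have "((\<lambda>n. (M n *v axis j 1) $ i) \<longlongrightarrow> (N *v axis j 1) $ i) F"
    by (rule tendsto_vec_nth[OF assms])
  then show "((\<lambda>n. M n $ i $ j) \<longlongrightarrow> N $ i $ j) F"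
    by (simp add: matrix_vector_mult_def axis_def if_distrib[of "(*) _"] cong: if_cong)
qed

locale refinement_setting =
  normalized_transfer_setting G act p rt r \<theta> x0 A q gs \<pi> vadd smul ip charts \<tau> m
  for G :: "('g, 'b) monoid_scheme"
    and act :: "'g \<Rightarrow> 'x::metric_space \<Rightarrow> 'x"
    and p :: "'x \<Rightarrow> 'y::metric_space"
    and rt r \<theta> x0 A q gs
    and \<pi> :: "'e::topological_space \<Rightarrow> 'y"
    and vadd smul ip
    and charts :: "('y set \<times> ('y \<Rightarrow> complex ^ 'd \<Rightarrow> 'e)) set"
    and \<tau> m +
  fixes l :: nat
  assumes E_condition: "E_condition l (mt x0)"
begin

interpretation grp: group G
  by (rule group)

abbreviation B :: "nat \<Rightarrow> 'x \<Rightarrow> complex ^ 'd ^ 'd" where "B \<equiv> backward_product mt rt"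

abbreviation P :: "'x \<Rightarrow> complex ^ 'd ^ 'd" where "P \<equiv> limit_product mt rt"

lemma B_0 [simp]: "B 0 x = mat 1"
  by (simp add: backward_product_def)

lemma B_Suc: "B (Suc k) x = B k (rti x) ** mt (rti x)"
proof -
  have "B (Suc k) x = filter_product mt rt k ((rti ^^ Suc k) x) ** mt ((rt ^^ k) ((rti ^^ Suc k) x))"
    by (simp only: backward_product_def filter_product.simps)
  also have "\<dots> = B k (rti x) ** mt (rti x)"
    by (simp only: rt_pow_rti_pow_Suc) (simp only: backward_product_def funpow_Suc_right o_apply)
  finally show ?thesis .
qed

lemma filter_product_Suc: "filter_product mt rt (Suc k) z = mt z ** filter_product mt rt k (rt z)"
proof (induction k)
  case (Suc k)
  have "filter_product mt rt (Suc (Suc k)) z = filter_product mt rt (Suc k) z ** mt ((rt ^^ Suc k) z)"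
    by (rule filter_product.simps)
  also have "\<dots> = mt z ** (filter_product mt rt k (rt z) ** mt ((rt ^^ k) (rt z)))"
    by (simp only: Suc matrix_mul_assoc funpow_Suc_right o_apply)
  finally show ?case
    by (simp only: filter_product.simps)
qed simp

text \<open>\<open>B_Suc\<close> adds a factor on the right and moves the base point, which yields
  the refinement equation; here the new factor stands on the left, at a point that tends to
  \<open>x0\<close>, which yields convergence and the range of the limit.\<close>

lemma B_Suc': "B (Suc k) x = mt ((rti ^^ Suc k) x) ** B k x"
  unfolding backward_product_def filter_product_Suc by simp

lemma norm_B_le: "norm (B k x *v u) \<le> norm u"
proof (induction k)
  case (Suc k)
  then show ?case
    unfolding B_Suc' matrix_vector_mul_assoc[symmetric] by (rule order_trans[OF norm_mt_le])
qed simp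

lemma B_x0_mult: "B k x0 *v u = ((*v) (mt x0) ^^ k) u"
  by (induction k) (simp_all add: B_Suc' flip: matrix_vector_mul_assoc)

lemma mt_x0_unimodular:
  "v \<noteq> 0 \<Longrightarrow> mt x0 *v v = ev *s v \<Longrightarrow> cmod ev = 1 \<Longrightarrow> ev = 1"
  using E_condition by (auto simp: E_condition_def)

lemma obtain_projection:
  obtains P0 where "is_orth_proj_onto P0 {v. mt x0 *v v = v}" "(\<lambda>k. B k x0) \<longlonglongrightarrow> P0"
proof (rule contraction_powers_tendsto_projection[of "mt x0", OF norm_mt_le mt_x0_unimodular])
  fix P0
  assume proj: "is_orth_proj_onto P0 {v. mt x0 *v v = v}"
    and lim: "\<And>v. (\<lambda>n. ((*v) (mt x0) ^^ n) v) \<longlonglongrightarrow> P0 *v v"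
  have "(\<lambda>k. B k x0) \<longlonglongrightarrow> P0"
    by (rule tendsto_matrixI) (simp add: B_x0_mult lim)
  with proj show thesis
    by (rule that)
qed

text \<open>After \<open>k\<close> steps the remaining factors differ from \<open>mt x0\<close> by a geometric series.\<close>

lemma B_add_close:
  obtains C where "0 \<le> C"
    "\<And>k j x u. norm (B (k + j) x *v u - B j x0 *v (B k x *v u)) \<le> C * \<theta> ^ k * dist x x0 * norm u"
proof -
  obtain L where L: "0 \<le> L" "\<And>x y u. norm (mt x *v u - mt y *v u) \<le> L * dist x y * norm u"
    by (rule mt_lipschitz) blast
  \<comment> \<open>The sum of the geometric series of the errors
    \<open>L * \<theta> ^ n\<close>.\<close>
  define C where "C = L / (1 - \<theta>)"
  have "0 \<le> C" "C * (1 - \<theta>) = L"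
    using L(1) theta by (simp_all add: C_def)
  then have C: "0 \<le> C" "C - C * \<theta> = L"
    by (simp_all add: right_diff_distrib)
  \<comment> \<open>The induction needs the partial sum of the series from \<open>k\<close> to
    \<open>k + j - 1\<close>, which is what the difference of the two powers is; the negative term
    is dropped at the end.\<close>
  have strong: "norm (B (k + j) x *v u - B j x0 *v (B k x *v u))
      \<le> (C * \<theta> ^ k - C * \<theta> ^ (k + j)) * dist x x0 * norm u" for k j x u
  proof (induction j)
    case (Suc j)
    let ?z = "(rti ^^ Suc (k + j)) x"
    let ?w = "B (k + j) x *v u"
    let ?v = "B j x0 *v (B k x *v u)"
    have "norm (mt ?z *v ?w - mt x0 *v ?w) \<le> L * dist ?z x0 * norm ?w"
      by (rule L(2))
    also have "\<dots> \<le> L * (\<theta> ^ (k + j) * dist x x0) * norm u"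
    proof (intro mult_mono order_refl norm_B_le)
      have "dist ?z x0 \<le> \<theta> * (\<theta> ^ (k + j) * dist x x0)"
        using dist_rti_pow_x0[of "Suc (k + j)" x] by (simp only: power_Suc mult.assoc)
      also have "\<dots> \<le> 1 * (\<theta> ^ (k + j) * dist x x0)"
        using theta by (intro mult_right_mono) auto
      finally show "dist ?z x0 \<le> \<theta> ^ (k + j) * dist x x0"
        by simp
    qed (use L(1) theta in auto)
    finally have 1: "norm (mt ?z *v ?w - mt x0 *v ?w) \<le> L * \<theta> ^ (k + j) * dist x x0 * norm u"
      by (simp only: mult.assoc)
    have 2: "norm (mt x0 *v (?w - ?v)) \<le> (C * \<theta> ^ k - C * \<theta> ^ (k + j)) * dist x x0 * norm u"
      using norm_mt_le Suc.IH by (rule order_trans)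
    have "B (k + Suc j) x *v u - B (Suc j) x0 *v (B k x *v u) = (mt ?z *v ?w - mt x0 *v ?w) + mt x0 *v (?w - ?v)"
      by (simp only: add_Suc_right B_Suc' rti_pow_x0 matrix_vector_mul_assoc[symmetric]
          matrix_vector_mult_diff_distrib) simp
    then have "norm (B (k + Suc j) x *v u - B (Suc j) x0 *v (B k x *v u))
        \<le> L * \<theta> ^ (k + j) * dist x x0 * norm u + (C * \<theta> ^ k - C * \<theta> ^ (k + j)) * dist x x0 * norm u"
      using norm_triangle_mono[OF 1 2] by simp
    also have "\<dots> = (C * \<theta> ^ k - C * \<theta> ^ (k + Suc j)) * dist x x0 * norm u"
      unfolding C(2)[symmetric] by (simp add: algebra_simps)
    finally show ?case .
  qed simp
  have "norm (B (k + j) x *v u - B j x0 *v (B k x *v u)) \<le> C * \<theta> ^ k * dist x x0 * norm u" for k j x u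
    by (rule order_trans[OF strong]) (use C(1) theta in \<open>auto intro!: mult_right_mono\<close>)
  with C(1) show thesis
    by (rule that)
qed

text \<open>For fixed \<open>k\<close>, \<open>P0 ** B k x\<close> is the comparison point for all
  large \<open>n\<close>: the \<open>k\<close> rightmost factors are kept, and the others are
  replaced by powers of \<open>mt x0\<close>, which converge to \<open>P0\<close>.\<close>

lemma uniform_limit_B:
  assumes "bounded S"
  shows "uniform_limit S B P sequentially"
proof -
  obtain C where C: "0 \<le> C"
    "\<And>k j x u. norm (B (k + j) x *v u - B j x0 *v (B k x *v u)) \<le> C * \<theta> ^ k * dist x x0 * norm u"
    by (rule B_add_close) blast
  obtain R where R: "\<And>x. x \<in> S \<Longrightarrow> dist x x0 \<le> R" "0 \<le> R"
    using assms unfolding bounded_any_center[of S x0] by (metis dist_commute linorder_linear order_trans)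
  obtain P0 where P0: "(\<lambda>k. B k x0) \<longlonglongrightarrow> P0"
    by (rule obtain_projection)
  \<comment> \<open>\<open>c\<close> converts bounds on vectors into bounds on the Frobenius
    norm.\<close>
  define c where "c = (real CARD('d))\<^sup>2"
  have "0 \<le> c"
    by (simp add: c_def)
  have "uniformly_Cauchy_on S B"
    unfolding uniformly_Cauchy_on_def
  proof (intro allI impI)
    fix e :: real assume "0 < e"
    \<comment> \<open>\<open>k\<close> makes the replacement error small on all of \<open>S\<close>,
      \<open>J\<close> the distance of the powers of \<open>mt x0\<close> from \<open>P0\<close>;
      from \<open>k + J\<close> on both are below \<open>e / 4\<close>.\<close>
    have "(\<lambda>k. c * (C * \<theta> ^ k * R)) \<longlonglongrightarrow> c * (C * 0 * R)"
      using theta by (intro tendsto_intros) auto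
    then have "eventually (\<lambda>k. c * (C * \<theta> ^ k * R) < e / 4) sequentially"
      using \<open>0 < e\<close> by (intro order_tendstoD) auto
    then obtain k where k: "c * (C * \<theta> ^ k * R) < e / 4"
      by (meson eventually_sequentially order_refl)
    have "(\<lambda>j. c * norm (B j x0 - P0)) \<longlonglongrightarrow> c * norm (P0 - P0)"
      by (intro tendsto_intros P0)
    then have "eventually (\<lambda>j. c * norm (B j x0 - P0) < e / 4) sequentially"
      using \<open>0 < e\<close> by (intro order_tendstoD) auto
    then obtain J where J: "\<And>j. J \<le> j \<Longrightarrow> c * norm (B j x0 - P0) < e / 4"
      by (meson eventually_sequentially)
    have close: "norm (B n x - P0 ** B k x) < e / 2" if "k + J \<le> n" "x \<in> S" for n x
    proof -
      define j where "j = n - k"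
      have j: "n = k + j" "J \<le> j"
        using that(1) by (auto simp: j_def)
      have "norm ((B n x - P0 ** B k x) *v u) \<le> (C * \<theta> ^ k * R + norm (B j x0 - P0)) * norm u" for u
      proof -
        have eq: "(B n x - P0 ** B k x) *v u =
            (B (k + j) x *v u - B j x0 *v (B k x *v u)) + (B j x0 - P0) *v (B k x *v u)"
          by (simp add: j(1) matrix_vector_mult_diff_rdistrib flip: matrix_vector_mul_assoc)
        have "norm (B (k + j) x *v u - B j x0 *v (B k x *v u)) \<le> C * \<theta> ^ k * R * norm u"
          by (rule order_trans[OF C(2)]) (use R(1)[OF that(2)] R(2) C(1) theta in \<open>auto intro!: mult_mono\<close>)
        moreover have "norm ((B j x0 - P0) *v (B k x *v u)) \<le> norm (B j x0 - P0) * norm u"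
          by (rule order_trans[OF norm_matrix_vector_le]) (intro mult_left_mono norm_B_le norm_ge_zero)
        ultimately show ?thesis
          unfolding eq distrib_right by (rule norm_triangle_mono)
      qed
      then have "norm (B n x - P0 ** B k x) \<le> c * (C * \<theta> ^ k * R + norm (B j x0 - P0))"
        unfolding c_def by (rule norm_matrix_le)
      also have "\<dots> < e / 2"
        using k J[OF j(2)] by (simp add: distrib_left)
      finally show ?thesis .
    qed
    show "\<exists>M. \<forall>x\<in>S. \<forall>m\<ge>M. \<forall>n\<ge>M. dist (B m x) (B n x) < e"
    proof (intro exI ballI allI impI)
      fix x m n assume "x \<in> S" "k + J \<le> m" "k + J \<le> n"
      then show "dist (B m x) (B n x) < e"
        using dist_triangle_half_l[of "B m x" "P0 ** B k x" e "B n x"] close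
        by (simp add: dist_norm)
    qed
  qed
  then show ?thesis
    unfolding uniformly_convergent_eq_Cauchy[symmetric] uniformly_convergent_uniform_limit_iff
      limit_product_def .
qed

lemma tendsto_B: "(\<lambda>k. B k x) \<longlonglongrightarrow> P x"
  using uniform_limit_B[of "{x}"] by simp

lemma tendsto_B_mult: "(\<lambda>k. B k x *v u) \<longlonglongrightarrow> P x *v u"
  by (rule bounded_bilinear.tendsto[OF bounded_bilinear_matrix_vector_mult tendsto_B tendsto_const])

lemma norm_P_le: "norm (P x *v u) \<le> norm u"
  by (rule LIMSEQ_le_const2[OF tendsto_norm[OF tendsto_B_mult]]) (use norm_B_le in blast)

lemma P_mult_refine: "P (rti x) *v (mt (rti x) *v u) = P x *v u"
proof (rule LIMSEQ_unique)
  show "(\<lambda>k. B (Suc k) x *v u) \<longlonglongrightarrow> P (rti x) *v (mt (rti x) *v u)"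
    unfolding B_Suc matrix_vector_mul_assoc[symmetric] by (rule tendsto_B_mult)
  show "(\<lambda>k. B (Suc k) x *v u) \<longlonglongrightarrow> P x *v u"
    using tendsto_B_mult by (rule LIMSEQ_Suc)
qed

lemma P_refine: "P (rti x) ** mt (rti x) = P x"
  by (simp add: matrix_eq P_mult_refine flip: matrix_vector_mul_assoc)

lemma tendsto_rti_pow: "(\<lambda>k. (rti ^^ k) x) \<longlonglongrightarrow> x0"
proof (rule tendsto_dist_iff[THEN iffD2], rule Lim_null_comparison)
  show "(\<lambda>k. \<theta> ^ k * dist x x0) \<longlonglongrightarrow> 0"
    using theta by (intro tendsto_mult_left_zero LIMSEQ_power_zero) auto
qed (simp add: dist_rti_pow_x0)

lemma mt_x0_P_mult: "mt x0 *v (P x *v u) = P x *v u"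
proof (rule LIMSEQ_unique)
  have "(\<lambda>k. mt ((rti ^^ Suc k) x)) \<longlonglongrightarrow> mt x0"
    using continuous_on_tendsto_compose[OF continuous_mt LIMSEQ_Suc[OF tendsto_rti_pow]] by simp
  then show "(\<lambda>k. B (Suc k) x *v u) \<longlonglongrightarrow> mt x0 *v (P x *v u)"
    unfolding B_Suc' matrix_vector_mul_assoc[symmetric]
    by (rule bounded_bilinear.tendsto[OF bounded_bilinear_matrix_vector_mult _ tendsto_B_mult])
  show "(\<lambda>k. B (Suc k) x *v u) \<longlonglongrightarrow> P x *v u"
    using tendsto_B_mult by (rule LIMSEQ_Suc)
qed

lemma P_x0_projection: "is_orth_proj_onto (P x0) {v. mt x0 *v v = v}"
  by (rule obtain_projection) (metis LIMSEQ_unique tendsto_B)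

lemma branch_x0:
  assumes "mt x0 *v v = v" "i \<in> {1..q}" "i \<noteq> 1"
  shows "branch i x0 v = 0"
proof -
  have "branch 1 x0 v = mt x0 *v v"
    unfolding branch_def psi_1 rti_x0 mt_mult fixed_point ..
  then have "(norm v)\<^sup>2 = (norm v)\<^sup>2 + (\<Sum>i\<in>{1..q} - {1}. (norm (branch i x0 v))\<^sup>2)"
    using sum_norm_branch[of x0 v] one_le_q assms(1) by (simp add: sum.remove[of _ 1])
  then have "(\<Sum>i\<in>{1..q} - {1}. (norm (branch i x0 v))\<^sup>2) = 0"
    by simp
  then show ?thesis
    using assms(2,3) by (subst (asm) sum_nonneg_eq_0_iff) auto
qed

text \<open>The energy of a fixed vector \<open>v\<close> at \<open>x0\<close> stays on the branch through \<open>x0\<close>, so all other branches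
  kill it.  Removing factors \<open>A\<close> from \<open>g\<close> moves \<open>act g x0\<close> towards \<open>x0\<close>, and
  by proper discontinuity this stops.\<close>

lemma P_translate_x0:
  assumes "mt x0 *v v = v" "g \<in> carrier G" "g \<noteq> \<one>\<^bsub>G\<^esub>"
  shows "P (act g x0) *v coord \<tau> (act g x0) (\<tau> x0 v) = 0"
proof -
  obtain e where e: "0 < e"
    "\<And>g h. g \<in> carrier G \<Longrightarrow> h \<in> carrier G \<Longrightarrow> g \<noteq> h \<Longrightarrow> e \<le> dist (act g x0) (act h x0)"
    by (rule orbit_separated[of x0]) blast
  \<comment> \<open>After \<open>n\<close> contractions the distance to \<open>x0\<close> would fall
    below the separation \<open>e\<close> of the orbit; for \<open>n = 0\<close> this contradicts
    \<open>g\<close> being different from the unit.\<close>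
  have "P (act g x0) *v coord \<tau> (act g x0) (\<tau> x0 v) = 0"
    if "\<theta> ^ n * dist (act g x0) x0 < e" "g \<in> carrier G" "g \<noteq> \<one>\<^bsub>G\<^esub>" for n g
    using that
  proof (induction n arbitrary: g)
    case 0
    then show ?case
      using e(2)[of g "\<one>\<^bsub>G\<^esub>"] by simp
  next
    case (Suc n)
    obtain i h where ih: "i \<in> {1..q}" "h \<in> carrier G" "g = A h \<otimes>\<^bsub>G\<^esub> gs i"
      using obtain_coset_rep[OF Suc.prems(2)] .
    have rti_g: "rti (act g x0) = act h (psi i x0)"
      unfolding ih(3) by (rule rti_act_coset[OF ih(1,2)])
    then have g: "act g x0 = rt (act h (psi i x0))"
      by (metis rt_rti)
    have "P (act g x0) *v coord \<tau> (act g x0) (\<tau> x0 v) =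
        P (act h (psi i x0)) *v (mt (act h (psi i x0)) *v coord \<tau> (act g x0) (\<tau> x0 v))"
      unfolding P_mult_refine[of "act g x0", symmetric] rti_g ..
    also have "mt (act h (psi i x0)) *v coord \<tau> (act g x0) (\<tau> x0 v) =
        coord \<tau> (act h (psi i x0)) (m (p (psi i x0)) (\<tau> x0 v))"
      using ih(2) Suc.prems(2) by (simp add: mt_mult flip: g)
    also have "P (act h (psi i x0)) *v \<dots> = 0"
    \<comment> \<open>On the branch through \<open>x0\<close> the vector is carried unchanged and
      \<open>g = A h\<close> is replaced by \<open>h\<close>, whose translate of \<open>x0\<close>
      is closer; on any other branch the vector has become zero.\<close>
    proof (cases "i = 1")
      case True
      then have "g = A h"
        using ih(2) unfolding ih(3) True reps_one by simp
      then have "h \<noteq> \<one>\<^bsub>G\<^esub>"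
        using Suc.prems(3) hom_one[OF endo group group] by blast
      have psi: "psi i x0 = x0"
        unfolding True psi_1 by simp
      have "\<theta> ^ n * dist (act h x0) x0 \<le> \<theta> ^ n * (\<theta> * dist (act g x0) x0)"
        using dist_rti[of "act g x0" x0] theta
        by (intro mult_left_mono) (simp_all add: rti_g[unfolded psi])
      then have "\<theta> ^ n * dist (act h x0) x0 < e"
        using Suc.prems(1) by (simp add: mult_ac)
      then have "P (act h x0) *v coord \<tau> (act h x0) (\<tau> x0 v) = 0"
        using Suc.IH ih(2) \<open>h \<noteq> _\<close> by blast
      moreover have "m (p x0) (\<tau> x0 v) = \<tau> x0 v"
      proof -
        have "\<tau> x0 (coord \<tau> x0 (m (p x0) (\<tau> x0 v))) = \<tau> x0 v"
          using assms(1) mt_mult[of x0 v] by (simp add: fixed_point)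
        then show ?thesis
          by (simp add: fixed_point)
      qed
      ultimately show ?thesis
        by (simp only: psi)
    next
      case False
      have "norm (coord \<tau> (act h (psi i x0)) (m (p (psi i x0)) (\<tau> x0 v))) = norm (branch i x0 v)"
        unfolding branch_def using pi_branch[OF ih(1)] ih(2) by (intro norm_coord_eq) simp_all
      then show ?thesis
        using branch_x0[OF assms(1) ih(1) False] by simp
    qed
    finally show ?case .
  qed
  moreover have "(\<lambda>n. \<theta> ^ n * dist (act g x0) x0) \<longlonglongrightarrow> 0"
    using theta by (intro tendsto_mult_left_zero LIMSEQ_power_zero) auto
  then have "eventually (\<lambda>n. \<theta> ^ n * dist (act g x0) x0 < e) sequentially"
    using e(1) by (rule order_tendstoD)
  then have "\<exists>n. \<theta> ^ n * dist (act g x0) x0 < e"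
    by (meson eventually_sequentially order_refl)
  ultimately show ?thesis
    using assms(2,3) by blast
qed

end

section \<open>Lipschitz estimates along orbits\<close>

context transfer_setting
begin

interpretation grp: group G
  by (rule group)

text \<open>The transition function of the trivialization along the deck transformation
  \<open>g\<close>, a unitary cocycle; it measures how far \<open>\<tau>\<close> is from descending
  to the quotient.\<close>

definition shift :: "'g \<Rightarrow> 'x \<Rightarrow> complex ^ 'd \<Rightarrow> complex ^ 'd" where
  "shift g x u = coord \<tau> (act g x) (\<tau> x u)"

lemma shift_diff: "g \<in> carrier G \<Longrightarrow> shift g x u - shift g x v = shift g x (u - v)"
  using coord_add[of "\<tau> x (u - v)" "act g x" "\<tau> x v"]
  by (simp add: shift_def flip: triv_add)

lemma shift_add: "g \<in> carrier G \<Longrightarrow> shift g x (u + v) = shift g x u + shift g x v"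
  by (simp add: shift_def triv_add coord_add)

lemma shift_scale: "g \<in> carrier G \<Longrightarrow> shift g x (c *s u) = c *s shift g x u"
  by (simp add: shift_def triv_scale coord_scale)

lemma norm_shift [simp]: "g \<in> carrier G \<Longrightarrow> norm (shift g x u) = norm u"
  using norm_coord_eq[of "\<tau> x u" "act g x" x] by (simp add: shift_def)

lemma shift_mult:
  "g \<in> carrier G \<Longrightarrow> h \<in> carrier G \<Longrightarrow> shift (g \<otimes>\<^bsub>G\<^esub> h) x u = shift g (act h x) (shift h x u)"
  by (simp add: shift_def act_mult)

section \<open>Lipschitz continuity of the transition functions\<close>

lemma chart_frame:
  assumes "(U, t) \<in> charts" "p x \<in> U"
  shows "t (p x) (matrix (\<lambda>v. inv_into UNIV (t (p x)) (\<tau> x v)) *v u) = \<tau> x u"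
proof -
  let ?t = "t (p x)"
  have loc: "local_trivialization \<pi> vadd smul U t"
    by (rule charts[OF assms(1)])
  then obtain t' where t': "homeomorphism (U \<times> UNIV) (\<pi> -` U) (\<lambda>(y, v). t y v) t'"
    unfolding local_trivialization_def by blast
  have pi_t: "\<pi> (t y v) = y" and t_add: "?t (u + v) = vadd (?t u) (?t v)" and t_scale: "?t (c *s v) = smul c (?t v)"
    if "y \<in> U" for y u v c
    using loc assms(2) that unfolding local_trivialization_def by blast+
  have inj: "inj ?t"
  proof (rule injI)
    fix u v assume "?t u = ?t v"
    then show "u = v"
      using homeomorphism_apply1[OF t', of "(p x, u)"] homeomorphism_apply1[OF t', of "(p x, v)"] assms(2)
      by simp
  qed
  have surj: "?t (inv_into UNIV ?t a) = a" if a: "\<pi> a = p x" for a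
  proof -
    obtain y v where yv: "t' a = (y, v)"
      by fastforce
    have "a \<in> \<pi> -` U"
      using a assms(2) by simp
    then have "(y, v) \<in> U \<times> UNIV"
      using homeomorphism_image2[OF t'] yv by (metis imageI)
    then have "t y v = a" "y \<in> U"
      using homeomorphism_apply2[OF t' \<open>a \<in> _\<close>] yv by auto
    then have "a = ?t v"
      using pi_t[of y v] a by simp
    then show ?thesis
      by (simp add: f_inv_into_f)
  qed
  have "Vector_Spaces.linear (*s) (*s) (\<lambda>v. inv_into UNIV ?t (\<tau> x v))"
  proof unfold_locales
    show "inv_into UNIV ?t (\<tau> x (u + v)) = inv_into UNIV ?t (\<tau> x u) + inv_into UNIV ?t (\<tau> x v)" for u v
      by (rule inv_into_f_eq[OF inj]) (auto simp: t_add[OF assms(2)] surj triv_add)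
    show "inv_into UNIV ?t (\<tau> x (c *s v)) = c *s inv_into UNIV ?t (\<tau> x v)" for c v
      by (rule inv_into_f_eq[OF inj]) (auto simp: t_scale[OF assms(2)] surj triv_scale)
  qed
  then have "matrix (\<lambda>v. inv_into UNIV ?t (\<tau> x v)) *v u = inv_into UNIV ?t (\<tau> x u)"
    by (rule matrix_works)
  then show ?thesis
    by (simp add: surj)
qed

text \<open>In a chart, \<open>shift g x\<close> is the quotient of the two Lipschitz frames at \<open>act g x\<close> and \<open>x\<close>; the first
  of them is bounded below near \<open>x\<close>.\<close>

lemma shift_locally_lipschitz:
  assumes g: "g \<in> carrier G"
  shows "\<exists>e C. 0 < e \<and> 0 \<le> C \<and> (\<forall>y\<in>ball x e. \<forall>z\<in>ball x e. \<forall>u.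
    norm (shift g y u - shift g z u) \<le> C * dist y z * norm u)"
proof -
  have "p x \<in> (\<Union>(U, t)\<in>charts. U)"
    by (simp only: charts_cover UNIV_I)
  then obtain U t where chart: "(U, t) \<in> charts" "p x \<in> U"
    by auto
  let ?N = "\<lambda>x. matrix (\<lambda>v. inv_into UNIV (t (p x)) (\<tau> x v))"
  have loc: "locally_lipschitz_on (p -` U) ?N"
    by (rule triv_lipschitz[OF chart(1)])
  have "open U"
    using charts[OF chart(1)] by (simp add: local_trivialization_def)
  then have "open (p -` U)"
    using continuous_p by (simp add: open_vimage)
  then obtain e0 where e0: "0 < e0" "ball x e0 \<subseteq> p -` U"
    using chart(2) by (metis openE vimage_eq)
  have t_inj: "v = w" if "y \<in> U" "t y v = t y w" for y v w
  proof -
    obtain t' where t': "homeomorphism (U \<times> UNIV) (\<pi> -` U) (\<lambda>(y, v). t y v) t'"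
      using charts[OF chart(1)] unfolding local_trivialization_def by blast
    show ?thesis
      using homeomorphism_apply1[OF t', of "(y, v)"] homeomorphism_apply1[OF t', of "(y, w)"] that by simp
  qed
  have frame_shift: "?N (act g y) *v shift g y u = ?N y *v u" if "p y \<in> U" for y u
  proof (rule t_inj[OF that])
    have "t (p y) (?N (act g y) *v shift g y u) = \<tau> (act g y) (shift g y u)"
      using chart_frame[OF chart(1), of "act g y" "shift g y u"] that g by simp
    also have "\<dots> = \<tau> y u"
      using g by (simp add: shift_def)
    also have "\<dots> = t (p y) (?N y *v u)"
      using chart_frame[OF chart(1) that] by simp
    finally show "t (p y) (?N (act g y) *v shift g y u) = t (p y) (?N y *v u)" .
  qed
  obtain e1 L1 where e1: "0 < e1" "L1-lipschitz_on (ball x e1 \<inter> p -` U) ?N"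
    using loc[unfolded locally_lipschitz_on_def, rule_format, of x] chart(2) by auto
  obtain e2 L2 where e2: "0 < e2" "L2-lipschitz_on (ball (act g x) e2 \<inter> p -` U) ?N"
    using loc[unfolded locally_lipschitz_on_def, rule_format, of "act g x"] chart(2) g by auto
  have L: "0 \<le> L1" "0 \<le> L2"
    using e1(2) e2(2) by (auto intro: lipschitz_on_nonneg)
  have "inj ((*v) (?N (act g x)))"
  proof (rule injI)
    fix v w assume "?N (act g x) *v v = ?N (act g x) *v w"
    then have "\<tau> (act g x) v = \<tau> (act g x) w"
      using chart_frame[OF chart(1), of "act g x"] chart(2) g by (metis p_act)
    then show "v = w"
      by (metis coord_tau)
  qed
  then obtain c where c: "0 < c" "\<And>w. c * norm w \<le> norm (?N (act g x) *v w)"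
    using linear_inj_bounded_below_pos[OF matrix_vector_mul_linear] by blast
  \<comment> \<open>The last entry keeps \<open>L2 * dist x y\<close> at most \<open>c / 2\<close>,
    so the lower bound \<open>c\<close> at \<open>act g x\<close> survives nearby as
    \<open>c / 2\<close>; \<open>L2 + 1\<close> avoids division by zero.\<close>
  define e where "e = Min {e0, e1, e2, c / (2 * (L2 + 1))}"
  have "0 < e"
    using e0(1) e1(1) e2(1) c(1) L by (simp add: e_def)
  have e_le: "e \<le> e0" "e \<le> e1" "e \<le> e2" "e \<le> c / (2 * (L2 + 1))"
    by (auto simp: e_def)
  have in_U: "p y \<in> U" if "y \<in> ball x e" for y
    using subsetD[OF e0(2), of y] that e_le(1) by simp
  have Lip1: "norm (?N y - ?N z) \<le> L1 * dist y z" if "y \<in> ball x e" "z \<in> ball x e" for y z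
    using lipschitz_onD[OF e1(2), of y z] that in_U e_le by (auto simp: dist_norm)
  have Lip2: "norm (?N (act g y) - ?N (act g z)) \<le> L2 * dist y z" if "y \<in> ball x e" "z \<in> ball x e" for y z
    using lipschitz_onD[OF e2(2), of "act g y" "act g z"] that in_U e_le g by (auto simp: dist_norm[symmetric] isometric)
  have below: "c / 2 * norm w \<le> norm (?N (act g y) *v w)" if y: "y \<in> ball x e" for y w
  proof -
    have "norm (?N (act g x) - ?N (act g y)) \<le> L2 * dist x y"
      using Lip2[of x y] y \<open>0 < e\<close> by simp
    also have "\<dots> \<le> (L2 + 1) * (c / (2 * (L2 + 1)))"
      using y e_le(4) L by (intro mult_mono) auto
    also have "\<dots> = c / 2"
      using L by (simp add: divide_simps)
    finally have "norm ((?N (act g x) - ?N (act g y)) *v w) \<le> c / 2 * norm w"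
      by (rule order_trans[OF norm_matrix_vector_le mult_right_mono]) simp
    moreover have "norm (?N (act g x) *v w) \<le> norm ((?N (act g x) - ?N (act g y)) *v w) + norm (?N (act g y) *v w)"
      unfolding matrix_vector_mult_diff_rdistrib by (metis diff_add_cancel norm_triangle_ineq)
    ultimately show ?thesis
      using c(2)[of w] by (simp add: field_simps)
  qed
  define C where "C = 2 * (L1 + L2) / c"
  have "norm (shift g y u - shift g z u) \<le> C * dist y z * norm u"
    if yz: "y \<in> ball x e" "z \<in> ball x e" for y z u
  proof -
    \<comment> \<open>Insert \<open>?N z *v u = ?N (act g z) *v shift g z u\<close>; since
      \<open>shift g z\<close> is isometric, the last term brings no new constant.\<close>
    have "?N (act g y) *v (shift g y u - shift g z u) =
        (?N y - ?N z) *v u + (?N (act g z) - ?N (act g y)) *v shift g z u"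
      by (simp add: matrix_vector_mult_diff_distrib matrix_vector_mult_diff_rdistrib
          frame_shift[OF in_U[OF yz(1)]] frame_shift[OF in_U[OF yz(2)]])
    moreover have "norm ((?N y - ?N z) *v u) \<le> L1 * dist y z * norm u"
      by (rule order_trans[OF norm_matrix_vector_le mult_right_mono[OF Lip1[OF yz]]]) simp
    moreover have "norm ((?N (act g z) - ?N (act g y)) *v shift g z u) \<le> L2 * dist y z * norm u"
      using order_trans[OF norm_matrix_vector_le mult_right_mono[OF Lip2[OF yz(2,1)]], of "shift g z u"] g
      by (simp add: dist_commute)
    ultimately have "norm (?N (act g y) *v (shift g y u - shift g z u)) \<le> (L1 + L2) * dist y z * norm u"
      by (simp add: distrib_right norm_triangle_mono)
    then have "c / 2 * norm (shift g y u - shift g z u) \<le> (L1 + L2) * dist y z * norm u"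
      by (rule order_trans[OF below[OF yz(1)]])
    then show ?thesis
      using c(1) by (simp add: C_def field_simps)
  qed
  moreover have "0 \<le> C"
    using c(1) L by (simp add: C_def)
  ultimately show ?thesis
    using \<open>0 < e\<close> by blast
qed

text \<open>Local constants become uniform by compactness: a Lebesgue number puts \<open>x\<close>
  and a nearby \<open>y\<close>, possibly outside \<open>K\<close>, into one covering ball.
  Uniformity in \<open>g\<close> comes from the finiteness of \<open>\<Lambda>\<close>.\<close>

lemma shift_uniformly_lipschitz:
  assumes K: "compact K" and "finite \<Lambda>" "\<Lambda> \<subseteq> carrier G"
  shows "\<exists>\<delta> C. 0 < \<delta> \<and> 0 \<le> C \<and> (\<forall>g\<in>\<Lambda>. \<forall>x\<in>K. \<forall>y\<in>ball x \<delta>. \<forall>u.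
    norm (shift g x u - shift g y u) \<le> C * dist x y * norm u)"
  using assms(2,3)
proof (induction rule: finite_induct)
  case empty
  show ?case
    by (rule exI[of _ 1]) auto
next
  case (insert g \<Lambda>)
  then obtain \<delta> C where \<delta>: "0 < \<delta>" "0 \<le> C" "\<And>g x y u. g \<in> \<Lambda> \<Longrightarrow> x \<in> K \<Longrightarrow> y \<in> ball x \<delta> \<Longrightarrow>
      norm (shift g x u - shift g y u) \<le> C * dist x y * norm u"
    by auto
  have "\<forall>x. \<exists>f. 0 < fst f \<and> 0 \<le> snd f \<and> (\<forall>y\<in>ball x (fst f). \<forall>z\<in>ball x (fst f). \<forall>u.
      norm (shift g y u - shift g z u) \<le> snd f * dist y z * norm u)"
    using shift_locally_lipschitz insert.prems by simp
  then obtain f where f: "\<And>x. 0 < fst (f x)" "\<And>x. 0 \<le> snd (f x)"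
    "\<And>x y z u. y \<in> ball x (fst (f x)) \<Longrightarrow> z \<in> ball x (fst (f x)) \<Longrightarrow>
      norm (shift g y u - shift g z u) \<le> snd (f x) * dist y z * norm u"
    by (drule_tac choice) blast
  obtain D where D: "finite D" "K \<subseteq> (\<Union>x\<in>D. ball x (fst (f x)))"
    by (rule compact_ball_cover[OF K f(1)])
  obtain \<epsilon> where \<epsilon>: "0 < \<epsilon>" "\<And>x. x \<in> K \<Longrightarrow> \<exists>B\<in>(\<lambda>x. ball x (fst (f x))) ` D. ball x \<epsilon> \<subseteq> B"
    using Heine_Borel_lemma[OF K D(2)] by blast
  \<comment> \<open>The sum over the finitely many centres dominates every local constant.\<close>
  define C' where "C' = C + (\<Sum>x\<in>D. snd (f x))"
  have C': "C \<le> C'" "0 \<le> C'"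
    unfolding C'_def using f(2) \<delta>(2) by (auto intro: sum_nonneg add_nonneg_nonneg)
  have C'_ge: "snd (f z) \<le> C'" if "z \<in> D" for z
    using member_le_sum[of z D "\<lambda>x. snd (f x)"] that D(1) f(2) \<delta>(2) by (simp add: C'_def)
  have "norm (shift h x u - shift h y u) \<le> C' * dist x y * norm u"
    if h: "h \<in> insert g \<Lambda>" and x: "x \<in> K" and y: "y \<in> ball x (min \<delta> \<epsilon>)" for h x y u
  proof (cases "h \<in> \<Lambda>")
    case True
    then have "norm (shift h x u - shift h y u) \<le> C * dist x y * norm u"
      using \<delta>(3) x y by simp
    also have "\<dots> \<le> C' * dist x y * norm u"
      using C'(1) by (intro mult_right_mono) auto
    finally show ?thesis .
  next
    case False
    obtain z where z: "z \<in> D" "ball x \<epsilon> \<subseteq> ball z (fst (f z))"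
      using \<epsilon>(2)[OF x] by blast
    then have "x \<in> ball z (fst (f z))" "y \<in> ball z (fst (f z))"
      using y \<epsilon>(1) by (meson centre_in_ball subsetD, auto)
    then have "norm (shift h x u - shift h y u) \<le> snd (f z) * dist x y * norm u"
      using f(3) h False by blast
    also have "\<dots> \<le> C' * dist x y * norm u"
      using C'_ge[OF z(1)] by (intro mult_right_mono) auto
    finally show ?thesis .
  qed
  then show ?case
    using \<delta>(1) \<epsilon>(1) C'(2) by (intro exI[of _ "min \<delta> \<epsilon>"] exI[of _ C']) simp
qed

text \<open>\<open>orbit_coeff \<Phi> x u\<close> is the family, along the orbit of \<open>x\<close>, of the values of the functional \<open>\<langle>\<Phi>, _\<rangle>\<close> at the
  fibre vector with the coordinates \<open>u\<close> at \<open>x\<close>; \<open>shift g x u\<close> are the coordinates of this vector at \<open>act g x\<close>.\<close>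

definition orbit_coeff :: "('x \<Rightarrow> complex ^ 'd) \<Rightarrow> 'x \<Rightarrow> complex ^ 'd \<Rightarrow> 'g \<Rightarrow> complex" where
  "orbit_coeff \<Phi> x u g = cinner_std (\<Phi> (act g x)) (shift g x u)"

definition refine_symbol :: "('x \<Rightarrow> complex ^ 'd) \<Rightarrow> 'x \<Rightarrow> complex ^ 'd" where
  "refine_symbol \<Phi> x = adjoint_matrix (mt (rti x)) *v \<Phi> (rti x)"

text \<open>Only \<open>x\<close> is confined to \<open>K\<close>; its partner \<open>y\<close> may
  leave it. The vector \<open>u\<close> has the same coordinates at \<open>x\<close> and
  \<open>y\<close>, although the two fibres differ.\<close>

definition l2_lipschitz_on :: "'x set \<Rightarrow> real \<Rightarrow> real \<Rightarrow> ('x \<Rightarrow> complex ^ 'd) \<Rightarrow> bool" where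
  "l2_lipschitz_on K \<delta> D \<Phi> \<longleftrightarrow> (\<forall>x\<in>K. \<forall>y\<in>ball x \<delta>. \<forall>u.
     l2_le (carrier G) (\<lambda>g. orbit_coeff \<Phi> x u g - orbit_coeff \<Phi> y u g) (D * dist x y * norm u))"

definition l2_bounded :: "real \<Rightarrow> ('x \<Rightarrow> complex ^ 'd) \<Rightarrow> bool" where
  "l2_bounded E \<Phi> \<longleftrightarrow> (\<forall>x u. l2_le (carrier G) (orbit_coeff \<Phi> x u) (E * norm u))"

lemma orbit_coeff_diff:
  "g \<in> carrier G \<Longrightarrow> orbit_coeff \<Phi> x u g - orbit_coeff \<Phi> x v g = orbit_coeff \<Phi> x (u - v) g"
  by (simp add: orbit_coeff_def flip: cinner_std_diff_right shift_diff)

lemma orbit_coeff_translate: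
  "g \<in> carrier G \<Longrightarrow> h \<in> carrier G \<Longrightarrow>
    orbit_coeff \<Phi> x u (g \<otimes>\<^bsub>G\<^esub> h) = orbit_coeff \<Phi> (act h x) (shift h x u) g"
  by (simp add: orbit_coeff_def shift_mult act_mult)

lemma l2_boundedD: "l2_bounded E \<Phi> \<Longrightarrow> l2_le (carrier G) (orbit_coeff \<Phi> x u) (E * norm u)"
  by (simp add: l2_bounded_def)

lemma l2_lipschitz_onD:
  "l2_lipschitz_on K \<delta> D \<Phi> \<Longrightarrow> x \<in> K \<Longrightarrow> dist x y < \<delta> \<Longrightarrow>
    l2_le (carrier G) (\<lambda>g. orbit_coeff \<Phi> x u g - orbit_coeff \<Phi> y u g) (D * dist x y * norm u)"
  by (simp add: l2_lipschitz_on_def)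

lemma l2_bounded_nonneg:
  assumes "l2_bounded E \<Phi>"
  shows "0 \<le> E"
  using l2_le_nonneg[OF l2_boundedD[OF assms, of x0 "axis undefined 1"]] by simp

text \<open>Change the base point first and the vector afterwards; the second change is linear and
  costs only \<open>E\<close>.\<close>

lemma l2_le_orbit_coeff_change:
  assumes "l2_le (carrier G) (\<lambda>g. orbit_coeff \<Phi> x u g - orbit_coeff \<Phi> y u g) B" "l2_bounded E \<Phi>"
  shows "l2_le (carrier G) (\<lambda>g. orbit_coeff \<Phi> x u g - orbit_coeff \<Phi> y v g) (B + E * norm (u - v))"
proof -
  have "l2_le (carrier G) (\<lambda>g. (orbit_coeff \<Phi> x u g - orbit_coeff \<Phi> y u g) + orbit_coeff \<Phi> y (u - v) g)
      (B + E * norm (u - v))"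
    by (rule l2_le_add[OF assms(1) l2_boundedD[OF assms(2)]])
  then show ?thesis
    by (rule l2_le_cong[THEN iffD1, rotated]) (simp flip: orbit_coeff_diff)
qed

end

section \<open>The refinement step on families along orbits\<close>

context normalized_transfer_setting
begin

interpretation grp: group G
  by (rule group)

lemma L2_set_norm_branch: "L2_set (\<lambda>i. norm (branch i x u)) {1..q} = norm u"
  unfolding L2_set_def sum_norm_branch by simp

text \<open>Both sides are the coordinates at \<open>act h (psi i x)\<close> of one fibre vector,
  the image of \<open>\<tau> x u\<close> under \<open>m\<close>. The left side exhibits it as a
  product of two factors whose Lipschitz constants are known.\<close>

lemma mt_shift:
  assumes "i \<in> {1..q}" "h \<in> carrier G"
  shows "mt (act h (psi i x)) *v shift (A h \<otimes>\<^bsub>G\<^esub> gs i) x u = shift h (psi i x) (branch i x u)"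
proof -
  let ?g = "A h \<otimes>\<^bsub>G\<^esub> gs i"
  have g: "?g \<in> carrier G"
    using assms by (simp add: reps_carrier)
  have "rt (act h (psi i x)) = act ?g x"
    using rti_act_coset[OF assms] rt_rti by metis
  then have "mt (act h (psi i x)) *v shift ?g x u = coord \<tau> (act h (psi i x)) (m (p (psi i x)) (\<tau> x u))"
    using assms(2) g by (simp add: mt_mult shift_def)
  also have "\<dots> = shift h (psi i x) (branch i x u)"
    using pi_branch[OF assms(1)] by (simp add: shift_def branch_def)
  finally show ?thesis .
qed

lemma orbit_coeff_refine:
  assumes "i \<in> {1..q}" "h \<in> carrier G"
  shows "orbit_coeff (refine_symbol \<Phi>) x u (A h \<otimes>\<^bsub>G\<^esub> gs i) = orbit_coeff \<Phi> (psi i x) (branch i x u) h"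
  unfolding orbit_coeff_def refine_symbol_def rti_act_coset[OF assms] cinner_std_adjoint mt_shift[OF assms] ..

text \<open>The cosets carry the bounds \<open>E * norm (branch i x u)\<close>, and these combine to
  \<open>E * norm u\<close> without loss.\<close>

lemma l2_bounded_refine:
  assumes "l2_bounded E \<Phi>"
  shows "l2_bounded E (refine_symbol \<Phi>)"
  unfolding l2_bounded_def
proof (intro allI)
  fix x u
  have "l2_le (carrier G) (orbit_coeff (refine_symbol \<Phi>) x u) (L2_set (\<lambda>i. E * norm (branch i x u)) {1..q})"
  proof (rule l2_le_coset_split)
    fix i assume "i \<in> {1..q}"
    then show "l2_le (carrier G) (\<lambda>h. orbit_coeff (refine_symbol \<Phi>) x u (A h \<otimes>\<^bsub>G\<^esub> gs i)) (E * norm (branch i x u))"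
      using l2_boundedD[OF assms, of "psi i x" "branch i x u"]
      by (subst l2_le_cong[OF orbit_coeff_refine]) auto
  qed
  then show "l2_le (carrier G) (orbit_coeff (refine_symbol \<Phi>) x u) (E * norm u)"
    using l2_bounded_nonneg[OF assms] by (simp only: L2_set_norm_branch flip: L2_set_right_distrib)
qed

text \<open>\<open>psi i\<close> contracts by \<theta> but may leave \<open>K\<close>, where the
  hypothesis on \<open>\<Phi>\<close> holds; hence the translation back into \<open>K\<close>, at
  the price of transition functions. They occur only for elements carrying a point of
  \<open>K\<close> into the image of \<open>K\<close> under \<open>rt\<close>.\<close>

lemma l2_lipschitz_on_refine:
  assumes K: "p ` K = UNIV"
    and \<Lambda>: "\<And>g x y u. g \<in> carrier G \<Longrightarrow> x \<in> K \<Longrightarrow> act g x \<in> rt ` K \<Longrightarrow> dist x y < \<delta> \<Longrightarrow>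
      norm (shift g x u - shift g y u) \<le> C * dist x y * norm u"
    and L: "\<And>x y u. norm (mt x *v u - mt y *v u) \<le> L * dist x y * norm u" "0 \<le> L"
    and C: "0 \<le> C"
    and D: "l2_lipschitz_on K \<delta> D \<Phi>" "0 \<le> D"
    and E: "l2_bounded E \<Phi>"
  shows "l2_lipschitz_on K \<delta> (\<theta> * D + E * (C + L) * sqrt q) (refine_symbol \<Phi>)"
  unfolding l2_lipschitz_on_def
proof (intro ballI allI)
  fix x y u assume x: "x \<in> K" and "y \<in> ball x \<delta>"
  then have y: "dist x y < \<delta>"
    by simp
  let ?d = "dist x y"
  let ?B = "\<lambda>i. D * (\<theta> * ?d) * norm (branch i x u) + E * ((C + L) * ?d * norm u)"
  have "l2_le (carrier G) (\<lambda>g. orbit_coeff (refine_symbol \<Phi>) x u g - orbit_coeff (refine_symbol \<Phi>) y u g)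
      (L2_set ?B {1..q})"
  proof (rule l2_le_coset_split)
    fix i assume i: "i \<in> {1..q}"
    let ?w = "\<lambda>x. branch i x u"
    obtain k where "k \<in> K" "p k = p (psi i x)"
      using K by (metis UNIV_I imageE)
    \<comment> \<open>\<open>h\<close> is chosen for \<open>x\<close> and kept for \<open>y\<close>,
      so both branch points move by the same isometry.\<close>
    then obtain h where h: "h \<in> carrier G" "act h (psi i x) \<in> K"
      using fibres by metis
    let ?z = "\<lambda>x. act h (psi i x)"
    let ?v = "\<lambda>x. shift h (psi i x) (?w x)"
    let ?g = "A h \<otimes>\<^bsub>G\<^esub> gs i"
    have g: "?g \<in> carrier G"
      using h(1) i by (simp add: reps_carrier)
    have "act ?g x = rt (?z x)"
      using rti_act_coset[OF i h(1)] rt_rti by metis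
    then have "act ?g x \<in> rt ` K"
      using h(2) by simp
    note shift_close = \<Lambda>[OF g x this y]
    have dz: "dist (?z x) (?z y) \<le> \<theta> * ?d"
      using dist_psi[OF i] h(1) by (simp add: isometric)
    also have "\<dots> \<le> 1 * ?d"
      using theta by (intro mult_right_mono) auto
    finally have dz': "dist (?z x) (?z y) \<le> ?d" "dist (?z x) (?z y) < \<delta>"
      using y by auto
    have close: "norm (?v x - ?v y) \<le> (C + L) * ?d * norm u"
    proof -
      \<comment> \<open>By \<open>mt_shift\<close> each translated branch vector is
        \<open>mt\<close> applied to a shift by \<open>?g\<close>: the first term is the variation
        of the shift, the second that of \<open>mt\<close>.\<close>
      have "?v x - ?v y = mt (?z x) *v (shift ?g x u - shift ?g y u) + (mt (?z x) *v shift ?g y u - mt (?z y) *v shift ?g y u)"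
        by (simp add: matrix_vector_mult_diff_distrib flip: mt_shift[OF i h(1)])
      moreover have "norm (mt (?z x) *v (shift ?g x u - shift ?g y u)) \<le> C * ?d * norm u"
        by (rule order_trans[OF norm_mt_le shift_close])
      moreover have "norm (mt (?z x) *v shift ?g y u - mt (?z y) *v shift ?g y u) \<le> L * ?d * norm u"
        using g by (intro order_trans[OF L(1)]) (auto intro!: mult_right_mono mult_left_mono dz'(1) L(2))
      ultimately show ?thesis
        by (simp add: distrib_right norm_triangle_mono)
    qed
    have "l2_le (carrier G) (\<lambda>g. orbit_coeff \<Phi> (?z x) (?v x) g - orbit_coeff \<Phi> (?z y) (?v y) g)
        (D * dist (?z x) (?z y) * norm (?v x) + E * norm (?v x - ?v y))"
      by (rule l2_le_orbit_coeff_change[OF l2_lipschitz_onD[OF D(1) h(2) dz'(2)] E])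
    then have "l2_le (carrier G) (\<lambda>g. orbit_coeff \<Phi> (?z x) (?v x) g - orbit_coeff \<Phi> (?z y) (?v y) g) (?B i)"
    proof (rule l2_le_mono)
      show "D * dist (?z x) (?z y) * norm (?v x) + E * norm (?v x - ?v y) \<le> ?B i"
        using dz close D(2) l2_bounded_nonneg[OF E] h(1) theta
        by (intro add_mono mult_mono mult_nonneg_nonneg) auto
    qed
    \<comment> \<open>The translation is undone: shifting the index by \<open>h\<close> returns to
      the orbits of the branch points themselves.\<close>
    then have "l2_le (carrier G) (\<lambda>g. orbit_coeff \<Phi> (psi i x) (?w x) (g \<otimes>\<^bsub>G\<^esub> h) -
        orbit_coeff \<Phi> (psi i y) (?w y) (g \<otimes>\<^bsub>G\<^esub> h)) (?B i)"
      by (rule l2_le_cong[THEN iffD2, rotated]) (simp only: orbit_coeff_translate[OF _ h(1)])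
    then have "l2_le (carrier G) (\<lambda>g. orbit_coeff \<Phi> (psi i x) (?w x) g - orbit_coeff \<Phi> (psi i y) (?w y) g) (?B i)"
      by (rule l2_le_translate[OF _ h(1)])
    then show "l2_le (carrier G) (\<lambda>h. orbit_coeff (refine_symbol \<Phi>) x u (A h \<otimes>\<^bsub>G\<^esub> gs i) -
        orbit_coeff (refine_symbol \<Phi>) y u (A h \<otimes>\<^bsub>G\<^esub> gs i)) (?B i)"
      by (rule l2_le_cong[THEN iffD2, rotated]) (simp only: orbit_coeff_refine[OF i])
  qed
  then show "l2_le (carrier G) (\<lambda>g. orbit_coeff (refine_symbol \<Phi>) x u g - orbit_coeff (refine_symbol \<Phi>) y u g)
      ((\<theta> * D + E * (C + L) * sqrt q) * ?d * norm u)"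
  proof (rule l2_le_mono)
    have "0 \<le> (C + L) * ?d * norm u"
      using C L(2) by simp
    \<comment> \<open>The two parts of \<open>?B\<close> are summed separately, so that
      \<open>sqrt q\<close> falls only on the additive error.\<close>
    have "L2_set ?B {1..q} \<le> L2_set (\<lambda>i. D * (\<theta> * ?d) * norm (branch i x u)) {1..q}
        + L2_set (\<lambda>i. E * ((C + L) * ?d * norm u)) {1..q}"
      by (rule L2_set_triangle_ineq)
    also have "L2_set (\<lambda>i. D * (\<theta> * ?d) * norm (branch i x u)) {1..q} = D * (\<theta> * ?d) * norm u"
    proof -
      have "0 \<le> D * (\<theta> * ?d)"
        using D(2) theta by simp
      then show ?thesis
        by (simp only: L2_set_norm_branch flip: L2_set_right_distrib)
    qed
    also have "L2_set (\<lambda>i. E * ((C + L) * ?d * norm u)) {1..q} = sqrt q * (E * ((C + L) * ?d * norm u))"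
      using \<open>0 \<le> (C + L) * ?d * norm u\<close> l2_bounded_nonneg[OF E] by (simp add: L2_set_constant)
    finally show "L2_set ?B {1..q} \<le> (\<theta> * D + E * (C + L) * sqrt q) * ?d * norm u"
      by (simp add: algebra_simps)
  qed
qed

lemma l2_lipschitz_on_iterate:
  assumes "compact K" "p ` K = UNIV"
    and D0: "0 \<le> D0" "\<And>\<delta>. l2_lipschitz_on K \<delta> D0 \<Phi>" and E: "l2_bounded E \<Phi>"
  obtains \<delta> D where "0 < \<delta>" "\<And>k. l2_lipschitz_on K \<delta> D ((refine_symbol ^^ k) \<Phi>)"
proof -
  \<comment> \<open>The group elements for which a refinement step uses a Lipschitz bound on
    \<open>shift\<close>; they do not depend on \<open>k\<close>, so neither do \<delta> and
    \<open>C\<close>.\<close>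
  let ?\<Lambda> = "{g \<in> carrier G. \<exists>x\<in>K. act g x \<in> rt ` K}"
  have "compact (rt ` K)"
    by (rule compact_continuous_image[OF continuous_on_subset[OF continuous_rt] assms(1)]) simp
  then have "finite ?\<Lambda>"
    by (rule finite_return_set[OF assms(1)])
  then obtain \<delta> C where \<delta>: "0 < \<delta>" "0 \<le> C" "\<And>g x y u. g \<in> ?\<Lambda> \<Longrightarrow> x \<in> K \<Longrightarrow> y \<in> ball x \<delta> \<Longrightarrow>
      norm (shift g x u - shift g y u) \<le> C * dist x y * norm u"
    using shift_uniformly_lipschitz[OF assms(1), of ?\<Lambda>] by blast
  obtain L where L: "0 \<le> L" "\<And>x y u. norm (mt x *v u - mt y *v u) \<le> L * dist x y * norm u"
    by (rule mt_lipschitz) blast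
  define c where "c = E * (C + L) * sqrt q"
  \<comment> \<open>At least the initial constant, and at least the fixed point
    \<open>c / (1 - \<theta>)\<close> of the recursion \<open>D \<mapsto> \<theta> * D + c\<close>,
    so the recursion does not increase it.\<close>
  define D where "D = D0 + c / (1 - \<theta>)"
  have "0 \<le> c"
    using l2_bounded_nonneg[OF E] \<delta>(2) L(1) by (simp add: c_def)
  then have D: "D0 \<le> D" "0 \<le> D"
    using D0(1) theta by (simp_all add: D_def)
  have "c = (1 - \<theta>) * (D - D0)"
    using theta by (simp add: D_def)
  also have "\<dots> \<le> (1 - \<theta>) * D"
    using D0(1) theta by (intro mult_left_mono) auto
  finally have contract: "\<theta> * D + c \<le> D"
    by (simp add: left_diff_distrib)
  have mono: "l2_lipschitz_on K \<delta> D \<Psi>" if "l2_lipschitz_on K \<delta> D' \<Psi>" "D' \<le> D" for D' \<Psi>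
    unfolding l2_lipschitz_on_def using that(2)
    by (intro ballI allI l2_le_mono[OF l2_lipschitz_onD[OF that(1)]] mult_right_mono) auto
  have "l2_lipschitz_on K \<delta> D ((refine_symbol ^^ k) \<Phi>) \<and> l2_bounded E ((refine_symbol ^^ k) \<Phi>)" for k
  proof (induction k)
    case 0
    then show ?case
      using mono[OF D0(2) D(1)] E by simp
  next
    case (Suc k)
    have "l2_lipschitz_on K \<delta> (\<theta> * D + c) (refine_symbol ((refine_symbol ^^ k) \<Phi>))"
      unfolding c_def
    proof (rule l2_lipschitz_on_refine[OF assms(2) _ L(2,1) \<delta>(2) _ D(2)])
      show "norm (shift g x u - shift g y u) \<le> C * dist x y * norm u"
        if "g \<in> carrier G" "x \<in> K" "act g x \<in> rt ` K" "dist x y < \<delta>" for g x y u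
        using that by (intro \<delta>(3)) auto
    qed (use Suc in blast)+
    then show ?case
      using mono[OF _ contract] Suc l2_bounded_refine by simp
  qed
  then show thesis
    using that \<delta>(1) by blast
qed

end

section \<open>Symbols of module maps\<close>

lemma infsum_finite_sum:
  fixes f :: "'a \<Rightarrow> 'g \<Rightarrow> complex"
  assumes "finite J" "\<And>j. j \<in> J \<Longrightarrow> f j summable_on I"
  shows "(\<lambda>g. \<Sum>j\<in>J. f j g) summable_on I \<and> (\<Sum>\<^sub>\<infinity>g\<in>I. \<Sum>j\<in>J. f j g) = (\<Sum>j\<in>J. infsum (f j) I)"
  using assms by (induction J rule: finite_induct) (auto simp: summable_on_add infsum_add)

context transfer_setting
begin

interpretation grp: group G
  by (rule group)

text \<open>The Lipschitz constants may depend on \<open>z\<close>; the purpose is continuity in l2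
  at each point.\<close>

definition l2_regular :: "('x \<Rightarrow> complex ^ 'd) \<Rightarrow> bool" where
  "l2_regular \<Phi> \<longleftrightarrow> (\<exists>E. l2_bounded E \<Phi>) \<and> (\<forall>z. \<exists>\<delta> D. 0 < \<delta> \<and> l2_lipschitz_on {z} \<delta> D \<Phi>)"

lemma orbit_coeff_summable: "l2_regular \<Phi> \<Longrightarrow> (\<lambda>g. (cmod (orbit_coeff \<Phi> x u g))\<^sup>2) summable_on carrier G"
  unfolding l2_regular_def by (blast intro: l2_le_summable l2_boundedD)

lemma orbit_coeff_l2_continuous:
  assumes "l2_regular \<Phi>" "continuous_on UNIV w" "0 < e"
  shows "\<exists>d>0. \<forall>x. dist x z < d \<longrightarrow>
    l2_le (carrier G) (\<lambda>g. orbit_coeff \<Phi> x (w x) g - orbit_coeff \<Phi> z (w z) g) e"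
proof -
  obtain E where E: "l2_bounded E \<Phi>"
    using assms(1) by (auto simp: l2_regular_def)
  obtain \<delta> D where D: "0 < \<delta>" "l2_lipschitz_on {z} \<delta> D \<Phi>"
    using assms(1) unfolding l2_regular_def by meson
  let ?b = "\<lambda>x. D * dist z x * norm (w z) + E * norm (w z - w x)"
  have "continuous_on UNIV ?b"
    by (intro continuous_intros assms(2))
  from continuous_on_UNIV_tendsto_nhds[OF this, of z]
  have "eventually (\<lambda>x. ?b x < e) (nhds z)"
    by (rule order_tendstoD) (use assms(3) in simp)
  then obtain d where d: "0 < d" "\<And>x. dist x z < d \<Longrightarrow> ?b x < e"
    unfolding eventually_nhds_metric by blast
  have "l2_le (carrier G) (\<lambda>g. orbit_coeff \<Phi> x (w x) g - orbit_coeff \<Phi> z (w z) g) e"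
    if x: "dist x z < min d \<delta>" for x
  proof -
    have "dist z x < \<delta>"
      using x by (simp add: dist_commute)
    then have "l2_le (carrier G) (\<lambda>g. orbit_coeff \<Phi> z (w z) g - orbit_coeff \<Phi> x (w x) g) (?b x)"
      by (intro l2_le_orbit_coeff_change[OF l2_lipschitz_onD[OF D(2)] E]) auto
    then have "l2_le (carrier G) (\<lambda>g. orbit_coeff \<Phi> z (w z) g - orbit_coeff \<Phi> x (w x) g) e"
      by (rule l2_le_mono) (use d(2)[of x] x in simp)
    then show ?thesis
      by (simp add: l2_le_def norm_minus_commute)
  qed
  then show ?thesis
    using d(1) D(1) by (intro exI[of _ "min d \<delta>"]) simp
qed

lemma continuous_orbit_coeff:
  assumes "l2_regular \<Phi>" "continuous_on UNIV w" "g \<in> carrier G"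
  shows "continuous_on UNIV (\<lambda>x. orbit_coeff \<Phi> x (w x) g)"
  unfolding continuous_on_iff
proof (intro ballI allI impI)
  fix z :: 'x and e :: real assume "0 < e"
  then obtain d where d: "0 < d" "\<And>x. dist x z < d \<Longrightarrow>
      l2_le (carrier G) (\<lambda>g. orbit_coeff \<Phi> x (w x) g - orbit_coeff \<Phi> z (w z) g) (e / 2)"
    using orbit_coeff_l2_continuous[OF assms(1,2), of "e / 2" z] by auto
  have "dist (orbit_coeff \<Phi> x (w x) g) (orbit_coeff \<Phi> z (w z) g) < e" if "dist x z < d" for x
    using l2_le_component[OF d(2)[OF that] assms(3)] \<open>0 < e\<close> by (simp add: dist_norm)
  then show "\<exists>d>0. \<forall>x\<in>UNIV. dist x z < d \<longrightarrow> dist (orbit_coeff \<Phi> x (w x) g) (orbit_coeff \<Phi> z (w z) g) < e"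
    using d(1) by blast
qed

lemma continuous_orbit_coeff_square_sum:
  assumes "l2_regular \<Phi>" "continuous_on UNIV w"
  shows "continuous_on UNIV (\<lambda>x. \<Sum>\<^sub>\<infinity>g\<in>carrier G. (cmod (orbit_coeff \<Phi> x (w x) g))\<^sup>2)"
  unfolding continuous_on_eq_continuous_at[OF open_UNIV]
  by (intro ballI isCont_infsum_square orbit_coeff_summable assms(1) orbit_coeff_l2_continuous[OF assms])

text \<open>\<open>riesz_vector \<Phi> h x\<close> represents, in the coordinates at \<open>x\<close>, the value at \<open>p x\<close> of the adjoint of
  \<open>s \<mapsto> \<langle>\<Phi>, s\<rangle>\<close> applied to \<open>h\<close>.\<close>

definition riesz_vector :: "('x \<Rightarrow> complex ^ 'd) \<Rightarrow> ('x \<Rightarrow> complex) \<Rightarrow> 'x \<Rightarrow> complex ^ 'd" where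
  "riesz_vector \<Phi> h x = (\<chi> i. \<Sum>\<^sub>\<infinity>g\<in>carrier G. cnj (orbit_coeff \<Phi> x (axis i 1) g) * h (act g x))"

lemma orbit_coeff_expand:
  assumes "g \<in> carrier G"
  shows "orbit_coeff \<Phi> x u g = (\<Sum>i\<in>UNIV. u $ i * orbit_coeff \<Phi> x (axis i 1) g)"
proof -
  have add: "orbit_coeff \<Phi> x (v + w) g = orbit_coeff \<Phi> x v g + orbit_coeff \<Phi> x w g" for v w
    using assms by (simp add: orbit_coeff_def shift_add cinner_std_add_right)
  have scale: "orbit_coeff \<Phi> x (c *s v) g = c * orbit_coeff \<Phi> x v g" for c v
    using assms by (simp add: orbit_coeff_def shift_scale cinner_std_scale_right)
  have "orbit_coeff \<Phi> x (\<Sum>i\<in>J. u $ i *s axis i 1) g = (\<Sum>i\<in>J. u $ i * orbit_coeff \<Phi> x (axis i 1) g)" for J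
    by (induction J rule: infinite_finite_induct) (use scale[of 0 0] in \<open>auto simp: add scale\<close>)
  from this[of UNIV] show ?thesis
    unfolding basis_expansion .
qed

lemma Xi_summable: "h \<in> Xi G act \<Longrightarrow> (\<lambda>g. (cmod (h (act g x)))\<^sup>2) summable_on carrier G"
  by (simp add: Xi_def)

lemma orbit_pairing_summable:
  assumes "l2_regular \<Phi>" "h \<in> Xi G act"
  shows "(\<lambda>g. cnj (orbit_coeff \<Phi> x u g) * h (act g x)) summable_on carrier G"
  by (rule abs_summable_summable[OF abs_summable_cnj_mult[OF orbit_coeff_summable Xi_summable]]) fact+

lemma cinner_riesz_vector:
  assumes "l2_regular \<Phi>" "h \<in> Xi G act"
  shows "cinner_std u (riesz_vector \<Phi> h x) = (\<Sum>\<^sub>\<infinity>g\<in>carrier G. cnj (orbit_coeff \<Phi> x u g) * h (act g x))"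
proof -
  let ?f = "\<lambda>i g. cnj (u $ i) * (cnj (orbit_coeff \<Phi> x (axis i 1) g) * h (act g x))"
  have summable: "?f i summable_on carrier G" for i
    by (rule summable_on_cmult_right[OF orbit_pairing_summable[OF assms]])
  have "(\<Sum>\<^sub>\<infinity>g\<in>carrier G. cnj (orbit_coeff \<Phi> x u g) * h (act g x)) = (\<Sum>\<^sub>\<infinity>g\<in>carrier G. \<Sum>i\<in>UNIV. ?f i g)"
    by (rule infsum_cong) (simp add: orbit_coeff_expand[of _ \<Phi> x u] sum_distrib_right mult.assoc)
  also have "\<dots> = (\<Sum>i\<in>UNIV. infsum (?f i) (carrier G))"
    using infsum_finite_sum[of UNIV ?f, OF finite summable] by (rule conjunct2)
  also have "\<dots> = cinner_std u (riesz_vector \<Phi> h x)"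
    unfolding cinner_std_def riesz_vector_def vec_lambda_beta
    by (intro sum.cong refl infsum_cmult_right orbit_pairing_summable[OF assms])
  finally show ?thesis ..
qed

lemma continuous_riesz_vector:
  assumes "l2_regular \<Phi>" "h \<in> Xi G act"
  shows "continuous_on UNIV (riesz_vector \<Phi> h)"
  unfolding riesz_vector_def[abs_def]
proof (intro continuous_on_vec_lambda continuous_on_infsum_cnj_mult)
  fix i
  show "continuous_on UNIV (\<lambda>x. orbit_coeff \<Phi> x (axis i 1) g)" if "g \<in> carrier G" for g
    by (rule continuous_orbit_coeff[OF assms(1) continuous_on_const that])
  show "continuous_on UNIV (\<lambda>x. \<Sum>\<^sub>\<infinity>g\<in>carrier G. (cmod (orbit_coeff \<Phi> x (axis i 1) g))\<^sup>2)"
    by (rule continuous_orbit_coeff_square_sum[OF assms(1) continuous_on_const])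
  have h: "continuous_on UNIV h"
    using assms(2) by (simp add: Xi_def)
  show "continuous_on UNIV (\<lambda>x. h (act g x))" if "g \<in> carrier G" for g
    by (rule continuous_on_compose2[OF h continuous_act[OF that] subset_UNIV])
  show "continuous_on UNIV (\<lambda>x. \<Sum>\<^sub>\<infinity>g\<in>carrier G. (cmod (h (act g x)))\<^sup>2)"
    using assms(2) by (simp add: Xi_def)
qed (rule orbit_coeff_summable[OF assms(1)] Xi_summable[OF assms(2)])+

lemma infsum_translate:
  "k \<in> carrier G \<Longrightarrow> (\<Sum>\<^sub>\<infinity>g\<in>carrier G. f (g \<otimes>\<^bsub>G\<^esub> k)) = infsum f (carrier G)"
  using bij_betw_translate by (rule infsum_reindex_bij_betw)

text \<open>Reindexing by \<open>k\<close> and unitarity of \<open>shift k x\<close> show that the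
  fibre vector is the same at all points of the orbit, so it descends to a section over the
  quotient.\<close>

lemma tau_riesz_vector_translate:
  assumes "l2_regular \<Phi>" "h \<in> Xi G act" "k \<in> carrier G"
  shows "\<tau> (act k x) (riesz_vector \<Phi> h (act k x)) = \<tau> x (riesz_vector \<Phi> h x)"
proof -
  have "riesz_vector \<Phi> h (act k x) = shift k x (riesz_vector \<Phi> h x)"
  proof (rule cinner_std_eqI)
    fix v
    define u where "u = coord \<tau> x (\<tau> (act k x) v)"
    have v: "v = shift k x u"
      using assms(3) by (simp add: u_def shift_def)
    have "cinner_std v (riesz_vector \<Phi> h (act k x)) =
        (\<Sum>\<^sub>\<infinity>g\<in>carrier G. cnj (orbit_coeff \<Phi> x u (g \<otimes>\<^bsub>G\<^esub> k)) * h (act (g \<otimes>\<^bsub>G\<^esub> k) x))"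
      unfolding cinner_riesz_vector[OF assms(1,2)] v
      by (rule infsum_cong) (simp add: orbit_coeff_translate assms(3) act_mult)
    also have "\<dots> = cinner_std u (riesz_vector \<Phi> h x)"
      unfolding cinner_riesz_vector[OF assms(1,2)]
      using infsum_translate[OF assms(3), of "\<lambda>g. cnj (orbit_coeff \<Phi> x u g) * h (act g x)"] .
    also have "\<dots> = cinner_std v (shift k x (riesz_vector \<Phi> h x))"
      using assms(3) triv_isometric[of x u "riesz_vector \<Phi> h x"]
        ip_eq_cinner_coord[of "\<tau> x u" "act k x" "\<tau> x (riesz_vector \<Phi> h x)"]
      by (simp add: v shift_def)
    finally show "cinner_std v (riesz_vector \<Phi> h (act k x)) = cinner_std v (shift k x (riesz_vector \<Phi> h x))" .
  qed
  then show ?thesis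
    using assms(3) by (simp add: shift_def)
qed

text \<open>The norm of the coordinates depends only on the point of the quotient, so a bound on a
  compact set meeting all orbits is enough.\<close>

lemma bounded_pull_section:
  assumes "s \<in> sections \<pi>"
  obtains N where "0 \<le> N" "\<And>x. norm (pull_section p \<tau> s x) \<le> N"
proof -
  obtain K where K: "compact K" "p ` K = UNIV"
    by (rule obtain_compact_lift)
  have "compact (pull_section p \<tau> s ` K)"
    by (rule compact_continuous_image[OF continuous_on_subset[OF continuous_on_pull_section[OF assms]] K(1)]) simp
  then obtain N where N: "\<And>x. x \<in> K \<Longrightarrow> norm (pull_section p \<tau> s x) \<le> N"
    by (meson bounded_iff compact_imp_bounded imageI)
  have "norm (pull_section p \<tau> s x) \<le> N" for x
  proof -
    obtain k where k: "k \<in> K" "p k = p x"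
      using K(2) by (metis UNIV_I imageE)
    then have "norm (pull_section p \<tau> s x) = norm (pull_section p \<tau> s k)"
      using norm_coord_eq[of "s (p x)" x k] pi_section[OF assms] by (simp add: pull_section_def)
    then show ?thesis
      using N[OF k(1)] by simp
  qed
  then show thesis
    using that[of N] norm_ge_zero order_trans by blast
qed

lemma pull_section_act:
  "s \<in> sections \<pi> \<Longrightarrow> g \<in> carrier G \<Longrightarrow> pull_section p \<tau> s (act g x) = shift g x (pull_section p \<tau> s x)"
  by (simp add: shift_def) (simp add: pull_section_def)

lemma symbol_map_in_Xi:
  assumes "l2_regular \<Phi>" "s \<in> sections \<pi>"
  shows "(\<lambda>x. cinner_std (\<Phi> x) (pull_section p \<tau> s x)) \<in> Xi G act"
proof -
  let ?w = "pull_section p \<tau> s"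
  let ?f = "\<lambda>x. cinner_std (\<Phi> x) (?w x)"
  have w: "continuous_on UNIV ?w"
    by (rule continuous_on_pull_section[OF assms(2)])
  \<comment> \<open>Coordinates of a section change along the orbit exactly by \<open>shift\<close>,
    so membership in \<open>Xi\<close> becomes a statement about \<open>orbit_coeff\<close> at the
    coordinates of \<open>s\<close>.\<close>
  have coeff: "?f (act g x) = orbit_coeff \<Phi> x (?w x) g" if "g \<in> carrier G" for g x
    using that by (simp add: orbit_coeff_def pull_section_act[OF assms(2)])
  have coeff_one: "?f x = orbit_coeff \<Phi> x (?w x) \<one>\<^bsub>G\<^esub>" for x
    using coeff[of "\<one>\<^bsub>G\<^esub>" x] by simp
  have square: "(\<Sum>\<^sub>\<infinity>g\<in>carrier G. (cmod (?f (act g x)))\<^sup>2) = (\<Sum>\<^sub>\<infinity>g\<in>carrier G. (cmod (orbit_coeff \<Phi> x (?w x) g))\<^sup>2)" for x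
    by (rule infsum_cong) (simp add: coeff)
  obtain N where N: "0 \<le> N" "\<And>x. norm (?w x) \<le> N"
    by (rule bounded_pull_section[OF assms(2)]) blast
  obtain E where E: "l2_bounded E \<Phi>"
    using assms(1) by (auto simp: l2_regular_def)
  have le: "l2_le (carrier G) (orbit_coeff \<Phi> x (?w x)) (E * N)" for x
    by (rule l2_le_mono[OF l2_boundedD[OF E] mult_left_mono[OF N(2) l2_bounded_nonneg[OF E]]])
  show ?thesis
    unfolding Xi_def mem_Collect_eq
  proof (intro conjI allI)
    show "continuous_on UNIV ?f"
      unfolding coeff_one by (rule continuous_orbit_coeff[OF assms(1) w]) simp
    show "bounded (range ?f)"
      unfolding coeff_one by (rule boundedI[of _ "E * N"]) (auto intro: l2_le_component[OF le])
    show "(\<lambda>g. (cmod (?f (act g x)))\<^sup>2) summable_on carrier G" for x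
      using orbit_coeff_summable[OF assms(1), of x "?w x"] by (simp add: coeff cong: summable_on_cong)
    show "continuous_on UNIV (\<lambda>x. \<Sum>\<^sub>\<infinity>g\<in>carrier G. (cmod (?f (act g x)))\<^sup>2)"
      unfolding square by (rule continuous_orbit_coeff_square_sum[OF assms(1) w])
    show "bounded (range (\<lambda>x. \<Sum>\<^sub>\<infinity>g\<in>carrier G. (cmod (?f (act g x)))\<^sup>2))"
      unfolding square
      by (rule boundedI[of _ "(E * N)\<^sup>2"]) (auto simp: infsum_nonneg intro: l2_le_infsum[OF le])
  qed
qed

lemma symbol_map_in_Hom:
  assumes \<Phi>: "l2_regular \<Phi>"
    and W: "\<And>s. s \<in> sections \<pi> \<Longrightarrow> W s = (\<lambda>x. cinner_std (\<Phi> x) (pull_section p \<tau> s x))"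
  shows "W \<in> Hom_module G act p \<pi> vadd smul ip"
  unfolding Hom_module_def mem_Collect_eq
proof (intro conjI ballI allI impI)
  show "W s \<in> Xi G act" if "s \<in> sections \<pi>" for s
    unfolding W[OF that] by (rule symbol_map_in_Xi[OF \<Phi> that])
  show "W (\<lambda>y. vadd (s y) (t y)) = (\<lambda>x. W s x + W t x)" if s: "s \<in> sections \<pi>" and t: "t \<in> sections \<pi>" for s t
  proof -
    let ?w = "\<lambda>x. pull_section p \<tau> s x + pull_section p \<tau> t x"
    have eq: "vadd (s (p x)) (t (p x)) = \<tau> x (?w x)" for x
      by (simp add: triv_add s t)
    have "(\<lambda>y. vadd (s y) (t y)) \<in> sections \<pi>"
    proof (rule sectionI)
      show "continuous_on UNIV ?w"
        by (intro continuous_intros continuous_on_pull_section s t)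
    qed (rule eq)
    moreover have "pull_section p \<tau> (\<lambda>y. vadd (s y) (t y)) x = ?w x" for x
      by (rule pull_section_eq) (rule eq)
    ultimately show ?thesis
      by (simp add: W s t cinner_std_add_right)
  qed
  show "W (\<lambda>y. smul (c y) (s y)) = (\<lambda>x. c (p x) * W s x)" if c: "continuous_on UNIV c" and s: "s \<in> sections \<pi>" for c s
  proof -
    let ?w = "\<lambda>x. c (p x) *s pull_section p \<tau> s x"
    have eq: "smul (c (p x)) (s (p x)) = \<tau> x (?w x)" for x
      by (simp add: triv_scale s)
    have "continuous_on UNIV ?w"
      unfolding vector_scalar_mult_def
      by (intro continuous_on_vec_lambda continuous_on_mult continuous_on_component
          continuous_on_pull_section[OF s] continuous_on_compose2[OF c continuous_p subset_UNIV])
    then have "(\<lambda>y. smul (c y) (s y)) \<in> sections \<pi>"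
      by (rule sectionI) (rule eq)
    moreover have "pull_section p \<tau> (\<lambda>y. smul (c y) (s y)) x = ?w x" for x
      by (rule pull_section_eq) (rule eq)
    ultimately show ?thesis
      by (simp add: W s cinner_std_scale_right)
  qed
  let ?x = "\<lambda>y. inv_into UNIV p y"
  \<comment> \<open>The adjoint. \<open>?x y\<close> is an arbitrary preimage; translation
    invariance makes the result independent of it, so that continuity can be checked
    upstairs.\<close>
  let ?V = "\<lambda>h y. \<tau> (?x y) (riesz_vector \<Phi> h (?x y))"
  have V: "?V h (p x) = \<tau> x (riesz_vector \<Phi> h x)" if h: "h \<in> Xi G act" for h x
  proof -
    have "p x = p (?x (p x))"
      by simp
    then obtain k where "k \<in> carrier G" "?x (p x) = act k x"
      using fibres by blast
    then show ?thesis
      using tau_riesz_vector_translate[OF \<Phi> h] by simp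
  qed
  show "\<exists>V. (\<forall>f\<in>Xi G act. V f \<in> sections \<pi>) \<and>
      (\<forall>s\<in>sections \<pi>. \<forall>f\<in>Xi G act. \<forall>y. Xi_inner G act p (W s) f y = ip (s y) (V f y))"
  proof (intro exI[of _ ?V] conjI ballI allI)
    show "?V h \<in> sections \<pi>" if "h \<in> Xi G act" for h
      by (rule sectionI[OF continuous_riesz_vector[OF \<Phi> that] V[OF that]])
    show "Xi_inner G act p (W s) h y = ip (s y) (?V h y)" if s: "s \<in> sections \<pi>" and h: "h \<in> Xi G act" for s h y
    proof -
      let ?w = "pull_section p \<tau> s"
      have "Xi_inner G act p (W s) h y =
          (\<Sum>\<^sub>\<infinity>g\<in>carrier G. cnj (orbit_coeff \<Phi> (?x y) (?w (?x y)) g) * h (act g (?x y)))"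
        unfolding Xi_inner_def W[OF s]
        by (rule infsum_cong) (simp add: orbit_coeff_def pull_section_act[OF s])
      also have "\<dots> = cinner_std (?w (?x y)) (riesz_vector \<Phi> h (?x y))"
        by (rule cinner_riesz_vector[OF \<Phi> h, symmetric])
      also have "\<dots> = ip (\<tau> (?x y) (?w (?x y))) (?V h y)"
        by (rule triv_isometric[symmetric])
      also have "\<tau> (?x y) (?w (?x y)) = s y"
        by (simp add: s)
      finally show ?thesis .
    qed
  qed
qed

end

section \<open>Iterates of the refinement operator\<close>

locale refinement_start =
  refinement_setting G act p rt r \<theta> x0 A q gs \<pi> vadd smul ip charts \<tau> m l
  for G :: "('g, 'b) monoid_scheme"
    and act :: "'g \<Rightarrow> 'x::metric_space \<Rightarrow> 'x"
    and p :: "'x \<Rightarrow> 'y::metric_space"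
    and rt r \<theta> x0 A q gs
    and \<pi> :: "'e::topological_space \<Rightarrow> 'y"
    and vadd smul ip
    and charts :: "('y set \<times> ('y \<Rightarrow> complex ^ 'd \<Rightarrow> 'e)) set"
    and \<tau> m l +
  fixes f :: "'x \<Rightarrow> complex" and s0 :: "'y \<Rightarrow> 'e"
  assumes f_Xi1: "f \<in> Xi1 G act"
    and f_normalized: "Xi_inner G act p f f = (\<lambda>y. 1)"
    and s0_lipschitz: "s0 \<in> lipschitz_sections \<pi> p \<tau>"
begin

interpretation grp: group G
  by (rule group)

abbreviation "v0 \<equiv> pull_section p \<tau> s0"

definition start_symbol :: "'x \<Rightarrow> complex ^ 'd" where
  "start_symbol x = cnj (f x) *s v0 x"

text \<open>In the \<open>k\<close>-th iterate \<open>f\<close> and \<open>s0\<close> are evaluated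
  over \<open>(rti ^^ k) x\<close>, which tends to \<open>x0\<close>; only their values there
  survive.\<close>

definition limit_symbol :: "'x \<Rightarrow> complex ^ 'd" where
  "limit_symbol x = cnj (f x0) *s (adjoint_matrix (P x) *v v0 x0)"

lemma s0_section: "s0 \<in> sections \<pi>"
  using s0_lipschitz by (simp add: lipschitz_sections_def)

lemma f_Xi: "f \<in> Xi G act"
  using f_Xi1 by (simp add: Xi1_def)

lemma continuous_f: "continuous_on UNIV f"
  using f_Xi by (simp add: Xi_def)

text \<open>The normalization is stated at one preimage of each point; a right translation of the
  index moves it to any \<open>x\<close>.\<close>

lemma f_orbit_l2: "l2_le (carrier G) (\<lambda>g. f (act g x)) 1"
proof -
  let ?z = "inv_into UNIV p (p x)"
  obtain k where k: "k \<in> carrier G" "?z = act k x"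
    using fibres[of x ?z] by auto
  have "(\<Sum>\<^sub>\<infinity>g\<in>carrier G. (cmod (f (act g x)))\<^sup>2) = (\<Sum>\<^sub>\<infinity>g\<in>carrier G. (cmod (f (act (g \<otimes>\<^bsub>G\<^esub> k) x)))\<^sup>2)"
    using infsum_reindex_bij_betw[OF bij_betw_translate[OF k(1)], of "\<lambda>g. (cmod (f (act g x)))\<^sup>2"] by simp
  also have "\<dots> = (\<Sum>\<^sub>\<infinity>g\<in>carrier G. (cmod (f (act g ?z)))\<^sup>2)"
    unfolding k(2) by (rule infsum_cong) (simp add: act_mult k(1))
  also have "complex_of_real \<dots> = (\<Sum>\<^sub>\<infinity>g\<in>carrier G. cnj (f (act g ?z)) * f (act g ?z))"
    unfolding infsumI[OF has_sum_of_real[OF has_sum_infsum[OF Xi_summable[OF f_Xi]]], symmetric]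
    by (rule infsum_cong) (simp only: complex_norm_square mult.commute)
  also have "\<dots> = 1"
    using fun_cong[OF f_normalized, of "p x"] by (simp add: Xi_inner_def)
  finally have "(\<Sum>\<^sub>\<infinity>g\<in>carrier G. (cmod (f (act g x)))\<^sup>2) = 1"
    by (simp only: of_real_eq_1_iff)
  then show ?thesis
    using l2_le_sqrt_infsum[OF Xi_summable[OF f_Xi, of x]] by simp
qed

lemma f_orbit_l2_lipschitz:
  obtains D where "0 < D" "\<And>x y. l2_le (carrier G) (\<lambda>g. f (act g x) - f (act g y)) (D * dist x y)"
proof -
  obtain D where D: "0 < D" "\<And>x y. sqrt (\<Sum>\<^sub>\<infinity>g\<in>carrier G. (cmod (f (act g x) - f (act g y)))\<^sup>2) \<le> D * dist x y"
    using f_Xi1 by (auto simp: Xi1_def)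
  have "l2_le (carrier G) (\<lambda>g. f (act g x) - f (act g y)) (D * dist x y)" for x y
  proof -
    \<comment> \<open>\<open>infsum\<close> of a family that is not summable is 0, so the inequality
      in \<open>Xi1\<close> is informative only once summability is known.\<close>
    have "l2_le (carrier G) (\<lambda>g. f (act g x) + (- 1) * f (act g y)) (1 + cmod (- 1) * 1)"
      by (intro l2_le_add l2_le_scale f_orbit_l2)
    then have "(\<lambda>g. (cmod (f (act g x) - f (act g y)))\<^sup>2) summable_on carrier G"
      by (intro l2_le_summable[where B = 2]) simp
    then show ?thesis
      by (rule l2_le_mono[OF l2_le_sqrt_infsum D(2)])
  qed
  with D(1) show thesis
    by (rule that)
qed

lemma cinner_shift:
  "g \<in> carrier G \<Longrightarrow> cinner_std (shift g x u) (shift g x v) = cinner_std u v"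
  using ip_eq_cinner_coord[of "\<tau> x u" "act g x" "\<tau> x v"] by (simp add: shift_def triv_isometric)

text \<open>Transition functions are unitary, so the pairing of \<open>v0\<close> with
  \<open>u\<close> is constant along the orbit and all dependence on \<open>g\<close> lies in
  \<open>f\<close>.\<close>

lemma orbit_coeff_start:
  "g \<in> carrier G \<Longrightarrow> orbit_coeff start_symbol x u g = cinner_std (v0 x) u * f (act g x)"
  by (simp add: orbit_coeff_def start_symbol_def cinner_std_scale_left pull_section_act[OF s0_section]
      cinner_shift)

lemma l2_bounded_start:
  obtains E where "l2_bounded E start_symbol"
proof -
  obtain N where N: "0 \<le> N" "\<And>x. norm (v0 x) \<le> N"
    by (rule bounded_pull_section[OF s0_section]) blast
  have "l2_le (carrier G) (orbit_coeff start_symbol x u) (N * norm u)" for x u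
  proof -
    have "cmod (cinner_std (v0 x) u) * 1 \<le> N * norm u"
      using norm_cinner_std_le[of "v0 x" u] mult_right_mono[OF N(2) norm_ge_zero, of x u] by simp
    then have "l2_le (carrier G) (\<lambda>g. cinner_std (v0 x) u * f (act g x)) (N * norm u)"
      by (rule l2_le_mono[OF l2_le_scale[OF f_orbit_l2]])
    then show ?thesis
      by (rule l2_le_cong[THEN iffD1, rotated]) (simp add: orbit_coeff_start)
  qed
  then have "l2_bounded N start_symbol"
    by (simp add: l2_bounded_def)
  then show thesis
    by (rule that)
qed

lemma l2_lipschitz_start:
  obtains D where "0 \<le> D" "\<And>K \<delta>. l2_lipschitz_on K \<delta> D start_symbol"
proof -
  obtain N where N: "0 \<le> N" "\<And>x. norm (v0 x) \<le> N"
    by (rule bounded_pull_section[OF s0_section]) blast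
  obtain D where D: "0 < D" "\<And>x y. l2_le (carrier G) (\<lambda>g. f (act g x) - f (act g y)) (D * dist x y)"
    by (rule f_orbit_l2_lipschitz) blast
  obtain L where L: "L-lipschitz_on UNIV v0"
    using s0_lipschitz by (auto simp: lipschitz_sections_def)
  have "l2_le (carrier G) (\<lambda>g. orbit_coeff start_symbol x u g - orbit_coeff start_symbol y u g)
      ((N * D + L) * dist x y * norm u)" for x y u
  proof -
    have 1: "cmod (cinner_std (v0 x) u) * (D * dist x y) \<le> (N * norm u) * (D * dist x y)"
      using norm_cinner_std_le[of "v0 x" u] mult_right_mono[OF N(2) norm_ge_zero, of x u] D(1)
      by (intro mult_right_mono) auto
    have 2: "cmod (cinner_std (v0 x - v0 y) u) * 1 \<le> L * dist x y * norm u"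
      using norm_cinner_std_le[of "v0 x - v0 y" u] lipschitz_onD[OF L, of x y]
        mult_right_mono[of "norm (v0 x - v0 y)" "L * dist x y" "norm u"]
      by (simp add: dist_norm)
    \<comment> \<open>Product rule: the first term varies \<open>f\<close>, the second the section,
      with \<open>f\<close> measured by its normalization.\<close>
    have "l2_le (carrier G) (\<lambda>g. cinner_std (v0 x) u * (f (act g x) - f (act g y)) + cinner_std (v0 x - v0 y) u * f (act g y))
        ((N * norm u) * (D * dist x y) + L * dist x y * norm u)"
      by (rule l2_le_add[OF l2_le_mono[OF l2_le_scale[OF D(2)] 1] l2_le_mono[OF l2_le_scale[OF f_orbit_l2] 2]])
    then have "l2_le (carrier G) (\<lambda>g. cinner_std (v0 x) u * (f (act g x) - f (act g y)) + cinner_std (v0 x - v0 y) u * f (act g y))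
        ((N * D + L) * dist x y * norm u)"
      by (simp add: algebra_simps)
    then show ?thesis
      by (rule l2_le_cong[THEN iffD1, rotated])
        (simp add: orbit_coeff_start cinner_std_diff_left algebra_simps)
  qed
  then have "l2_lipschitz_on K \<delta> (N * D + L) start_symbol" for K \<delta>
    by (simp add: l2_lipschitz_on_def)
  moreover have "0 \<le> N * D + L"
    using N(1) D(1) lipschitz_on_nonneg[OF L] by simp
  ultimately show thesis
    using that by blast
qed

lemma l2_regular_start: "l2_regular start_symbol"
  unfolding l2_regular_def
  by (metis l2_bounded_start l2_lipschitz_start zero_less_one)

text \<open>The adjoint factors collect into \<open>B k x\<close> on the other side of the pairing;
  in this form each factor has an evident limit.\<close>

lemma cinner_refine_pow:
  "cinner_std ((refine_symbol ^^ k) start_symbol x) u =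
    f ((rti ^^ k) x) * cinner_std (v0 ((rti ^^ k) x)) (B k x *v u)"
proof (induction k arbitrary: x u)
  case 0
  then show ?case
    by (simp add: start_symbol_def cinner_std_scale_left)
next
  case (Suc k)
  have "cinner_std ((refine_symbol ^^ Suc k) start_symbol x) u =
      cinner_std ((refine_symbol ^^ k) start_symbol (rti x)) (mt (rti x) *v u)"
    by (simp add: refine_symbol_def cinner_std_adjoint)
  then show ?case
    unfolding Suc by (simp add: B_Suc funpow_swap1 matrix_vector_mul_assoc)
qed

lemma start_map_eq: "start_map p ip f s0 s = (\<lambda>x. cinner_std (start_symbol x) (pull_section p \<tau> s x))"
  if "s \<in> sections \<pi>"
proof
  fix x
  have "ip (s0 (p x)) (s (p x)) = cinner_std (v0 x) (pull_section p \<tau> s x)"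
    unfolding pull_section_def
    by (rule ip_eq_cinner_coord) (simp_all add: pi_section[OF s0_section] pi_section[OF that])
  then show "start_map p ip f s0 s x = cinner_std (start_symbol x) (pull_section p \<tau> s x)"
    by (simp add: start_map_def start_symbol_def cinner_std_scale_left)
qed

lemma refinement_pow_eq:
  "s \<in> sections \<pi> \<Longrightarrow> (refinement_op rt r m ^^ k) (start_map p ip f s0) s x =
    cinner_std ((refine_symbol ^^ k) start_symbol x) (pull_section p \<tau> s x)"
proof (induction k arbitrary: s x)
  case 0
  then show ?case
    by (simp add: start_map_eq)
next
  case (Suc k)
  have "(refinement_op rt r m ^^ Suc k) (start_map p ip f s0) s x =
      (refinement_op rt r m ^^ k) (start_map p ip f s0) (\<lambda>y. m y (s (r y))) (rti x)"
    by (simp add: refinement_op_def)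
  also have "\<dots> = cinner_std ((refine_symbol ^^ k) start_symbol (rti x)) (mt (rti x) *v pull_section p \<tau> s x)"
    unfolding Suc.IH[OF filtered_section[OF Suc.prems]] pull_filtered_section[OF Suc.prems] by simp
  also have "\<dots> = cinner_std ((refine_symbol ^^ Suc k) start_symbol x) (pull_section p \<tau> s x)"
    by (simp add: refine_symbol_def cinner_std_adjoint)
  finally show ?case .
qed

lemma cinner_limit_symbol: "cinner_std (limit_symbol x) u = f x0 * cinner_std (v0 x0) (P x *v u)"
  by (simp add: limit_symbol_def cinner_std_scale_left cinner_std_adjoint)

lemma uniform_limit_rti_pow:
  fixes h :: "'x \<Rightarrow> 'c :: metric_space"
  assumes "bounded C" "continuous_on UNIV h"
  shows "uniform_limit C (\<lambda>k x. h ((rti ^^ k) x)) (\<lambda>_. h x0) sequentially"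
proof (rule uniform_limitI)
  fix e :: real assume "0 < e"
  then obtain d where d: "0 < d" "\<And>x. dist x x0 < d \<Longrightarrow> dist (h x) (h x0) < e"
    using assms(2) unfolding continuous_on_iff by blast
  obtain R where R: "\<And>x. x \<in> C \<Longrightarrow> dist x0 x \<le> R"
    using assms(1) unfolding bounded_any_center[of C x0] by blast
  have "(\<lambda>k. \<theta> ^ k * R) \<longlonglongrightarrow> 0"
    using theta by (intro tendsto_mult_left_zero LIMSEQ_power_zero) auto
  then have "eventually (\<lambda>k. \<theta> ^ k * R < d) sequentially"
    using d(1) by (rule order_tendstoD)
  then show "eventually (\<lambda>k. \<forall>x\<in>C. dist (h ((rti ^^ k) x)) (h x0) < e) sequentially"
  proof eventually_elim
    case (elim k)
    have "dist ((rti ^^ k) x) x0 < d" if "x \<in> C" for x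
    proof -
      have "dist ((rti ^^ k) x) x0 \<le> \<theta> ^ k * R"
        using theta R[OF that]
        by (intro order_trans[OF dist_rti_pow_x0] mult_left_mono) (auto simp: dist_commute)
      then show ?thesis
        using elim by simp
    qed
    then show ?case
      using d(2) by blast
  qed
qed

text \<open>\<open>w\<close> is arbitrary, so that both the coordinates of a section and the vectors
  occurring in \<open>orbit_coeff\<close> are covered.\<close>

lemma uniform_limit_symbol:
  assumes "bounded C" "bounded (w ` C)"
  shows "uniform_limit C (\<lambda>k x. cinner_std ((refine_symbol ^^ k) start_symbol x) (w x))
    (\<lambda>x. cinner_std (limit_symbol x) (w x)) sequentially"
  unfolding cinner_refine_pow cinner_limit_symbol
proof (intro uniform_lim_mult bounded_bilinear.bounded_uniform_limit[OF bounded_bilinear_cinner_std]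
    bounded_bilinear.bounded_uniform_limit[OF bounded_bilinear_matrix_vector_mult])
  show "uniform_limit C (\<lambda>k x. f ((rti ^^ k) x)) (\<lambda>_. f x0) sequentially"
    by (rule uniform_limit_rti_pow[OF assms(1) continuous_f])
  show "uniform_limit C (\<lambda>k x. v0 ((rti ^^ k) x)) (\<lambda>_. v0 x0) sequentially"
    by (rule uniform_limit_rti_pow[OF assms(1) continuous_on_pull_section[OF s0_section]])
  show "uniform_limit C B P sequentially"
    by (rule uniform_limit_B[OF assms(1)])
  show "uniform_limit C (\<lambda>_. w) w sequentially"
    by (rule uniform_limit_const)
  show "bounded (w ` C)"
    by fact
  have "norm (P x) \<le> (real CARD('d))\<^sup>2 * 1" for x
    by (rule norm_matrix_le) (simp add: norm_P_le)
  then show "bounded (P ` C)"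
    by (intro boundedI) auto
  obtain N where N: "\<And>x. x \<in> C \<Longrightarrow> norm (w x) \<le> N"
    using assms(2) by (auto simp: bounded_iff)
  have Pw: "norm (P x *v w x) \<le> N" if "x \<in> C" for x
    using norm_P_le N[OF that] by (rule order_trans)
  then show "bounded ((\<lambda>x. P x *v w x) ` C)"
    by (intro boundedI[of _ N]) auto
  show "bounded ((\<lambda>_. f x0) ` C)" "bounded ((\<lambda>_. v0 x0) ` C)"
    by (auto intro!: boundedI)
  have "cmod (cinner_std (v0 x0) (P x *v w x)) \<le> norm (v0 x0) * N" if "x \<in> C" for x
    by (rule order_trans[OF norm_cinner_std_le mult_left_mono[OF Pw[OF that]]]) simp
  then show "bounded ((\<lambda>x. cinner_std (v0 x0) (P x *v w x)) ` C)"
    by (intro boundedI[of _ "norm (v0 x0) * N"]) auto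
qed

lemma tendsto_orbit_coeff:
  "(\<lambda>k. orbit_coeff ((refine_symbol ^^ k) start_symbol) x u g) \<longlonglongrightarrow> orbit_coeff limit_symbol x u g"
  using uniform_limit_symbol[of "{act g x}" "\<lambda>_. shift g x u"] by (simp add: orbit_coeff_def)

lemma l2_regular_limit: "l2_regular limit_symbol"
  unfolding l2_regular_def
proof (intro conjI allI)
  obtain E where E: "l2_bounded E start_symbol"
    by (rule l2_bounded_start)
  have bounded: "l2_bounded E ((refine_symbol ^^ k) start_symbol)" for k
    by (induction k) (simp_all add: E l2_bounded_refine)
  have "l2_bounded E limit_symbol"
    unfolding l2_bounded_def
    by (intro allI l2_le_limit[OF l2_boundedD[OF bounded] tendsto_orbit_coeff])
  then show "\<exists>E. l2_bounded E limit_symbol" ..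
  fix z
  obtain K where K: "compact K" "p ` K = UNIV"
    by (rule obtain_compact_lift)
  \<comment> \<open>The point \<open>z\<close> joins the compact set, so that the uniform estimate
    is available there.\<close>
  then have K': "compact (insert z K)" "p ` insert z K = UNIV"
    by (auto simp: compact_insert)
  obtain D0 where D0: "0 \<le> D0" "\<And>K \<delta>. l2_lipschitz_on K \<delta> D0 start_symbol"
    by (rule l2_lipschitz_start) blast
  obtain \<delta> D where D: "0 < \<delta>" "\<And>k. l2_lipschitz_on (insert z K) \<delta> D ((refine_symbol ^^ k) start_symbol)"
    by (rule l2_lipschitz_on_iterate[OF K' D0(1) D0(2) E]) blast
  have "l2_lipschitz_on {z} \<delta> D limit_symbol"
    unfolding l2_lipschitz_on_def
  proof (intro ballI allI)
    fix x y u assume x: "x \<in> {z}" and y: "y \<in> ball x \<delta>"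
    show "l2_le (carrier G) (\<lambda>g. orbit_coeff limit_symbol x u g - orbit_coeff limit_symbol y u g)
        (D * dist x y * norm u)"
    proof (rule l2_le_limit)
      show "l2_le (carrier G) (\<lambda>g. orbit_coeff ((refine_symbol ^^ k) start_symbol) x u g -
          orbit_coeff ((refine_symbol ^^ k) start_symbol) y u g) (D * dist x y * norm u)" for k
        by (rule l2_lipschitz_onD[OF D(2)]) (use x y in auto)
      show "(\<lambda>k. orbit_coeff ((refine_symbol ^^ k) start_symbol) x u g -
          orbit_coeff ((refine_symbol ^^ k) start_symbol) y u g) \<longlonglongrightarrow>
          orbit_coeff limit_symbol x u g - orbit_coeff limit_symbol y u g" for g
        by (intro tendsto_diff tendsto_orbit_coeff)
    qed
  qed
  with D(1) show "\<exists>\<delta> D. 0 < \<delta> \<and> l2_lipschitz_on {z} \<delta> D limit_symbol"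
    by blast
qed

lemma limit_map_eq:
  assumes "s \<in> sections \<pi>"
  shows "limit_map p rt r ip m f s0 s = (\<lambda>x. cinner_std (limit_symbol x) (pull_section p \<tau> s x))"
proof
  fix x
  have "(\<lambda>k. cinner_std ((refine_symbol ^^ k) start_symbol x) (pull_section p \<tau> s x))
      \<longlonglongrightarrow> cinner_std (limit_symbol x) (pull_section p \<tau> s x)"
    using uniform_limit_symbol[of "{x}" "pull_section p \<tau> s"] by simp
  then show "limit_map p rt r ip m f s0 s x = cinner_std (limit_symbol x) (pull_section p \<tau> s x)"
    unfolding limit_map_def refinement_pow_eq[OF assms] by (rule limI)
qed

text \<open>\<open>s0\<close> enters only through its value over \<open>x0\<close>, which gives
  independence of the rest of the section; and \<open>x\<close> enters through \<open>P x\<close>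
  and \<open>s\<close>, so the refinement equation of \<open>P\<close> carries over.\<close>

lemma limit_map_value:
  "s \<in> sections \<pi> \<Longrightarrow>
    limit_map p rt r ip m f s0 s x = cinner_std (v0 x0) (P x *v pull_section p \<tau> s x) * f x0"
  by (simp add: limit_map_eq cinner_limit_symbol mult.commute)

lemma uniform_limit_map:
  assumes "s \<in> sections \<pi>" "compact C"
  shows "uniform_limit C (\<lambda>k. (refinement_op rt r m ^^ k) (start_map p ip f s0) s)
    (limit_map p rt r ip m f s0 s) sequentially"
proof -
  have "bounded (pull_section p \<tau> s ` C)"
    by (intro compact_imp_bounded compact_continuous_image assms(2)
        continuous_on_subset[OF continuous_on_pull_section[OF assms(1)]]) simp
  then have "uniform_limit C (\<lambda>k x. (refinement_op rt r m ^^ k) (start_map p ip f s0) s x)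
      (limit_map p rt r ip m f s0 s) sequentially"
    unfolding limit_map_eq[OF assms(1)] refinement_pow_eq[OF assms(1)]
    by (rule uniform_limit_symbol[OF compact_imp_bounded[OF assms(2)]])
  then show ?thesis .
qed

lemma start_map_Hom: "start_map p ip f s0 \<in> Hom_module G act p \<pi> vadd smul ip"
  by (rule symbol_map_in_Hom[OF l2_regular_start start_map_eq])

lemma limit_map_Hom: "limit_map p rt r ip m f s0 \<in> Hom_module G act p \<pi> vadd smul ip"
  by (rule symbol_map_in_Hom[OF l2_regular_limit limit_map_eq])

lemma limit_map_Xi: "s \<in> sections \<pi> \<Longrightarrow> limit_map p rt r ip m f s0 s \<in> Xi G act"
  using limit_map_Hom by (simp add: Hom_module_def)

lemma refinement_limit_map:
  assumes "s \<in> sections \<pi>"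
  shows "refinement_op rt r m (limit_map p rt r ip m f s0) s = limit_map p rt r ip m f s0 s"
proof
  fix x
  show "refinement_op rt r m (limit_map p rt r ip m f s0) s x = limit_map p rt r ip m f s0 s x"
    by (simp add: refinement_op_def limit_map_value[OF filtered_section[OF assms]] limit_map_value[OF assms]
        pull_filtered_section[OF assms] P_mult_refine)
qed

lemma limit_map_x0:
  assumes "s \<in> sections \<pi>"
  shows "limit_map p rt r ip m f s0 s x0 = cinner_std (P x0 *v v0 x0) (pull_section p \<tau> s x0) * f x0"
proof -
  have "adjoint_matrix (P x0) = P x0"
    using P_x0_projection by (simp add: is_orth_proj_onto_def)
  then show ?thesis
    using cinner_std_adjoint[of "P x0" "v0 x0"] by (simp add: limit_map_value[OF assms])
qed

end

theorem theorem6p2: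
  fixes G :: "('g, 'b) monoid_scheme"
    and act :: "'g \<Rightarrow> 'x::metric_space \<Rightarrow> 'x"
    and p :: "'x \<Rightarrow> 'y::metric_space"
    and \<pi> :: "'e::topological_space \<Rightarrow> 'y"
    and charts :: "('y set \<times> ('y \<Rightarrow> complex ^ 'd \<Rightarrow> 'e)) set"
    and \<tau> :: "'x \<Rightarrow> complex ^ 'd \<Rightarrow> 'e"
    and m :: "'y \<Rightarrow> 'e \<Rightarrow> 'e"
    and l :: nat
  assumes setting: "transfer_setting G act p rt r \<theta> x0 A q gs \<pi> vadd smul ip charts \<tau> m"
    and R_one: "transfer_op act p rt r q gs \<pi> vadd smul ip m (\<lambda>a. a) = (\<lambda>a. a)"
    and l: "1 \<le> l" "l \<le> CARD('d)"
    and E_l: "E_condition l (pull_filter p rt \<tau> m x0)"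
  shows "let mt = pull_filter p rt \<tau> m;
             P = limit_product mt rt;
             E1 = {v. mt x0 *v v = v};
             rti = inv_into UNIV rt;
             S = sections \<pi>;
             S1 = lipschitz_sections \<pi> p \<tau>;
             Hom = Hom_module G act p \<pi> vadd smul ip;
             M = refinement_op rt r m
         in
           ((\<forall>x. (\<lambda>k. backward_product mt rt k x) \<longlonglongrightarrow> P x) \<and>
            (\<forall>K. compact K \<longrightarrow> uniform_limit K (backward_product mt rt) P sequentially) \<and>
            (\<forall>x. P (rti x) ** mt (rti x) = P x) \<and>
            is_orth_proj_onto (P x0) E1 \<and>
            (\<forall>x. range ((*v) (P x)) \<subseteq> E1) \<and>
            (\<forall>x. mt x0 ** P x = P x) \<and>
            (\<forall>g\<in>carrier G. g \<noteq> \<one>\<^bsub>G\<^esub> \<longrightarrow>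
               (\<forall>v\<in>E1. P (act g x0) *v coord \<tau> (act g x0) (\<tau> x0 v) = 0)))
           \<and>
           (\<forall>f\<in>Xi1 G act.
              Xi_inner G act p f f = (\<lambda>y. 1) \<longrightarrow>
              (\<forall>g\<in>carrier G. g \<noteq> \<one>\<^bsub>G\<^esub> \<longrightarrow> f (act g x0) = 0) \<longrightarrow>
              (\<forall>s0\<in>S1.
                 let v = pull_section p \<tau> s0 x0;
                     W0 = start_map p ip f s0;
                     W = limit_map p rt r ip m f s0
                 in
                   W0 \<in> Hom \<and>
                   (\<forall>s\<in>S.
                      (\<forall>K. compact K \<longrightarrow>
                         uniform_limit K (\<lambda>k. (M ^^ k) W0 s) (W s) sequentially) \<and>
                      continuous_on UNIV (W s) \<and>
                      W s \<in> Xi G act \<and>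
                      (\<forall>x. W s x = cinner_std v (P x *v pull_section p \<tau> s x) * f x0)) \<and>
                   W \<in> Hom \<and>
                   (\<forall>s0'\<in>S1. pull_section p \<tau> s0' x0 = v \<longrightarrow>
                      (\<forall>s\<in>S. limit_map p rt r ip m f s0' s = W s)) \<and>
                   (\<forall>s\<in>S. M W s = W s) \<and>
                   (\<forall>s\<in>S. W s x0 = cinner_std (P x0 *v v) (pull_section p \<tau> s x0) * f x0)))"
proof -
  interpret transfer_setting G act p rt r \<theta> x0 A q gs \<pi> vadd smul ip charts \<tau> m
    by (rule setting)
  interpret refinement_setting G act p rt r \<theta> x0 A q gs \<pi> vadd smul ip charts \<tau> m l
    by unfold_locales (rule R_one, rule E_l)
  have start: "refinement_start G act p rt r \<theta> x0 A q gs \<pi> vadd smul ip charts \<tau> m l f s0"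
    if "f \<in> Xi1 G act" "Xi_inner G act p f f = (\<lambda>y. 1)" "s0 \<in> lipschitz_sections \<pi> p \<tau>" for f s0
    by unfold_locales fact+
  show ?thesis
    unfolding Let_def
  proof (rule conjI)
    show "(\<forall>x. (\<lambda>k. B k x) \<longlonglongrightarrow> P x) \<and>
        (\<forall>K. compact K \<longrightarrow> uniform_limit K B P sequentially) \<and>
        (\<forall>x. P (rti x) ** mt (rti x) = P x) \<and>
        is_orth_proj_onto (P x0) {v. mt x0 *v v = v} \<and>
        (\<forall>x. range ((*v) (P x)) \<subseteq> {v. mt x0 *v v = v}) \<and>
        (\<forall>x. mt x0 ** P x = P x) \<and>
        (\<forall>g\<in>carrier G. g \<noteq> \<one>\<^bsub>G\<^esub> \<longrightarrow>
           (\<forall>v\<in>{v. mt x0 *v v = v}. P (act g x0) *v coord \<tau> (act g x0) (\<tau> x0 v) = 0))"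
      using tendsto_B uniform_limit_B[OF compact_imp_bounded] P_refine P_x0_projection mt_x0_P_mult P_translate_x0
      by (auto simp: matrix_eq simp flip: matrix_vector_mul_assoc)
  next
    show "\<forall>f\<in>Xi1 G act. Xi_inner G act p f f = (\<lambda>y. 1) \<longrightarrow>
        (\<forall>g\<in>carrier G. g \<noteq> \<one>\<^bsub>G\<^esub> \<longrightarrow> f (act g x0) = 0) \<longrightarrow>
        (\<forall>s0\<in>lipschitz_sections \<pi> p \<tau>.
          start_map p ip f s0 \<in> Hom_module G act p \<pi> vadd smul ip \<and>
          (\<forall>s\<in>sections \<pi>.
            (\<forall>K. compact K \<longrightarrow> uniform_limit K (\<lambda>k. (refinement_op rt r m ^^ k) (start_map p ip f s0) s)
              (limit_map p rt r ip m f s0 s) sequentially) \<and>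
            continuous_on UNIV (limit_map p rt r ip m f s0 s) \<and>
            limit_map p rt r ip m f s0 s \<in> Xi G act \<and>
            (\<forall>x. limit_map p rt r ip m f s0 s x =
              cinner_std (pull_section p \<tau> s0 x0) (P x *v pull_section p \<tau> s x) * f x0)) \<and>
          limit_map p rt r ip m f s0 \<in> Hom_module G act p \<pi> vadd smul ip \<and>
          (\<forall>s0'\<in>lipschitz_sections \<pi> p \<tau>. pull_section p \<tau> s0' x0 = pull_section p \<tau> s0 x0 \<longrightarrow>
            (\<forall>s\<in>sections \<pi>. limit_map p rt r ip m f s0' s = limit_map p rt r ip m f s0 s)) \<and>
          (\<forall>s\<in>sections \<pi>. refinement_op rt r m (limit_map p rt r ip m f s0) s = limit_map p rt r ip m f s0 s) \<and>
          (\<forall>s\<in>sections \<pi>. limit_map p rt r ip m f s0 s x0 =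
            cinner_std (P x0 *v pull_section p \<tau> s0 x0) (pull_section p \<tau> s x0) * f x0))"
    proof (intro ballI impI)
      fix f s0
      assume f: "f \<in> Xi1 G act" "Xi_inner G act p f f = (\<lambda>y. 1)" and s0: "s0 \<in> lipschitz_sections \<pi> p \<tau>"
      interpret refinement_start G act p rt r \<theta> x0 A q gs \<pi> vadd smul ip charts \<tau> m l f s0
        by (rule start[OF f s0])
      have same: "limit_map p rt r ip m f s0' s = limit_map p rt r ip m f s0 s"
        if s0': "s0' \<in> lipschitz_sections \<pi> p \<tau>" "pull_section p \<tau> s0' x0 = pull_section p \<tau> s0 x0"
          and s: "s \<in> sections \<pi>" for s0' s
        using refinement_start.limit_map_value[OF start[OF f s0'(1)] s] limit_map_value[OF s] s0'(2) by auto
      have "continuous_on UNIV (limit_map p rt r ip m f s0 s)" if "s \<in> sections \<pi>" for s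
        using limit_map_Xi[OF that] by (simp add: Xi_def)
      then show "start_map p ip f s0 \<in> Hom_module G act p \<pi> vadd smul ip \<and>
          (\<forall>s\<in>sections \<pi>.
            (\<forall>K. compact K \<longrightarrow> uniform_limit K (\<lambda>k. (refinement_op rt r m ^^ k) (start_map p ip f s0) s)
              (limit_map p rt r ip m f s0 s) sequentially) \<and>
            continuous_on UNIV (limit_map p rt r ip m f s0 s) \<and>
            limit_map p rt r ip m f s0 s \<in> Xi G act \<and>
            (\<forall>x. limit_map p rt r ip m f s0 s x =
              cinner_std (pull_section p \<tau> s0 x0) (P x *v pull_section p \<tau> s x) * f x0)) \<and>
          limit_map p rt r ip m f s0 \<in> Hom_module G act p \<pi> vadd smul ip \<and>
          (\<forall>s0'\<in>lipschitz_sections \<pi> p \<tau>. pull_section p \<tau> s0' x0 = pull_section p \<tau> s0 x0 \<longrightarrow>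
            (\<forall>s\<in>sections \<pi>. limit_map p rt r ip m f s0' s = limit_map p rt r ip m f s0 s)) \<and>
          (\<forall>s\<in>sections \<pi>. refinement_op rt r m (limit_map p rt r ip m f s0) s = limit_map p rt r ip m f s0 s) \<and>
          (\<forall>s\<in>sections \<pi>. limit_map p rt r ip m f s0 s x0 =
            cinner_std (P x0 *v pull_section p \<tau> s0 x0) (pull_section p \<tau> s x0) * f x0)"
        by (intro conjI ballI allI impI start_map_Hom uniform_limit_map limit_map_Xi limit_map_value limit_map_Hom
            same refinement_limit_map limit_map_x0)
    qed
  qed
qed

end
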